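(* Let $\lambda\in\mathbb C^*$, $\mu\in\mathbb C$ and $c(z)=\sum_{n\le0}c_nz^{-n-2}\in\mathbb C((z))$. Set $\chi(z)=\frac{\lambda\mu}{z^3}+c(z)$. Then $$V_{\widehat{\mathfrak{sl}_2}}(\lambda,\mu,-2,c(z))\cong M_T(\chi(z))\otimes\Pi_\lambda$$ as $\widehat{\mathfrak{sl}_2}$-modules.
   Context: $\mathfrak{sl}_2$: basis $e,f,h$, $[e,f]=h$, $[h,e]=2e$, $[h,f]=-2f$, form $(e,f)=1$, $(h,h)=2$ (other pairings zero). $\widehat{\mathfrak{sl}_2}=\mathfrak{sl}_2\otimes\mathbb C[t,t^{-1}]\oplus\mathbb Cc$, $c$ central, $x(n)=x\otimes t^n$, $[x(n),y(m)]=[x,y](n+m)+n(x,y)\delta_{n+m,0}c$; $x(z)=\sum_nx(n)z^{-n-1}$. Level $\kappa$: $c$ acts as $\kappa\,\mathrm{Id}$. $V_{\widehat{\mathfrak{sl}_2}}(\lambda,\mu,-2)=U(\widehat{\mathfrak{sl}_2})/J$, with $J$ the left ideal generated by $e(0)-\lambda$, $f(1)-\mu$, $c+2$, $e(i),h(i),f(i+1)$ $(i\ge1)$; $w$ is the image of $1$. On it $T(n)=\frac12\sum_k(:e(k)f(n-k):+:f(k)e(n-k):+\frac12:h(k)h(n-k):)$, with $:x(k)y(m):=x(k)y(m)$ for $k<0$ and $y(m)x(k)$ for $k\ge0$; these commute with $\widehat{\mathfrak{sl}_2}$. $V_{\widehat{\mathfrak{sl}_2}}(\lambda,\mu,-2,c(z))$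 is the quotient of $V_{\widehat{\mathfrak{sl}_2}}(\lambda,\mu,-2)$ by the submodule generated by $(T(n)-c_n)w$, $n\le0$. Vertex algebra $\Pi(0)$: let $L=\mathbb Z\alpha+\mathbb Z\beta$ with $\langle\alpha,\alpha\rangle=1=-\langle\beta,\beta\rangle$, $\langle\alpha,\beta\rangle=0$; $\Pi(0)=M_{\alpha,\beta}(1)\otimes\mathbb C[\mathbb Z(\alpha+\beta)]$ inside the lattice vertex superalgebra $V_L$, $M_{\alpha,\beta}(1)$ being the Heisenberg vertex algebra generated by $\alpha(z),\beta(z)$. Put $a=e^{\alpha+\beta}$, $a^{-1}=e^{-\alpha-\beta}$, $a^*=-\alpha(-1)e^{-\alpha-\beta}$; fields $a(z)=\sum a(n)z^{-n-1}$, $a^{-1}(z)=\sum a^{-1}(n)z^{-n+1}$, $a^*(z)=\sum a^*(n)z^{-n}$. The modes satisfy $[a(n),a^*(m)]=\delta_{n+m,0}$, $[a(n),a(m)]=[a^*(n),a^*(m)]=0$. $\Pi_\lambda$ is the following $\Pi(0)$-module. Write $x=\alpha+\beta$, $y=\alpha-\beta$. As a vector space $\Pi_\lambda=\mathbb C[y(0),x(-n),y(-n)\mid n\ge1]w_\lambda$, with $[x(m),y(n)]=2m\delta_{m+n,0}$, $[x(m),x(n)]=[y(m),y(n)]=0$, $x(0)=-\mathrm{Id}$, $x(n)w_\lambda=y(n)w_\lambda=0$ for $n\ge1$, $y(0)$ acting freely, and $$Y(e^{mx},z)=E^m z^{-m}\exp\Big(m\sum_{k\ge1}\tfrac{x(-k)}{k}z^k\Big)\exp\Big(-m\sum_{k\ge1}\tfrac{x(k)}{k}z^{-k}\Big),$$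 where $E^m w_\lambda=\lambda^mw_\lambda$, $[y(0),E^m]=2mE^m$, and $E^m$ commutes with all $x(n)$ and with $y(n)$, $n\ne0$. In particular $a(0)w_\lambda=\lambda w_\lambda$, $a^{-1}(0)w_\lambda=\lambda^{-1}w_\lambda$, $a(n)w_\lambda=a^{-1}(n)w_\lambda=0$ for $n\ge1$. For $\chi(z)=\sum_n\chi(n)z^{-n-2}\in\mathbb C((z))$, $M_T(\chi(z))$ is the $1$-dimensional module over the commutative vertex algebra $M_T(0)$ (generated by $T(z)=\sum T(n)z^{-n-2}$) on which $T(n)$ acts as $\chi(n)$. The level $-2$ action of $\widehat{\mathfrak{sl}_2}$ on $M_T(\chi(z))\otimes\Pi_\lambda$ is $$e(z)=a(z),\quad h(z)=-2:a^*(z)a(z):,\quad f(z)=-:a^*(z)^2a(z):-2\partial_za^*(z)+\chi(z)a^{-1}(z),$$ where $:a^*(z)^ja(z):=a(z)^+a^*(z)^j+a^*(z)^ja(z)^-$, $a(z)^+=\sum_{n\le-1}a(n)z^{-n-1}$, $a(z)^-=\sum_{n\ge0}a(n)z^{-n-1}$. *)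

theory Defs
  imports
    "HOL-Algebra.QuotRing"
    "HOL-Algebra.Module"
    "HOL-Algebra.Algebraic_Closure_Type"
    "HOL-Library.Poly_Mapping"
    "HOL-Library.Product_Plus"
    "HOL-Computational_Algebra.Formal_Laurent_Series"
begin

hide_const (open) Polynomial.smult Multiset.mult

section \<open>The affine Lie algebra of type sl2\<close>

text \<open>The triple \<open>(a, b, c)\<close> stands for \<open>a e + b f + c h\<close>.\<close>
type_synonym sl2 = "complex \<times> complex \<times> complex"

definition sl2_e :: sl2 where "sl2_e = (1, 0, 0)"
definition sl2_f :: sl2 where "sl2_f = (0, 1, 0)"
definition sl2_h :: sl2 where "sl2_h = (0, 0, 1)"

definition sl2_scale :: "complex \<Rightarrow> sl2 \<Rightarrow> sl2" where
  "sl2_scale s = (\<lambda>(a, b, c). (s * a, s * b, s * c))"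

definition sl2_bracket :: "sl2 \<Rightarrow> sl2 \<Rightarrow> sl2" where
  "sl2_bracket = (\<lambda>(a, b, c) (a', b', c').
     (2 * (c * a' - a * c'), 2 * (b * c' - c * b'), a * b' - b * a'))"

definition sl2_form :: "sl2 \<Rightarrow> sl2 \<Rightarrow> complex" where
  "sl2_form = (\<lambda>(a, b, c) (a', b', c'). a * b' + b * a' + 2 * c * c')"

lemma sl2_bracket_basis:
  "sl2_bracket sl2_e sl2_f = sl2_h"
  "sl2_bracket sl2_h sl2_e = sl2_scale 2 sl2_e"
  "sl2_bracket sl2_h sl2_f = sl2_scale (- 2) sl2_f"
  by (simp_all add: sl2_bracket_def sl2_scale_def sl2_e_def sl2_f_def sl2_h_def)

text \<open>The pair \<open>(p, s)\<close> stands for \<open>(\<Sum>n. p\<^sub>n \<otimes> t\<^sup>n) + s c\<close>.\<close>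
type_synonym affine = "(int \<Rightarrow>\<^sub>0 sl2) \<times> complex"

definition loop :: "sl2 \<Rightarrow> int \<Rightarrow> affine" where
  "loop x n = (Poly_Mapping.single n x, 0)"

definition central :: affine where
  "central = (0, 1)"

definition affine_scale :: "complex \<Rightarrow> affine \<Rightarrow> affine" where
  "affine_scale s = (\<lambda>(p, t). (Poly_Mapping.map (sl2_scale s) p, s * t))"

definition affine_bracket :: "affine \<Rightarrow> affine \<Rightarrow> affine" where
  "affine_bracket = (\<lambda>(p, s) (q, t).
     (\<Sum>n\<in>Poly_Mapping.keys p. \<Sum>m\<in>Poly_Mapping.keys q.
        Poly_Mapping.single (n + m)
          (sl2_bracket (Poly_Mapping.lookup p n) (Poly_Mapping.lookup q m)),
      \<Sum>n\<in>Poly_Mapping.keys p.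
        of_int n * sl2_form (Poly_Mapping.lookup p n) (Poly_Mapping.lookup q (- n))))"

lemma sl2_bracket_zero [simp]: "sl2_bracket 0 x = 0" "sl2_bracket x 0 = 0"
  and sl2_form_zero [simp]: "sl2_form 0 x = 0" "sl2_form x 0 = 0"
  unfolding sl2_bracket_def sl2_form_def zero_prod_def by (auto split: prod.split)

lemma affine_bracket_loop:
  "affine_bracket (loop x n) (loop y m) =
     loop (sl2_bracket x y) (n + m)
     + affine_scale (of_int n * sl2_form x y * (if n + m = 0 then 1 else 0)) central"
proof -
  have map0: "Poly_Mapping.map (sl2_scale s) (0 :: int \<Rightarrow>\<^sub>0 sl2) = 0" for s
    by (rule poly_mapping_eqI) (simp add: Poly_Mapping.map.rep_eq)
  have "(\<Sum>i\<in>Poly_Mapping.keys (Poly_Mapping.single n x).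
          \<Sum>j\<in>Poly_Mapping.keys (Poly_Mapping.single m y).
            Poly_Mapping.single (i + j) (sl2_bracket (Poly_Mapping.lookup (Poly_Mapping.single n x) i)
              (Poly_Mapping.lookup (Poly_Mapping.single m y) j)))
        = Poly_Mapping.single (n + m) (sl2_bracket x y)"
    by simp
  moreover have "(\<Sum>i\<in>Poly_Mapping.keys (Poly_Mapping.single n x).
          of_int i * sl2_form (Poly_Mapping.lookup (Poly_Mapping.single n x) i)
            (Poly_Mapping.lookup (Poly_Mapping.single m y) (- i)))
        = of_int n * sl2_form x y * (if n + m = 0 then 1 else 0)"
    by (auto simp: lookup_single when_def)
  ultimately show ?thesis
    by (simp add: affine_bracket_def loop_def central_def affine_scale_def map0)
qed

lemma affine_bracket_central:
  "affine_bracket central x = 0" "affine_bracket x central = 0"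
  unfolding affine_bracket_def central_def by (auto simp: zero_prod_def[symmetric] split: prod.split)


section \<open>Modules over the affine Lie algebra\<close>

text \<open>
  A module is a record of the library type \<open>module\<close> over the ring of complex numbers, extended by
  the action.  The fields \<open>mult\<close> and \<open>one\<close>, which the library record for modules inherits from
  the one for rings, carry no information here.
\<close>
record 'v affine_module = "(complex, 'v) module" +
  act :: "affine \<Rightarrow> 'v \<Rightarrow> 'v"

abbreviation complex_field :: "complex ring" where
  "complex_field \<equiv> ring_of_type_algebra"

definition is_affine_module :: "('v, 'z) affine_module_scheme \<Rightarrow> bool" where
  "is_affine_module M \<longleftrightarrow>
     module complex_field M \<and>
     (\<forall>x. \<forall>v\<in>carrier M. act M x v \<in> carrier M) \<and>
     (\<forall>x. \<forall>v\<in>carrier M. \<forall>w\<in>carrier M. act M x (v \<oplus>\<^bsub>M\<^esub> w) = act M x v \<oplus>\<^bsub>M\<^esub> act M x w) \<and>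
     (\<forall>x s. \<forall>v\<in>carrier M. act M x (s \<odot>\<^bsub>M\<^esub> v) = s \<odot>\<^bsub>M\<^esub> act M x v) \<and>
     (\<forall>x y. \<forall>v\<in>carrier M. act M (x + y) v = act M x v \<oplus>\<^bsub>M\<^esub> act M y v) \<and>
     (\<forall>x s. \<forall>v\<in>carrier M. act M (affine_scale s x) v = s \<odot>\<^bsub>M\<^esub> act M x v) \<and>
     (\<forall>x y. \<forall>v\<in>carrier M.
        act M (affine_bracket x y) v = act M x (act M y v) \<ominus>\<^bsub>M\<^esub> act M y (act M x v))"

definition affine_module_iso ::
    "('v, 'y) affine_module_scheme \<Rightarrow> ('w, 'z) affine_module_scheme \<Rightarrow> ('v \<Rightarrow> 'w) set" where
  "affine_module_iso M N = {\<phi>. bij_betw \<phi> (carrier M) (carrier N) \<and>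
     (\<forall>v\<in>carrier M. \<forall>w\<in>carrier M. \<phi> (v \<oplus>\<^bsub>M\<^esub> w) = \<phi> v \<oplus>\<^bsub>N\<^esub> \<phi> w) \<and>
     (\<forall>s. \<forall>v\<in>carrier M. \<phi> (s \<odot>\<^bsub>M\<^esub> v) = s \<odot>\<^bsub>N\<^esub> \<phi> v) \<and>
     (\<forall>x. \<forall>v\<in>carrier M. \<phi> (act M x v) = act N x (\<phi> v))}"

definition affine_isomorphic ::
    "('v, 'y) affine_module_scheme \<Rightarrow> ('w, 'z) affine_module_scheme \<Rightarrow> bool" where
  "affine_isomorphic M N \<longleftrightarrow>
     is_affine_module M \<and> is_affine_module N \<and> affine_module_iso M N \<noteq> {}"

definition affine_submodule :: "'v set \<Rightarrow> ('v, 'z) affine_module_scheme \<Rightarrow> bool" where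
  "affine_submodule H M \<longleftrightarrow>
     submodule H complex_field M \<and> (\<forall>x. \<forall>v\<in>H. act M x v \<in> H)"

definition affine_submodule_gen :: "('v, 'z) affine_module_scheme \<Rightarrow> 'v set \<Rightarrow> 'v set" where
  "affine_submodule_gen M S = \<Inter>{H. affine_submodule H M \<and> S \<subseteq> H}"

text \<open>The operations on cosets are unions over representatives, as in \<^const>\<open>rcoset_mult\<close>.\<close>
definition affine_quot ::
    "('v, 'z) affine_module_scheme \<Rightarrow> 'v set \<Rightarrow> 'v set affine_module" where
  "affine_quot M H =
    \<lparr>carrier = a_rcosets\<^bsub>M\<^esub> H, mult = undefined, one = undefined, zero = H, add = set_add M,
     smult = (\<lambda>s A. \<Union>a\<in>A. H +>\<^bsub>M\<^esub> (s \<odot>\<^bsub>M\<^esub> a)),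
     act = (\<lambda>x A. \<Union>a\<in>A. H +>\<^bsub>M\<^esub> (act M x a))\<rparr>"


section \<open>The universal enveloping algebra\<close>

text \<open>The free monoid; its monoid algebra below is the free associative algebra.\<close>
datatype 'a free_word = Word (letters: "'a list")

instantiation free_word :: (type) monoid_add
begin

definition zero_free_word :: "'a free_word" where
  "zero_free_word = Word []"

definition plus_free_word :: "'a free_word \<Rightarrow> 'a free_word \<Rightarrow> 'a free_word" where
  "plus_free_word u v = Word (letters u @ letters v)"

instance
  by standard (simp_all add: zero_free_word_def plus_free_word_def)

end

type_synonym free_alg = "affine free_word \<Rightarrow>\<^sub>0 complex"

definition free_scalar :: "complex \<Rightarrow> free_alg" where
  "free_scalar s = Poly_Mapping.single 0 s"

definition free_gen :: "affine \<Rightarrow> free_alg" where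
  "free_gen x = Poly_Mapping.single (Word [x]) 1"

text \<open>
  The generators are all elements of the Lie algebra; the first two families of relations make
  the free algebra into the tensor algebra.
\<close>
definition uea_relations :: "free_alg set" where
  "uea_relations =
     {free_gen (x + y) - free_gen x - free_gen y | x y. True} \<union>
     {free_gen (affine_scale s x) - free_scalar s * free_gen x | s x. True} \<union>
     {free_gen x * free_gen y - free_gen y * free_gen x - free_gen (affine_bracket x y) | x y. True}"

abbreviation free_ring :: "free_alg ring" where
  "free_ring \<equiv> ring_of_type_algebra"

definition uea_ideal :: "free_alg set" where
  "uea_ideal = Idl\<^bsub>free_ring\<^esub> uea_relations"

definition uea :: "free_alg set ring" where
  "uea = free_ring Quot uea_ideal"

definition uea_scalar :: "complex \<Rightarrow> free_alg set" where
  "uea_scalar s = uea_ideal +>\<^bsub>free_ring\<^esub> free_scalar s"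

definition uea_gen :: "affine \<Rightarrow> free_alg set" where
  "uea_gen x = uea_ideal +>\<^bsub>free_ring\<^esub> free_gen x"

text \<open>The left regular module.\<close>
definition uea_module :: "free_alg set affine_module" where
  "uea_module =
    \<lparr>carrier = carrier uea, mult = mult uea, one = one uea, zero = zero uea, add = add uea,
     smult = (\<lambda>s u. uea_scalar s \<otimes>\<^bsub>uea\<^esub> u),
     act = (\<lambda>x u. uea_gen x \<otimes>\<^bsub>uea\<^esub> u)\<rparr>"

definition left_ideal :: "'a set \<Rightarrow> ('a, 'z) ring_scheme \<Rightarrow> bool" where
  "left_ideal J R \<longleftrightarrow>
     additive_subgroup J R \<and> (\<forall>r\<in>carrier R. \<forall>a\<in>J. r \<otimes>\<^bsub>R\<^esub> a \<in> J)"

definition left_ideal_gen :: "('a, 'z) ring_scheme \<Rightarrow> 'a set \<Rightarrow> 'a set" where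
  "left_ideal_gen R S = \<Inter>{J. left_ideal J R \<and> S \<subseteq> J}"


section \<open>The Whittaker modules at the critical level\<close>

definition whittaker_ideal :: "complex \<Rightarrow> complex \<Rightarrow> free_alg set set" where
  "whittaker_ideal l mu = left_ideal_gen uea
     ({uea_gen (loop sl2_e 0) \<ominus>\<^bsub>uea\<^esub> uea_scalar l,
       uea_gen (loop sl2_f 1) \<ominus>\<^bsub>uea\<^esub> uea_scalar mu,
       uea_gen central \<oplus>\<^bsub>uea\<^esub> uea_scalar 2} \<union>
      (\<Union>i\<in>{1..}. {uea_gen (loop sl2_e i), uea_gen (loop sl2_h i), uea_gen (loop sl2_f (i + 1))}))"

text \<open>The module \<open>V(\<lambda>, \<mu>, -2)\<close>.\<close>
definition whittaker_module :: "complex \<Rightarrow> complex \<Rightarrow> free_alg set set affine_module" where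
  "whittaker_module l mu = affine_quot uea_module (whittaker_ideal l mu)"

definition whittaker_vector :: "complex \<Rightarrow> complex \<Rightarrow> free_alg set set" where
  "whittaker_vector l mu = whittaker_ideal l mu +>\<^bsub>uea_module\<^esub> \<one>\<^bsub>uea\<^esub>"

definition normal_ordered ::
    "('v, 'z) affine_module_scheme \<Rightarrow> sl2 \<Rightarrow> int \<Rightarrow> sl2 \<Rightarrow> int \<Rightarrow> 'v \<Rightarrow> 'v" where
  "normal_ordered M x k y m v =
     (if k < 0 then act M (loop x k) (act M (loop y m) v)
      else act M (loop y m) (act M (loop x k) v))"

text \<open>
  The mode \<open>T(n)\<close>.  The sum over \<open>k\<close> is taken over the support of the summand, which is finite on
  every vector of the modules considered here.
\<close>
definition sugawara :: "('v, 'z) affine_module_scheme \<Rightarrow> int \<Rightarrow> 'v \<Rightarrow> 'v" where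
  "sugawara M n v =
     (let t = (\<lambda>k. normal_ordered M sl2_e k sl2_f (n - k) v
               \<oplus>\<^bsub>M\<^esub> normal_ordered M sl2_f k sl2_e (n - k) v
               \<oplus>\<^bsub>M\<^esub> (1/2) \<odot>\<^bsub>M\<^esub> normal_ordered M sl2_h k sl2_h (n - k) v)
      in (1/2) \<odot>\<^bsub>M\<^esub> finsum M t {k. t k \<noteq> \<zero>\<^bsub>M\<^esub>})"

text \<open>The coefficient \<open>g\<^sub>n\<close> of a series written \<open>g(z) = \<Sum>n. g\<^sub>n z\<^bsup>-n-2\<^esup>\<close>.\<close>
definition mode2 :: "complex fls \<Rightarrow> int \<Rightarrow> complex" where
  "mode2 g n = fls_nth g (- n - 2)"

text \<open>The module \<open>V(\<lambda>, \<mu>, -2, c(z))\<close>.\<close>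
definition whittaker_quotient ::
    "complex \<Rightarrow> complex \<Rightarrow> complex fls \<Rightarrow> free_alg set set set affine_module" where
  "whittaker_quotient l mu c =
     (let V = whittaker_module l mu; w = whittaker_vector l mu in
      affine_quot V
        (affine_submodule_gen V {sugawara V n w \<ominus>\<^bsub>V\<^esub> mode2 c n \<odot>\<^bsub>V\<^esub> w | n. n \<le> 0}))"


section \<open>The vertex operators on the module Pi\<close>

text \<open>\<open>Xvar n\<close> stands for \<open>x(-n-1)\<close>, and \<open>Yvar n\<close> for \<open>y(-n)\<close>.\<close>
datatype pi_var = Xvar nat | Yvar nat

text \<open>Polynomials in the variables above; the vector \<open>w\<^sub>\<lambda>\<close> is the polynomial 1.\<close>
type_synonym pi_space = "(pi_var \<Rightarrow>\<^sub>0 nat) \<Rightarrow>\<^sub>0 complex"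

definition pi_const :: "complex \<Rightarrow> pi_space" where
  "pi_const s = Poly_Mapping.single 0 s"

definition pi_of_var :: "pi_var \<Rightarrow> pi_space" where
  "pi_of_var v = Poly_Mapping.single (Poly_Mapping.single v 1) 1"

definition pi_deriv :: "pi_var \<Rightarrow> pi_space \<Rightarrow> pi_space" where
  "pi_deriv v p = (\<Sum>t\<in>Poly_Mapping.keys p.
     Poly_Mapping.single (t - Poly_Mapping.single v 1)
       (of_nat (Poly_Mapping.lookup t v) * Poly_Mapping.lookup p t))"

definition pi_subst :: "(pi_var \<Rightarrow> pi_space) \<Rightarrow> pi_space \<Rightarrow> pi_space" where
  "pi_subst \<sigma> p = (\<Sum>t\<in>Poly_Mapping.keys p.
     pi_const (Poly_Mapping.lookup p t) *
       (\<Prod>v\<in>Poly_Mapping.keys t. \<sigma> v ^ Poly_Mapping.lookup t v))"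

text \<open>
  The positive modes annihilate 1, so \<open>[x(m), y(n)] = 2m \<delta>\<^sub>m\<^sub>+\<^sub>n\<close> forces them to be the derivations
  below; \<open>x(0)\<close> is \<open>-1\<close>.
\<close>
definition xop :: "int \<Rightarrow> pi_space \<Rightarrow> pi_space" where
  "xop n p =
     (if n < 0 then pi_of_var (Xvar (nat (- n - 1))) * p
      else if n = 0 then - p
      else pi_const (2 * of_int n) * pi_deriv (Yvar (nat n)) p)"

definition yop :: "int \<Rightarrow> pi_space \<Rightarrow> pi_space" where
  "yop n p =
     (if n \<le> 0 then pi_of_var (Yvar (nat (- n))) * p
      else pi_const (2 * of_int n) * pi_deriv (Xvar (nat (n - 1))) p)"

text \<open>\<open>\<alpha> = (x + y) / 2\<close>\<close>
definition alpha_op :: "int \<Rightarrow> pi_space \<Rightarrow> pi_space" where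
  "alpha_op n p = pi_const (1/2) * (xop n p + yop n p)"

text \<open>
  The operator \<open>E\<^sup>m\<close>: since \<open>E\<^sup>m y(0) = (y(0) - 2m) E\<^sup>m\<close>, it shifts the variable \<open>y(0)\<close> by \<open>-2m\<close>.
\<close>
definition E_op :: "complex \<Rightarrow> int \<Rightarrow> pi_space \<Rightarrow> pi_space" where
  "E_op l m p = pi_const (l powi m) *
     pi_subst (\<lambda>v. if v = Yvar 0 then pi_of_var v - pi_const (2 * of_int m) else pi_of_var v) p"

text \<open>The coefficient of \<open>z\<^sup>j\<close> in the \<open>r\<close>-th power of the operator series \<open>\<Sum>k\<ge>1. A\<^sub>k z\<^sup>k\<close>.\<close>
fun series_power_coeff ::
    "(nat \<Rightarrow> pi_space \<Rightarrow> pi_space) \<Rightarrow> nat \<Rightarrow> nat \<Rightarrow> pi_space \<Rightarrow> pi_space" where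
  "series_power_coeff A 0 j p = (if j = 0 then p else 0)"
| "series_power_coeff A (Suc r) j p = (\<Sum>k=1..j. A k (series_power_coeff A r (j - k) p))"

text \<open>
  The coefficient of \<open>z\<^sup>j\<close> in \<open>exp(\<Sum>k\<ge>1. A\<^sub>k z\<^sup>k)\<close>; powers with exponent above \<open>j\<close> do not contribute.
\<close>
definition series_exp_coeff ::
    "(nat \<Rightarrow> pi_space \<Rightarrow> pi_space) \<Rightarrow> nat \<Rightarrow> pi_space \<Rightarrow> pi_space" where
  "series_exp_coeff A j p = (\<Sum>r\<le>j. pi_const (1 / fact r) * series_power_coeff A r j p)"

text \<open>
  The coefficient of \<open>z\<^sup>d\<close> in \<open>Y(e\<^bsup>mx\<^esup>, z)\<close>.  All occurrences of \<^const>\<open>Sum_any\<close> are sums with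
  finite support on every vector.
\<close>
definition Y_exp_coeff :: "complex \<Rightarrow> int \<Rightarrow> int \<Rightarrow> pi_space \<Rightarrow> pi_space" where
  "Y_exp_coeff l m d p = E_op l m (Sum_any (\<lambda>(i, j).
     if - m + int i - int j = d
     then series_exp_coeff (\<lambda>k q. pi_const (of_int m / of_nat k) * xop (- int k) q) i
            (series_exp_coeff (\<lambda>k q. pi_const (- of_int m / of_nat k) * xop (int k) q) j p)
     else 0))"

text \<open>\<open>a(z) = \<Sum>n. a(n) z\<^bsup>-n-1\<^esup>\<close> and \<open>a\<^bsup>-1\<^esup>(z) = \<Sum>n. a\<^bsup>-1\<^esup>(n) z\<^bsup>-n+1\<^esup>\<close>\<close>
definition a_op :: "complex \<Rightarrow> int \<Rightarrow> pi_space \<Rightarrow> pi_space" where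
  "a_op l n = Y_exp_coeff l 1 (- n - 1)"

definition a_inv_op :: "complex \<Rightarrow> int \<Rightarrow> pi_space \<Rightarrow> pi_space" where
  "a_inv_op l n = Y_exp_coeff l (- 1) (- n + 1)"

text \<open>
  \<open>a\<^sup>*(z) = \<Sum>n. a\<^sup>*(n) z\<^bsup>-n\<^esup>\<close> is the field of \<open>-\<alpha>(-1) e\<^bsup>-x\<^esup>\<close>, that is
  \<open>-(\<alpha>(z)\<^sup>+ a\<^bsup>-1\<^esup>(z) + a\<^bsup>-1\<^esup>(z) \<alpha>(z)\<^sup>-)\<close> with \<open>\<alpha>(z) = \<Sum>n. \<alpha>(n) z\<^bsup>-n-1\<^esup>\<close>.
\<close>
definition a_star_op :: "complex \<Rightarrow> int \<Rightarrow> pi_space \<Rightarrow> pi_space" where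
  "a_star_op l n p = - Sum_any (\<lambda>k.
     if k < 0 then alpha_op k (a_inv_op l (n - k) p) else a_inv_op l (n - k) (alpha_op k p))"

text \<open>The coefficient of \<open>z\<^bsup>-n\<^esup>\<close> in \<open>a\<^sup>*(z)\<^sup>2\<close>.\<close>
definition a_star_sq_op :: "complex \<Rightarrow> int \<Rightarrow> pi_space \<Rightarrow> pi_space" where
  "a_star_sq_op l n p = Sum_any (\<lambda>m. a_star_op l m (a_star_op l (n - m) p))"

text \<open>
  The coefficient of \<open>z\<^bsup>-n-1\<^esup>\<close> in \<open>a(z)\<^sup>+ B(z) + B(z) a(z)\<^sup>-\<close>, where \<open>B(z) = \<Sum>n. B(n) z\<^bsup>-n\<^esup>\<close>.
\<close>
definition normal_ordered_a ::
    "complex \<Rightarrow> (int \<Rightarrow> pi_space \<Rightarrow> pi_space) \<Rightarrow> int \<Rightarrow> pi_space \<Rightarrow> pi_space" where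
  "normal_ordered_a l B n p = Sum_any (\<lambda>k.
     if k < 0 then a_op l k (B (n - k) p) else B (n - k) (a_op l k p))"


section \<open>The Wakimoto-type action\<close>

text \<open>
  The module \<open>M\<^sub>T(\<chi>(z))\<close> is the complex line with the following action of \<open>T(n)\<close>.  A vector of
  \<open>M\<^sub>T(\<chi>(z)) \<otimes> \<Pi>\<^sub>\<lambda>\<close> is a polynomial with coefficients in \<open>M\<^sub>T(\<chi>(z))\<close>, so the tensor product has
  underlying space \<^typ>\<open>pi_space\<close>; the operators on the first factor act on coefficients.
\<close>
definition MT_act :: "complex fls \<Rightarrow> int \<Rightarrow> complex \<Rightarrow> complex" where
  "MT_act chi n s = mode2 chi n * s"

definition wak_e :: "complex \<Rightarrow> int \<Rightarrow> pi_space \<Rightarrow> pi_space" where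
  "wak_e l n p = a_op l n p"

definition wak_h :: "complex \<Rightarrow> int \<Rightarrow> pi_space \<Rightarrow> pi_space" where
  "wak_h l n p = - (pi_const 2 * normal_ordered_a l (a_star_op l) n p)"

text \<open>The coefficient of \<open>z\<^bsup>-n-1\<^esup>\<close> in \<open>\<partial>\<^sub>z a\<^sup>*(z)\<close> is \<open>-n a\<^sup>*(n)\<close>.\<close>
definition wak_f :: "complex \<Rightarrow> complex fls \<Rightarrow> int \<Rightarrow> pi_space \<Rightarrow> pi_space" where
  "wak_f l chi n p =
     - normal_ordered_a l (a_star_sq_op l) n p
     - pi_const 2 * (pi_const (- of_int n) * a_star_op l n p)
     + Sum_any (\<lambda>k. Poly_Mapping.map (MT_act chi k) (a_inv_op l (n - k) p))"

text \<open>The module \<open>M\<^sub>T(\<chi>(z)) \<otimes> \<Pi>\<^sub>\<lambda>\<close>; the central element acts as \<open>-2\<close>.\<close>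
definition wak_module :: "complex \<Rightarrow> complex fls \<Rightarrow> pi_space affine_module" where
  "wak_module l chi =
    \<lparr>carrier = UNIV, mult = undefined, one = undefined, zero = 0, add = (+),
     smult = (\<lambda>s p. pi_const s * p),
     act = (\<lambda>(q, s) p.
       (\<Sum>n\<in>Poly_Mapping.keys q. case Poly_Mapping.lookup q n of (u, v, w) \<Rightarrow>
          pi_const u * wak_e l n p + pi_const v * wak_f l chi n p + pi_const w * wak_h l n p)
       + pi_const (- 2 * s) * p)\<rparr>"

end

theory Submission
  imports Defs
begin

text \<open>
  Let \<open>w\<close> be the image of 1 in the quotient \<open>M = V(\<lambda>, \<mu>, -2, c(z))\<close>.  Both sides are compared with a
  polynomial ring.

  \<^bold>\<open>An upper bound for M.\<close>  As \<open>e(0) w = \<lambda> w\<close> and \<open>e(i) w = 0\<close> for \<open>i \<ge> 1\<close>, the vector \<open>T(n) w\<close> is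
  \<open>\<lambda> f(n) w\<close> plus terms that contain only modes of \<open>e\<close> and \<open>h\<close> and vectors \<open>f(m) w\<close> with \<open>m > n\<close>
  (\<open>sugawara_leading_term\<close>).  Imposing \<open>T(n) w = c\<^sub>n w\<close> therefore eliminates \<open>f\<close> by descending
  induction on \<open>n\<close>, and \<open>M\<close> is spanned by the vectors
  \<open>h(-j\<^sub>1) \<dots> h(-j\<^sub>s) e(-k\<^sub>1) \<dots> e(-k\<^sub>r) w\<close> with \<open>j\<^sub>i \<ge> 0\<close>, \<open>k\<^sub>i \<ge> 1\<close> (\<open>R_eq_carrier\<close>).

  \<^bold>\<open>A lower bound for M.\<close>  On the Wakimoto side \<open>T(z)\<close> acts as \<open>\<chi>(z)\<close> (\<open>wakimoto_sugawara\<close>) and the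
  polynomial 1 satisfies the relations of \<open>w\<close> (\<open>whittaker_vector_wak\<close>), so there is a homomorphism
  that sends \<open>w\<close> to 1.  By bosonization \<open>h(-j)\<close> is multiplication by \<open>y(-j) - x(-j)\<close>, while \<open>e(-k)\<close>
  multiplies a polynomial in the \<open>x(-n)\<close> by \<open>\<lambda>\<close> times the coefficient of \<open>z\<^sup>k\<close> in
  \<open>exp (\<Sum>n\<ge>1. x(-n) z\<^sup>n / n)\<close>.  These polynomials are free generators of the polynomial ring
  (\<open>gen_subst_inverse\<close>), so the homomorphism takes the spanning vectors bijectively to a basis.

  \<^bold>\<open>The module structure.\<close>  Most of the work is to check that the Wakimoto operators satisfy the
  affine relations (\<open>wakimoto_commutators\<close>).  It rests on a calculus of normally ordered products of
  modes: a derivation rule, an index shift that produces the double contractions, and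
  quasi-associativity (\<open>nop_derivation\<close>, \<open>nop_shift_left\<close>, \<open>nop_quasi_assoc\<close>).  The hard relations,
  \<open>[a\<^sup>*(n), a\<^sup>*(m)] = 0\<close> and \<open>[f(n), f(m)] = 0\<close>, follow from symmetry: the calculus shows that the
  commutator depends only on \<open>n + m\<close>, and a commutator is antisymmetric in \<open>n\<close> and \<open>m\<close>.
\<close>

section \<open>Sums with finite support\<close>

lemma Sum_any_eq_sum:
  assumes "finite S" and "\<And>x. x \<notin> S \<Longrightarrow> f x = 0"
  shows "Sum_any f = sum f S"
  using assms by (intro Sum_any.expand_superset) auto

lemma Sum_any_diff:
  fixes f g :: "'a \<Rightarrow> 'v::ab_group_add"
  assumes "finite {x. f x \<noteq> 0}" and "finite {x. g x \<noteq> 0}"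
  shows "Sum_any (\<lambda>x. f x - g x) = Sum_any f - Sum_any g"
proof -
  let ?S = "{x. f x \<noteq> 0} \<union> {x. g x \<noteq> 0}"
  have "finite ?S" using assms by simp
  moreover have "Sum_any f = sum f ?S" "Sum_any g = sum g ?S" "Sum_any (\<lambda>x. f x - g x) = sum (\<lambda>x. f x - g x) ?S"
    by (rule Sum_any_eq_sum[OF \<open>finite ?S\<close>]; auto)+
  ultimately show ?thesis by (simp add: sum_subtractf)
qed

lemma additive_Sum_any:
  assumes "Modules.additive D" and "finite {x. f x \<noteq> 0}"
  shows "D (Sum_any f) = Sum_any (\<lambda>x. D (f x))"
proof -
  interpret additive D by fact
  have "Sum_any (\<lambda>x. D (f x)) = (\<Sum>x\<in>{x. f x \<noteq> 0}. D (f x))"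
    using assms(2) by (rule Sum_any_eq_sum) (simp add: zero)
  moreover have "Sum_any f = (\<Sum>x\<in>{x. f x \<noteq> 0}. f x)"
    using assms(2) by (rule Sum_any_eq_sum) simp
  ultimately show ?thesis by (simp add: sum)
qed

lemma additive_of_int:
  fixes D :: "'v::ring_1 \<Rightarrow> 'w::ring_1"
  assumes "Modules.additive D"
  shows "D (of_int n * v) = of_int n * D v"
proof -
  interpret additive D by fact
  have nat: "D (of_nat m * v) = of_nat m * D v" for m
    by (induction m) (simp_all add: zero add algebra_simps)
  show ?thesis
    by (cases n rule: int_cases2) (simp_all add: nat minus)
qed

lemma finite_nonzero_image:
  assumes "Modules.additive D" and "finite {x. f x \<noteq> 0}"
  shows "finite {x. D (f x) \<noteq> 0}"
proof -
  interpret additive D by fact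
  show ?thesis by (rule finite_subset[OF _ assms(2)]) (auto simp: zero)
qed

lemma finite_nonzero_add:
  fixes f g :: "'a \<Rightarrow> 'v::ab_group_add"
  assumes "finite {x. f x \<noteq> 0}" and "finite {x. g x \<noteq> 0}"
  shows "finite {x. f x + g x \<noteq> 0}" and "finite {x. f x - g x \<noteq> 0}"
  by (rule finite_subset[OF _ finite_UnI[OF assms]], auto)+

lemma Sum_any_pair:
  fixes g :: "'a \<Rightarrow> 'b \<Rightarrow> 'v::comm_monoid_add"
  assumes "finite {(a, b). g a b \<noteq> 0}"
  shows "Sum_any (\<lambda>a. Sum_any (g a)) = Sum_any (\<lambda>(a, b). g a b)"
proof -
  let ?S = "{(a, b). g a b \<noteq> 0}"
  have "fst ` ?S \<times> snd ` ?S \<supseteq> {a. \<exists>b. g a b \<noteq> 0} \<times> {b. \<exists>a. g a b \<noteq> 0}"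
    by force
  then show ?thesis
    by (intro Sum_any.cartesian_product[of "fst ` ?S \<times> snd ` ?S"]) (use assms in auto)
qed

lemma Sum_any_int_shift: "Sum_any (\<lambda>k::int. f (k + r)) = Sum_any f"
  by (rule sym, rule Sum_any.reindex_cong[where l = "\<lambda>k. k + r"]) (auto simp: bij_def inj_def surj_def intro: exI[of _ "_ - r"])

lemma Sum_any_int_reflect: "Sum_any (\<lambda>k::int. f (n - k)) = Sum_any f"
  by (rule sym, rule Sum_any.reindex_cong[where l = "\<lambda>k. n - k"]) (auto simp: bij_def inj_def surj_def intro: exI[of _ "n - _"])

text \<open>
  The difference of two step functions on the integers, with signed number of steps \<open>r\<close>.  Moving the
  boundary between the two orders in a normally ordered product changes the product by such a sum of
  commutators.
\<close>
lemma Sum_any_step: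
  fixes c :: "'v::ring_1"
  shows "Sum_any (\<lambda>k. (if k < r then c else 0) - (if k < (0::int) then c else 0)) = of_int r * c"
    and "finite {k. (if k < r then c else 0) - (if k < (0::int) then c else 0) \<noteq> 0}"
proof -
  let ?f = "\<lambda>k. (if k < r then c else 0) - (if k < (0::int) then c else 0)"
  show "finite {k. ?f k \<noteq> 0}"
    by (rule finite_subset[of _ "{min 0 r..<max 0 r}"]) (auto split: if_splits)
  show "Sum_any ?f = of_int r * c"
  proof (cases "r \<ge> 0")
    case True
    have "Sum_any ?f = sum ?f {0..<r}" by (rule Sum_any_eq_sum) (use True in auto)
    also have "\<dots> = (\<Sum>k\<in>{0..<r}. c)" by (rule sum.cong) auto
    finally show ?thesis using True by (simp add: of_nat_nat)
  next
    case False
    have "Sum_any ?f = sum ?f {r..<0}" by (rule Sum_any_eq_sum) (use False in auto)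
    also have "\<dots> = (\<Sum>k\<in>{r..<0}. - c)" by (rule sum.cong) auto
    finally show ?thesis using False by (simp add: of_nat_nat)
  qed
qed

section \<open>Modes of fields and normally ordered products\<close>

text \<open>
  A family of modes is a field if on each vector only finitely many modes of positive index act
  nontrivially.  This is what makes the sums below finite.
\<close>
definition field_modes :: "(int \<Rightarrow> 'v::ring_1 \<Rightarrow> 'v) \<Rightarrow> bool" where
  "field_modes A \<longleftrightarrow> (\<forall>n. Modules.additive (A n)) \<and> (\<forall>v. \<exists>N. \<forall>n\<ge>N. A n v = 0)"

definition nop_term :: "(int \<Rightarrow> 'v::ring_1 \<Rightarrow> 'v) \<Rightarrow> (int \<Rightarrow> 'v \<Rightarrow> 'v) \<Rightarrow> int \<Rightarrow> 'v \<Rightarrow> int \<Rightarrow> 'v" where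
  "nop_term A B n v k = (if k < 0 then A k (B (n - k) v) else B (n - k) (A k v))"

text \<open>
  The mode of \<open>A(z)\<^sup>+ B(z) + B(z) A(z)\<^sup>-\<close>, where \<open>A(z)\<^sup>+\<close> collects the modes of negative index.
\<close>
definition nop :: "(int \<Rightarrow> 'v::ring_1 \<Rightarrow> 'v) \<Rightarrow> (int \<Rightarrow> 'v \<Rightarrow> 'v) \<Rightarrow> int \<Rightarrow> 'v \<Rightarrow> 'v" where
  "nop A B n v = Sum_any (nop_term A B n v)"

lemma field_modes_additive: "field_modes A \<Longrightarrow> Modules.additive (A n)"
  by (simp add: field_modes_def)

lemma field_modes_simps:
  assumes "field_modes A"
  shows "A n (u + v) = A n u + A n v" "A n (u - v) = A n u - A n v" "A n (- v) = - A n v"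
    "A n 0 = 0" "A n (of_int i * v) = of_int i * A n v"
  using field_modes_additive[OF assms, of n]
  by (auto simp: additive.add additive.diff additive.minus additive.zero additive_of_int)

lemma field_modes_bound:
  assumes "field_modes A"
  obtains N where "N \<ge> 0" "\<And>n. n \<ge> N \<Longrightarrow> A n v = 0"
proof -
  obtain N where N: "\<forall>n\<ge>N. A n v = 0" using assms unfolding field_modes_def by blast
  show ?thesis by (rule that[of "max N 0"]) (use N in auto)
qed

lemma field_modes_bound_finite:
  assumes "field_modes A" "finite S"
  obtains N where "N \<ge> 0" "\<And>n v. n \<ge> N \<Longrightarrow> v \<in> S \<Longrightarrow> A n v = 0"
proof -
  have "\<exists>N\<ge>0. \<forall>n\<ge>N. \<forall>v\<in>S. A n v = 0"
    using assms(2)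
  proof (induction S)
    case empty then show ?case by auto
  next
    case (insert x S)
    obtain M where "\<forall>n\<ge>M. A n x = 0" using assms(1) unfolding field_modes_def by blast
    moreover obtain N where "N \<ge> 0" "\<forall>n\<ge>N. \<forall>v\<in>S. A n v = 0" using insert.IH by blast
    ultimately show ?case by (intro exI[of _ "max M N"]) auto
  qed
  then show ?thesis using that by blast
qed

lemma field_modesI:
  assumes "\<And>n. Modules.additive (A n)" "\<And>v. \<exists>N. \<forall>n\<ge>N. A n v = 0"
  shows "field_modes A"
  using assms by (simp add: field_modes_def)

lemma finite_nop_term:
  assumes "field_modes A" "field_modes B"
  shows "finite {k. nop_term A B n v k \<noteq> 0}"
proof -
  obtain M where M: "M \<ge> 0" "\<And>k. k \<ge> M \<Longrightarrow> A k v = 0" by (rule field_modes_bound[OF assms(1)]) blast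
  obtain N where N: "N \<ge> 0" "\<And>k. k \<ge> N \<Longrightarrow> B k v = 0" by (rule field_modes_bound[OF assms(2)]) blast
  \<comment> \<open>Left factors of very negative index meet a mode of B that kills v.\<close>
  have "nop_term A B n v k = 0" if "k \<notin> {min (n - N) 0..M}" for k
  proof (cases "k < 0")
    case True
    then have "n - k \<ge> N" using that M(1) by auto
    then show ?thesis using True N by (simp add: nop_term_def field_modes_simps[OF assms(1)])
  next
    case False
    then show ?thesis
      using that M by (auto simp: nop_term_def field_modes_simps[OF assms(2)])
  qed
  then have "{k. nop_term A B n v k \<noteq> 0} \<subseteq> {min (n - N) 0..M}" by blast
  then show ?thesis by (rule finite_subset) simp
qed

lemma nop_term_bound:
  assumes A: "field_modes A" and B: "field_modes B"
  shows "\<exists>K. \<forall>n\<ge>K. \<forall>k. nop_term A B n v k = 0"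
proof -
  obtain M where M: "M \<ge> 0" "\<And>k. k \<ge> M \<Longrightarrow> A k v = 0" by (rule field_modes_bound[OF A]) blast
  obtain N where N: "N \<ge> 0" "\<And>k u. k \<ge> N \<Longrightarrow> u \<in> insert v ((\<lambda>k. A k v) ` {0..M}) \<Longrightarrow> B k u = 0"
    by (rule field_modes_bound_finite[OF B, of "insert v ((\<lambda>k. A k v) ` {0..M})"]) auto
  have "nop_term A B n v k = 0" if "n \<ge> M + N" for n k
  proof (cases "k < 0")
    case True
    then show ?thesis using that M(1) N(2)[of "n - k" v] by (auto simp: nop_term_def field_modes_simps[OF A])
  next
    case False
    show ?thesis
    proof (cases "k \<le> M")
      case True
      then show ?thesis using False that N(2)[of "n - k" "A k v"] by (auto simp: nop_term_def)
    next
      case b: False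
      then show ?thesis using False M(2)[of k] by (auto simp: nop_term_def field_modes_simps[OF B])
    qed
  qed
  then show ?thesis by blast
qed

lemma field_modes_nop:
  assumes A: "field_modes A" and B: "field_modes B"
  shows "field_modes (nop A B)"
proof (rule field_modesI)
  fix n
  show "Modules.additive (nop A B n)"
  proof
    fix u v
    have "nop_term A B n (u + v) = (\<lambda>k. nop_term A B n u k + nop_term A B n v k)"
      by (auto simp: nop_term_def field_modes_simps[OF A] field_modes_simps[OF B] fun_eq_iff)
    then show "nop A B n (u + v) = nop A B n u + nop A B n v"
      unfolding nop_def by (simp add: Sum_any.distrib finite_nop_term A B)
  qed
next
  fix v
  obtain K where "\<forall>n\<ge>K. \<forall>k. nop_term A B n v k = 0" using nop_term_bound[OF A B] by blast
  then have "nop_term A B n v = (\<lambda>_. 0)" if "n \<ge> K" for n using that by auto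
  then show "\<exists>K. \<forall>n\<ge>K. nop A B n v = 0"
    by (intro exI[of _ K]) (simp add: nop_def)
qed

lemma field_modes_shift: "field_modes A \<Longrightarrow> field_modes (\<lambda>k. A (k + r))"
  unfolding field_modes_def by (metis add.commute add_le_cancel_left diff_add_cancel)

lemma field_modes_add:
  assumes A: "field_modes A" and B: "field_modes B"
  shows "field_modes (\<lambda>k v. A k v + B k v)"
proof (rule field_modesI)
  show "Modules.additive (\<lambda>v. A n v + B n v)" for n
    by standard (simp add: field_modes_simps[OF A] field_modes_simps[OF B])
  fix v
  obtain M where M: "M \<ge> 0" "\<And>k. k \<ge> M \<Longrightarrow> A k v = 0" by (rule field_modes_bound[OF A]) blast
  obtain N where N: "N \<ge> 0" "\<And>k. k \<ge> N \<Longrightarrow> B k v = 0" by (rule field_modes_bound[OF B]) blast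
  show "\<exists>N. \<forall>n\<ge>N. A n v + B n v = 0"
    by (rule exI[of _ "max M N"]) (use M N in auto)
qed

lemma field_modes_of_int:
  assumes A: "field_modes A"
  shows "field_modes (\<lambda>k v. of_int (c k) * A k v)"
proof (rule field_modesI)
  show "Modules.additive (\<lambda>v. of_int (c n) * A n v)" for n
    by standard (simp add: field_modes_simps[OF A] algebra_simps)
  fix v
  obtain M where M: "M \<ge> 0" "\<And>k. k \<ge> M \<Longrightarrow> A k v = 0" by (rule field_modes_bound[OF A]) blast
  then show "\<exists>N. \<forall>n\<ge>N. of_int (c n) * A n v = 0" by (intro exI[of _ M]) auto
qed

lemma field_modes_minus: "field_modes A \<Longrightarrow> field_modes (\<lambda>k v. - A k v)"
  using field_modes_of_int[of A "\<lambda>_. -1"] by simp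

lemma field_modes_diff:
  assumes "field_modes A" "field_modes B"
  shows "field_modes (\<lambda>k v. A k v - B k v)"
  using field_modes_add[OF assms(1) field_modes_minus[OF assms(2)]] by simp

lemma field_modes_zero: "field_modes (\<lambda>k v. 0)"
  by (rule field_modesI) (auto intro: additive.intro)

text \<open>
  The modes of the identity field.
\<close>
definition vacuum_modes :: "int \<Rightarrow> 'v::ring_1 \<Rightarrow> 'v" where
  "vacuum_modes n v = (if n = 0 then v else 0)"

lemma field_modes_vacuum: "field_modes vacuum_modes"
proof (rule field_modesI)
  show "Modules.additive (vacuum_modes n)" for n by standard (simp add: vacuum_modes_def)
  show "\<exists>N. \<forall>n\<ge>N. vacuum_modes n v = 0" for v :: 'a
    by (rule exI[of _ 1]) (simp add: vacuum_modes_def)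
qed

lemma field_modes_commutator:
  assumes D: "Modules.additive D" and A: "field_modes A"
    and comm: "\<And>k v. D (A k v) - A k (D v) = A' k v"
  shows "field_modes A'"
proof (rule field_modesI)
  interpret additive D by fact
  show "Modules.additive (A' n)" for n
    by standard (simp add: comm[symmetric] field_modes_simps[OF A] add algebra_simps)
  fix v
  obtain M where M: "M \<ge> 0" "\<And>k. k \<ge> M \<Longrightarrow> A k v = 0" by (rule field_modes_bound[OF A]) blast
  obtain N where N: "N \<ge> 0" "\<And>k. k \<ge> N \<Longrightarrow> A k (D v) = 0" by (rule field_modes_bound[OF A]) blast
  show "\<exists>N. \<forall>n\<ge>N. A' n v = 0"
    by (rule exI[of _ "max M N"]) (use M N in \<open>auto simp: comm[symmetric] zero\<close>)
qed

lemma nop_vacuum_right: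
  assumes A: "field_modes A"
  shows "nop A vacuum_modes n v = A n v"
proof -
  have "nop A vacuum_modes n v = (\<Sum>k\<in>{n}. nop_term A vacuum_modes n v k)"
    unfolding nop_def
    by (rule Sum_any_eq_sum) (auto simp: nop_term_def vacuum_modes_def field_modes_simps[OF A])
  then show ?thesis by (simp add: nop_term_def vacuum_modes_def)
qed

text \<open>
  A commutator with a scalar contraction such as \<open>[a(m), a\<^sup>*(j)] = \<delta>\<^bsub>m+j,0\<^esub>\<close> enters a normally ordered
  product as one of these delta families, and picks out a single mode of the other factor.
\<close>
lemma nop_delta_right:
  assumes A: "field_modes A"
  shows "nop A (\<lambda>j. vacuum_modes (m + j)) n v = A (n + m) v"
proof -
  have "nop A (\<lambda>j. vacuum_modes (m + j)) n v = (\<Sum>k\<in>{n + m}. nop_term A (\<lambda>j. vacuum_modes (m + j)) n v k)"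
    unfolding nop_def
    by (rule Sum_any_eq_sum) (auto simp: nop_term_def vacuum_modes_def field_modes_simps[OF A])
  then show ?thesis by (simp add: nop_term_def vacuum_modes_def)
qed

lemma nop_delta_left:
  assumes B: "field_modes B"
  shows "nop (\<lambda>j v. of_int (c j) * vacuum_modes (m + j) v) B n v = of_int (c (- m)) * B (n + m) v"
proof -
  have "nop (\<lambda>j v. of_int (c j) * vacuum_modes (m + j) v) B n v
      = (\<Sum>k\<in>{- m}. nop_term (\<lambda>j v. of_int (c j) * vacuum_modes (m + j) v) B n v k)"
    unfolding nop_def
    by (rule Sum_any_eq_sum) (auto simp: nop_term_def vacuum_modes_def field_modes_simps[OF B])
  then show ?thesis by (simp add: nop_term_def vacuum_modes_def field_modes_simps[OF B])
qed

lemma nop_cong: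
  assumes "\<And>k v. A k v = A' k v" "\<And>k v. B k v = B' k v"
  shows "nop A B n v = nop A' B' n v"
proof -
  have "A = A'" "B = B'" using assms by (blast intro: ext)+
  then show ?thesis by simp
qed

lemma nop_add_left:
  assumes A: "field_modes A" and A': "field_modes A'" and B: "field_modes B"
  shows "nop (\<lambda>k v. A k v + A' k v) B n v = nop A B n v + nop A' B n v"
proof -
  have "nop_term (\<lambda>k v. A k v + A' k v) B n v = (\<lambda>k. nop_term A B n v k + nop_term A' B n v k)"
    by (auto simp: nop_term_def field_modes_simps[OF B] fun_eq_iff)
  then show ?thesis
    unfolding nop_def by (simp add: Sum_any.distrib finite_nop_term A B A')
qed

lemma nop_add_right:
  assumes A: "field_modes A" and B: "field_modes B" and B': "field_modes B'"
  shows "nop A (\<lambda>k v. B k v + B' k v) n v = nop A B n v + nop A B' n v"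
proof -
  have "nop_term A (\<lambda>k v. B k v + B' k v) n v = (\<lambda>k. nop_term A B n v k + nop_term A B' n v k)"
    by (auto simp: nop_term_def field_modes_simps[OF A] fun_eq_iff)
  then show ?thesis
    unfolding nop_def by (simp add: Sum_any.distrib finite_nop_term A B B')
qed

lemma nop_of_int_left:
  assumes A: "field_modes A" and B: "field_modes B"
  shows "nop (\<lambda>k v. of_int c * A k v) B n v = of_int c * nop A B n v"
proof -
  have "nop_term (\<lambda>k v. of_int c * A k v) B n v = (\<lambda>k. of_int c * nop_term A B n v k)"
    by (auto simp: nop_term_def field_modes_simps[OF B] fun_eq_iff)
  then show ?thesis
    unfolding nop_def by (simp add: Sum_any_right_distrib finite_nop_term A B)
qed

lemma nop_of_int_right:
  assumes A: "field_modes A" and B: "field_modes B"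
  shows "nop A (\<lambda>k v. of_int c * B k v) n v = of_int c * nop A B n v"
proof -
  have "nop_term A (\<lambda>k v. of_int c * B k v) n v = (\<lambda>k. of_int c * nop_term A B n v k)"
    by (auto simp: nop_term_def field_modes_simps[OF A] fun_eq_iff)
  then show ?thesis
    unfolding nop_def by (simp add: Sum_any_right_distrib finite_nop_term A B)
qed

lemma nop_minus_left:
  "field_modes A \<Longrightarrow> field_modes B \<Longrightarrow> nop (\<lambda>k v. - A k v) B n v = - nop A B n v"
  using nop_of_int_left[of A B "-1" n v] by simp

lemma nop_minus_right:
  "field_modes A \<Longrightarrow> field_modes B \<Longrightarrow> nop A (\<lambda>k v. - B k v) n v = - nop A B n v"
  using nop_of_int_right[of A B "-1" n v] by simp

lemma nop_zero_left [simp]: "field_modes B \<Longrightarrow> nop (\<lambda>k v. 0) B n v = 0"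
  using nop_of_int_left[OF field_modes_zero, of B 0] by simp

lemma nop_zero_right [simp]: "field_modes A \<Longrightarrow> nop A (\<lambda>k v. 0) n v = 0"
  using nop_of_int_right[OF _ field_modes_zero, of A 0] by simp

text \<open>
  The ordering of the factors is decided by the index of \<open>A\<close> alone, so a commutator acts on each
  summand by the product rule, and never has to reorder the factors.
\<close>
lemma nop_derivation:
  assumes D: "Modules.additive D" and A: "field_modes A" and B: "field_modes B"
    and commA: "\<And>k v. D (A k v) - A k (D v) = A' k v"
    and commB: "\<And>k v. D (B k v) - B k (D v) = B' k v"
  shows "D (nop A B n v) - nop A B n (D v) = nop A' B n v + nop A B' n v"
proof -
  interpret additive D by fact
  have A': "field_modes A'" and B': "field_modes B'"
    using field_modes_commutator[OF D A commA] field_modes_commutator[OF D B commB] by auto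
  have fin: "finite {k. nop_term A B n v k \<noteq> 0}" "finite {k. nop_term A B n (D v) k \<noteq> 0}"
    by (simp_all add: finite_nop_term A B)
  have "D (nop A B n v) = Sum_any (\<lambda>k. D (nop_term A B n v k))"
    unfolding nop_def using D fin(1) by (rule additive_Sum_any)
  then have "D (nop A B n v) - nop A B n (D v)
      = Sum_any (\<lambda>k. D (nop_term A B n v k) - nop_term A B n (D v) k)"
    unfolding nop_def using Sum_any_diff[OF finite_nonzero_image[OF D fin(1)] fin(2)] by simp
  also have "\<dots> = Sum_any (\<lambda>k. nop_term A' B n v k + nop_term A B' n v k)"
    by (rule arg_cong[where f = Sum_any])
      (auto simp: nop_term_def commA[symmetric] commB[symmetric] field_modes_simps[OF A] field_modes_simps[OF B] diff algebra_simps)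
  also have "\<dots> = nop A' B n v + nop A B' n v"
    unfolding nop_def by (simp add: Sum_any.distrib finite_nop_term A B A' B')
  finally show ?thesis .
qed

lemma nop_intertwine:
  assumes D: "Modules.additive D" and A: "field_modes A" and B: "field_modes B"
    and "\<And>k v. D (A k v) = A k (D v)" "\<And>k v. D (B k v) = B k (D v)"
  shows "D (nop A B n v) = nop A B n (D v)"
  using nop_derivation[OF D A B, of "\<lambda>_ _. 0" "\<lambda>_ _. 0" n v] assms by simp

lemma nop_shift_right: "nop A (\<lambda>k. B (k + r)) n v = nop A B (n + r) v"
proof -
  have "nop_term A (\<lambda>k. B (k + r)) n v = nop_term A B (n + r) v"
    by (auto simp: nop_term_def algebra_simps)
  then show ?thesis by (simp add: nop_def)
qed

text \<open>
  A shift of the left index moves the boundary of the normal ordering by \<open>r\<close> places, and each place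
  costs one commutator.  This is how double contractions enter all computations below.
\<close>
lemma nop_shift_left:
  assumes A: "field_modes A" and B: "field_modes B"
    and comm: "\<And>k j v. A k (B j v) - B j (A k v) = C (k + j) v"
  shows "nop (\<lambda>k. A (k + r)) B n v = nop A B (n + r) v + of_int r * C (n + r) v"
proof -
  let ?f = "\<lambda>k. nop_term (\<lambda>k. A (k + r)) B n v (k + (- r))" and ?g = "nop_term A B (n + r) v"
  have f: "nop (\<lambda>k. A (k + r)) B n v = Sum_any ?f"
    unfolding nop_def by (rule Sum_any_int_shift[symmetric])
  have "?f = (\<lambda>k. ?g k + ((if k < r then C (n + r) v else 0) - (if k < 0 then C (n + r) v else 0)))"
  proof
    fix k
    have "A k (B (n + r - k) v) - B (n + r - k) (A k v) = C (n + r) v"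
      using comm[of k "n + r - k" v] by simp
    then show "?f k = ?g k + ((if k < r then C (n + r) v else 0) - (if k < 0 then C (n + r) v else 0))"
      by (auto simp: nop_term_def algebra_simps)
  qed
  then have "Sum_any ?f = Sum_any ?g + of_int r * C (n + r) v"
    by (simp only: Sum_any.distrib[OF finite_nop_term[OF A B] Sum_any_step(2)] Sum_any_step(1))
  then show ?thesis using f by (simp add: nop_def)
qed

lemma nop_commuting_shift_left:
  assumes "field_modes A" "field_modes B" "\<And>k j v. A k (B j v) = B j (A k v)"
  shows "nop (\<lambda>k. A (k + r)) B n v = nop A B (n + r) v"
  using nop_shift_left[of A B "\<lambda>_ _. 0" r n v] assms by simp

text \<open>
  Only the summands with index between 0 and \<open>n\<close> are ordered differently in the two products.  For
  \<open>n = 0\<close> no index but 0 occurs, so a Schwinger term proportional to \<open>k \<delta>\<^bsub>n,0\<^esub>\<close> in the commutator vanishes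
  there, and the fields may be treated as if they commuted up to \<open>C\<close>.
\<close>
lemma nop_swap:
  assumes A: "field_modes A" and B: "field_modes B"
    and comm: "\<And>k. 0 \<le> k \<and> k \<le> n \<or> n < k \<and> k < 0 \<Longrightarrow> A k (B (n - k) v) - B (n - k) (A k v) = C"
  shows "nop A B n v = nop B A n v - of_int (n + 1) * C"
proof -
  let ?f = "\<lambda>k. nop_term B A n v (n - k)" and ?g = "nop_term A B n v"
  have f: "nop B A n v = Sum_any ?f"
    unfolding nop_def by (rule Sum_any_int_reflect[symmetric])
  have "?f = (\<lambda>k. ?g k + ((if k < n + 1 then C else 0) - (if k < 0 then C else 0)))"
  proof
    fix k
    show "?f k = ?g k + ((if k < n + 1 then C else 0) - (if k < 0 then C else 0))"
      using comm[of k] by (auto simp: nop_term_def algebra_simps)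
  qed
  then have "Sum_any ?f = Sum_any ?g + of_int (n + 1) * C"
    by (simp only: Sum_any.distrib[OF finite_nop_term[OF A B] Sum_any_step(2)] Sum_any_step(1))
  then show ?thesis using f by (simp add: nop_def)
qed


text \<open>
  Up to sign and a shift of the index, the modes of the derivative of the field.
\<close>
definition index_weighted :: "(int \<Rightarrow> 'v::ring_1 \<Rightarrow> 'v) \<Rightarrow> int \<Rightarrow> 'v \<Rightarrow> 'v" where
  "index_weighted A n v = of_int n * A n v"

lemma index_weighted_shift: "of_int k * A (k + m) v = index_weighted A (k + m) v + of_int (- m) * A (k + m) v"
  by (simp add: index_weighted_def algebra_simps)

lemma field_modes_index_weighted: "field_modes A \<Longrightarrow> field_modes (index_weighted A)"
  using field_modes_of_int[of A "\<lambda>n. n"] by (simp add: index_weighted_def[abs_def])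

text \<open>
  For fixed \<open>i\<close> the summand does not depend on \<open>j\<close>, and there are \<open>\<bar>i\<bar>\<close> admissible values of \<open>j\<close>.
\<close>
lemma sum_reordering_terms:
  fixes n and v :: "'v::ring_1"
  assumes A: "field_modes A" and F: "field_modes F"
  defines "D \<equiv> \<lambda>i j. if i < 0 \<and> 0 \<le> j \<and> i + j < 0 then A i (F (n - i) v)
     else if i \<ge> 0 \<and> j < 0 \<and> i + j \<ge> 0 then - F (n - i) (A i v) else 0"
  shows "finite {(i, j). D i j \<noteq> 0}"
    and "Sum_any (\<lambda>(i, j). D i j) = - nop (index_weighted A) F n v"
proof -
  have "{(i, j). D i j \<noteq> 0} \<subseteq> (SIGMA i:{i. nop_term A F n v i \<noteq> 0}. {- \<bar>i\<bar>..\<bar>i\<bar>})"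
    by (auto simp: D_def nop_term_def split: if_splits)
  then show fin: "finite {(i, j). D i j \<noteq> 0}"
    by (rule finite_subset) (auto intro!: finite_SigmaI finite_nop_term A F)
  have inner: "Sum_any (D i) = - nop_term (index_weighted A) F n v i" for i
  proof (cases "i < 0")
    case True
    have "Sum_any (D i) = (\<Sum>j\<in>{0..<-i}. D i j)"
      by (rule Sum_any_eq_sum) (use True in \<open>auto simp: D_def\<close>)
    also have "\<dots> = (\<Sum>j\<in>{0..<-i}. A i (F (n - i) v))"
      by (rule sum.cong) (use True in \<open>auto simp: D_def\<close>)
    also have "\<dots> = of_int (- i) * A i (F (n - i) v)"
      using True by (simp add: of_nat_nat del: of_int_minus)
    finally show ?thesis using True by (simp add: nop_term_def index_weighted_def)
  next
    case False
    have "Sum_any (D i) = (\<Sum>j\<in>{-i..<0}. D i j)"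
      by (rule Sum_any_eq_sum) (use False in \<open>auto simp: D_def\<close>)
    also have "\<dots> = (\<Sum>j\<in>{-i..<0}. - F (n - i) (A i v))"
      by (rule sum.cong) (use False in \<open>auto simp: D_def\<close>)
    also have "\<dots> = - (of_int i * F (n - i) (A i v))"
      using False by (simp add: of_nat_nat)
    finally show ?thesis using False by (simp add: nop_term_def index_weighted_def field_modes_simps[OF F])
  qed
  have "Sum_any (\<lambda>(i, j). D i j) = Sum_any (\<lambda>i. Sum_any (D i))"
    by (rule Sum_any_pair[symmetric, OF fin])
  also have "\<dots> = Sum_any (\<lambda>i. - nop_term (index_weighted A) F n v i)"
    using inner by presburger
  also have "\<dots> = - nop (index_weighted A) F n v"
    using Sum_any_diff[of "\<lambda>_. 0" "nop_term (index_weighted A) F n v"]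
    by (simp add: nop_def finite_nop_term A F field_modes_index_weighted)
  finally show "Sum_any (\<lambda>(i, j). D i j) = - nop (index_weighted A) F n v" .
qed

text \<open>
  Both sides are double sums over the indices \<open>i\<close> of \<open>A\<close> and \<open>j\<close> of \<open>B\<close>.  The factors are ordered by
  the signs of \<open>i\<close> and \<open>i + j\<close> on the left, by the signs of \<open>i\<close> and \<open>j\<close> on the right.  So the summands
  agree when \<open>i\<close> and \<open>j\<close> have the same sign, and otherwise differ by a single commutator with \<open>C\<close>.  The
  number of such pairs for a given \<open>i\<close> (or \<open>j\<close>) is \<open>\<bar>i\<bar>\<close> (or \<open>\<bar>j\<bar>\<close>).
\<close>
theorem nop_quasi_assoc:
  assumes A: "field_modes A" and B: "field_modes B" and C: "field_modes C"
    and F: "field_modes F" and G: "field_modes G"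
    and BC: "\<And>k j v. B k (C j v) - C j (B k v) = F (k + j) v"
    and AC: "\<And>k j v. A k (C j v) - C j (A k v) = G (k + j) v"
  shows "nop (nop A B) C n v = nop A (nop B C) n v
    - nop (index_weighted A) F n v - nop (index_weighted B) G n v"
proof -
  define l where "l k i = (if k < 0 then nop_term A B k (C (n - k) v) i else C (n - k) (nop_term A B k v i))" for k i
  define r where "r i j = (if i < 0 then A i (nop_term B C (n - i) v j) else nop_term B C (n - i) (A i v) j)" for i j
  \<comment> \<open>The discrepancies that come from commuting B with C, and A with C.\<close>
  define D1 where "D1 i j = (if i < 0 \<and> 0 \<le> j \<and> i + j < 0 then A i (F (n - i) v)
     else if i \<ge> 0 \<and> j < 0 \<and> i + j \<ge> 0 then - F (n - i) (A i v) else 0)" for i j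
  define D2 where "D2 j i = (if j < 0 \<and> 0 \<le> i \<and> j + i < 0 then B j (G (n - j) v)
     else if j \<ge> 0 \<and> i < 0 \<and> j + i \<ge> 0 then - G (n - j) (B j v) else 0)" for i j
  note simps = field_modes_simps[OF A] field_modes_simps[OF B] field_modes_simps[OF C]
  obtain K where K: "\<And>k i. k \<ge> K \<Longrightarrow> nop_term A B k v i = 0" using nop_term_bound[OF A B] by blast
  obtain M where M: "\<And>k j. k \<ge> M \<Longrightarrow> nop_term B C k v j = 0" using nop_term_bound[OF B C] by blast
  obtain N where N: "\<And>k. k \<ge> N \<Longrightarrow> C k v = 0" by (rule field_modes_bound[OF C]) blast
  obtain P where P: "\<And>k. k \<ge> P \<Longrightarrow> A k v = 0" by (rule field_modes_bound[OF A]) blast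
  have l_zero: "l k i = 0" if "k \<notin> {min 0 (n - N)..max 0 K}" for k i
  proof (cases "k < 0")
    case True
    then have "C (n - k) v = 0" using that by (intro N) auto
    then show ?thesis using True by (simp add: l_def nop_term_def simps)
  next
    case False
    then show ?thesis using that K[of k i] by (auto simp: l_def simps)
  qed
  have l_fin: "finite {i. l k i \<noteq> 0}" for k
    using finite_nop_term[OF A B, of k "C (n - k) v"]
      finite_nonzero_image[OF field_modes_additive[OF C] finite_nop_term[OF A B], of "n - k" k v]
    by (cases "k < 0") (simp_all add: l_def)
  have "{(k, i). l k i \<noteq> 0} \<subseteq> (SIGMA k:{min 0 (n - N)..max 0 K}. {i. l k i \<noteq> 0})"
    using l_zero by fast
  then have fin_l: "finite {(k, i). l k i \<noteq> 0}"
    by (rule finite_subset) (intro finite_SigmaI l_fin finite_atLeastAtMost_int)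
  have r_zero: "r i j = 0" if "i \<notin> {min 0 (n - M)..max 0 P}" for i j
  proof (cases "i < 0")
    case True
    then have "nop_term B C (n - i) v j = 0" using that by (intro M) auto
    then show ?thesis using True by (simp add: r_def simps)
  next
    case False
    then show ?thesis using that P[of i] by (auto simp: r_def nop_term_def simps)
  qed
  have r_fin: "finite {j. r i j \<noteq> 0}" for i
    using finite_nop_term[OF B C, of "n - i" "A i v"]
      finite_nonzero_image[OF field_modes_additive[OF A] finite_nop_term[OF B C], of i "n - i" v]
    by (cases "i < 0") (simp_all add: r_def)
  have "{(i, j). r i j \<noteq> 0} \<subseteq> (SIGMA i:{min 0 (n - M)..max 0 P}. {j. r i j \<noteq> 0})"
    using r_zero by fast
  then have fin_r: "finite {(i, j). r i j \<noteq> 0}"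
    by (rule finite_subset) (intro finite_SigmaI r_fin finite_atLeastAtMost_int)
  have "nop (nop A B) C n v = Sum_any (\<lambda>k. Sum_any (l k))"
    unfolding nop_def[of "nop A B"]
  proof (rule arg_cong[where f = Sum_any], rule ext)
    fix k
    show "nop_term (nop A B) C n v k = Sum_any (l k)"
      using additive_Sum_any[OF field_modes_additive[OF C] finite_nop_term[OF A B], of "n - k" k v]
      by (cases "k < 0") (simp_all add: nop_term_def[of "nop A B"] nop_def l_def[abs_def])
  qed
  also have "\<dots> = Sum_any (\<lambda>(k, i). l k i)" by (rule Sum_any_pair[OF fin_l])
  also have "\<dots> = Sum_any (\<lambda>(i, j). l (i + j) i)"
    by (rule Sum_any.reindex_cong[where l = "\<lambda>(i, j). (i + j, i)"])
      (auto simp: fun_eq_iff intro!: bij_betw_byWitness[where f' = "\<lambda>(k, i). (i, k - i)"])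
  finally have L: "nop (nop A B) C n v = Sum_any (\<lambda>(i, j). l (i + j) i)" .
  have fin_l': "finite {x. (case x of (i, j) \<Rightarrow> l (i + j) i) \<noteq> 0}"
    by (rule finite_subset[OF _ finite_imageI[OF fin_l, of "\<lambda>(k, i). (i, k - i)"]]) (force simp: image_iff)
  have "nop A (nop B C) n v = Sum_any (\<lambda>i. Sum_any (r i))"
    unfolding nop_def[of A "nop B C"]
  proof (rule arg_cong[where f = Sum_any], rule ext)
    fix i
    show "nop_term A (nop B C) n v i = Sum_any (r i)"
      using additive_Sum_any[OF field_modes_additive[OF A] finite_nop_term[OF B C], of i "n - i" v]
      by (cases "i < 0") (simp_all add: nop_term_def[of A "nop B C"] nop_def r_def[abs_def])
  qed
  also have "\<dots> = Sum_any (\<lambda>(i, j). r i j)" by (rule Sum_any_pair[OF fin_r])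
  finally have R: "nop A (nop B C) n v = Sum_any (\<lambda>(i, j). r i j)" .
  have D1: "finite {x. (case x of (i, j) \<Rightarrow> D1 i j) \<noteq> 0}"
      "Sum_any (\<lambda>(i, j). D1 i j) = - nop (index_weighted A) F n v"
    using sum_reordering_terms[OF A F, of n v] by (simp_all add: D1_def split_def)
  have D2: "finite {(j, i). D2 j i \<noteq> 0}"
      "Sum_any (\<lambda>(j, i). D2 j i) = - nop (index_weighted B) G n v"
    using sum_reordering_terms[OF B G, of n v] by (simp_all add: D2_def)
  have D2': "Sum_any (\<lambda>(i, j). D2 j i) = Sum_any (\<lambda>(j, i). D2 j i)"
    by (rule Sum_any.reindex_cong[where l = prod.swap]) (auto simp: fun_eq_iff)
  have fin_D2: "finite {x. (case x of (i, j) \<Rightarrow> D2 j i) \<noteq> 0}"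
    by (rule finite_subset[OF _ finite_imageI[OF D2(1), of prod.swap]]) (force simp: image_iff)
  \<comment> \<open>The left sum runs over the total index of A and B; it is compared after substituting k = i + j.\<close>
  have "l (i + j) i = r i j + (D1 i j + D2 j i)" for i j
    using BC[of j "n - i - j"] AC[of i "n - i - j"]
    by (auto simp: l_def r_def D1_def D2_def nop_term_def simps algebra_simps BC[symmetric] AC[symmetric])
  then have "Sum_any (\<lambda>(i, j). l (i + j) i)
      = Sum_any (\<lambda>x. (case x of (i, j) \<Rightarrow> r i j) + ((case x of (i, j) \<Rightarrow> D1 i j) + (case x of (i, j) \<Rightarrow> D2 j i)))"
    by (intro arg_cong[where f = Sum_any]) auto
  also have "\<dots> = Sum_any (\<lambda>(i, j). r i j) + (Sum_any (\<lambda>(i, j). D1 i j) + Sum_any (\<lambda>(i, j). D2 j i))"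
    using fin_r D1(1) fin_D2 finite_nonzero_add(1)[OF D1(1) fin_D2]
    by (subst Sum_any.distrib; simp add: Sum_any.distrib split_def)
  finally show ?thesis using L R D1 D2 D2' by simp
qed

lemma nop_minus_delta_left:
  "field_modes B \<Longrightarrow> nop (\<lambda>j v. - vacuum_modes (m + j) v) B n v = - B (n + m) v"
  using nop_delta_left[of B "\<lambda>_. -1" m n v] by simp

lemma nop_vacuum_delta_left:
  "field_modes B \<Longrightarrow> nop (\<lambda>j v. vacuum_modes (m + j) v) B n v = B (n + m) v"
  using nop_delta_left[of B "\<lambda>_. 1" m n v] by simp

lemma nop_index_weighted:
  assumes A: "field_modes A" and B: "field_modes B"
  shows "nop (index_weighted A) B n v + nop A (index_weighted B) n v = of_int n * nop A B n v"
proof -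
  have "(\<lambda>k. nop_term (index_weighted A) B n v k + nop_term A (index_weighted B) n v k)
      = (\<lambda>k. of_int n * nop_term A B n v k)"
    by (auto simp: nop_term_def index_weighted_def field_modes_simps[OF A] field_modes_simps[OF B] algebra_simps)
  then have "Sum_any (\<lambda>k. nop_term (index_weighted A) B n v k + nop_term A (index_weighted B) n v k)
      = Sum_any (\<lambda>k. of_int n * nop_term A B n v k)"
    by (rule arg_cong)
  then show ?thesis
    by (simp add: nop_def Sum_any.distrib Sum_any_right_distrib finite_nop_term A B field_modes_index_weighted)
qed

section \<open>The polynomial ring\<close>

lemma poly_mapping_single_add_induct [case_names zero single add]:
  assumes "P 0" and "\<And>t c. P (Poly_Mapping.single t c)" and "\<And>p q. P p \<Longrightarrow> P q \<Longrightarrow> P (p + q)"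
  shows "P (p :: 'a \<Rightarrow>\<^sub>0 'b::comm_monoid_add)"
proof (induction p rule: update_induct)
  case const
  show ?case by (rule assms(1))
next
  case (update f a b)
  have "Poly_Mapping.update a b f = f + Poly_Mapping.single a b"
    using update(1) by (intro poly_mapping_eqI) (auto simp: lookup_update lookup_add lookup_single in_keys_iff when_def)
  then show ?case using assms(2,3) update(3) by simp
qed

lemma pi_const_hom [simp]:
  "pi_const 1 = 1" "pi_const 0 = 0"
  by (simp_all add: pi_const_def)

lemma pi_const_add: "pi_const (a + b) = pi_const a + pi_const b"
  and pi_const_mult: "pi_const (a * b) = pi_const a * pi_const b"
  and pi_const_minus: "pi_const (- a) = - pi_const a"
  and pi_const_diff: "pi_const (a - b) = pi_const a - pi_const b"
  by (simp_all add: pi_const_def single_add mult_single single_uminus single_diff)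

lemma pi_const_of_nat [simp]: "pi_const (of_nat n) = of_nat n"
  by (simp add: pi_const_def)

lemma pi_const_of_int [simp]: "pi_const (of_int n) = of_int n"
  by (cases n rule: int_cases2) (simp_all add: pi_const_minus)

lemma pi_const_numeral [simp]: "pi_const (numeral n) = numeral n"
  using pi_const_of_nat[of "numeral n"] by (simp del: pi_const_of_nat)

lemma pi_const_mult_eq: "pi_const a * (pi_const b * p) = pi_const (a * b) * p"
  by (simp add: pi_const_mult mult.assoc)

text \<open>
  Cancellation of positive integers, by multiplying with an inverse in the field of constants.
\<close>
lemma of_nat_mult_cancel_pi:
  fixes p q :: pi_space
  assumes "of_nat (Suc n) * p = of_nat (Suc n) * q"
  shows "p = q"
proof -
  let ?c = "pi_const (1 / of_nat (Suc n))"
  have "?c * pi_const (of_nat (Suc n)) = pi_const 1"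
    unfolding pi_const_mult[symmetric] by (simp del: of_nat_Suc)
  then have c: "?c * of_nat (Suc n) = 1"
    unfolding pi_const_of_nat pi_const_hom .
  have "?c * (of_nat (Suc n) * p) = ?c * (of_nat (Suc n) * q)" using assms by (rule arg_cong)
  then show ?thesis unfolding mult.assoc[symmetric] c by (simp only: mult_1)
qed

lemma single_eq_pi_const_mult: "Poly_Mapping.single t c = pi_const c * Poly_Mapping.single t 1"
  by (simp add: pi_const_def mult_single)

lemma pi_monomial_induct [case_names zero var]:
  assumes "P 0" and "\<And>v t. P t \<Longrightarrow> P (Poly_Mapping.single v 1 + t)"
  shows "P (t :: pi_var \<Rightarrow>\<^sub>0 nat)"
proof -
  have single: "P (Poly_Mapping.single v n + t)" if "P t" for v n t
  proof (induction n)
    case 0 then show ?case using that by simp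
  next
    case (Suc n)
    have "Poly_Mapping.single v (Suc n) + t = Poly_Mapping.single v 1 + (Poly_Mapping.single v n + t)"
      by (simp add: single_add[symmetric] add.assoc[symmetric])
    then show ?case using assms(2)[OF Suc] by simp
  qed
  have "P u \<Longrightarrow> P (t + u)" for u
    by (induction t arbitrary: u rule: poly_mapping_single_add_induct) (simp_all add: single add.assoc)
  from this[OF assms(1)] show ?thesis by simp
qed

text \<open>
  The polynomial 1 generates the ring under scalars, sums and multiplication by variables.  Operators
  on the ring are identified below by their value at 1 and their commutators with the variables.
\<close>
lemma pi_space_induct [case_names one const add var]:
  assumes one: "P 1" and const: "\<And>c p. P p \<Longrightarrow> P (pi_const c * p)"
    and add: "\<And>p q. P p \<Longrightarrow> P q \<Longrightarrow> P (p + q)"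
    and var: "\<And>v p. P p \<Longrightarrow> P (pi_of_var v * p)"
  shows "P (p :: pi_space)"
proof (induction p rule: poly_mapping_single_add_induct)
  case zero
  show ?case using const[OF one, of 0] by simp
next
  case (single t c)
  have "P (Poly_Mapping.single t 1)"
  proof (induction t rule: pi_monomial_induct)
    case zero then show ?case using one by simp
  next
    case (var v t)
    then show ?case using assms(4)[OF var] by (simp add: pi_of_var_def mult_single)
  qed
  then show ?case using const by (simp add: single_eq_pi_const_mult[of t c])
next
  case (add p q)
  then show ?case by (rule assms(3))
qed

definition pi_linear :: "(pi_space \<Rightarrow> pi_space) \<Rightarrow> bool" where
  "pi_linear F \<longleftrightarrow> Modules.additive F \<and> (\<forall>c p. F (pi_const c * p) = pi_const c * F p)"

lemma pi_linearI:
  assumes "\<And>p q. F (p + q) = F p + F q" "\<And>c p. F (pi_const c * p) = pi_const c * F p"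
  shows "pi_linear F"
  using assms by (simp add: pi_linear_def additive_def)

lemma pi_linear_simps:
  assumes "pi_linear F"
  shows "F (p + q) = F p + F q" "F (p - q) = F p - F q" "F (- p) = - F p" "F 0 = 0"
    "F (pi_const c * p) = pi_const c * F p" "F (of_int i * p) = of_int i * F p"
    "F (of_nat m * p) = of_nat m * F p" "F (sum g S) = (\<Sum>x\<in>S. F (g x))"
proof -
  interpret additive F using assms by (simp add: pi_linear_def)
  show "F (p + q) = F p + F q" "F (p - q) = F p - F q" "F (- p) = - F p" "F 0 = 0"
    by (simp_all add: add diff minus zero)
  show s: "F (pi_const c * p) = pi_const c * F p" for c p using assms by (simp add: pi_linear_def)
  show "F (of_int i * p) = of_int i * F p" "F (of_nat m * p) = of_nat m * F p"
    using s[of "of_int i" p] s[of "of_nat m" p] by simp_all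
  show "F (sum g S) = (\<Sum>x\<in>S. F (g x))" by (rule sum)
qed

lemma pi_linear_additive: "pi_linear F \<Longrightarrow> Modules.additive F"
  by (simp add: pi_linear_def)

lemma pi_linear_mult [simp]: "pi_linear (\<lambda>p. q * p)"
  by (rule pi_linearI) (simp_all add: algebra_simps)

lemma pi_linear_compose: "pi_linear F \<Longrightarrow> pi_linear G \<Longrightarrow> pi_linear (\<lambda>p. F (G p))"
  by (rule pi_linearI) (simp_all add: pi_linear_simps)

lemma pi_deriv_add: "pi_deriv v (p + q) = pi_deriv v p + pi_deriv v q"
  unfolding pi_deriv_def
  by (rule setsum_keys_plus_distrib) (simp_all add: algebra_simps single_add)

lemma pi_deriv_single: "pi_deriv v (Poly_Mapping.single t c)
    = Poly_Mapping.single (t - Poly_Mapping.single v 1) (of_nat (Poly_Mapping.lookup t v) * c)"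
  by (cases "c = 0") (simp_all add: pi_deriv_def)

lemma pi_linear_deriv: "pi_linear (pi_deriv v)"
proof (rule pi_linearI)
  fix c p
  show "pi_deriv v (pi_const c * p) = pi_const c * pi_deriv v p"
  proof (induction p rule: poly_mapping_single_add_induct)
    case zero then show ?case by (simp add: pi_deriv_def)
  next
    case (single t d)
    then show ?case by (simp add: pi_const_def mult_single pi_deriv_single mult.left_commute)
  next
    case (add p q) then show ?case by (simp add: pi_deriv_add algebra_simps)
  qed
qed (rule pi_deriv_add)

lemma pi_deriv_one [simp]: "pi_deriv v 1 = 0"
  using pi_deriv_single[of v 0 1] by simp

lemma pi_deriv_var: "pi_deriv v (pi_of_var u * p) = pi_of_var u * pi_deriv v p + (if u = v then p else 0)"
proof (induction p rule: poly_mapping_single_add_induct)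
  case zero then show ?case by (simp add: pi_deriv_def)
next
  case (single t c)
  show ?case
  proof (cases "u = v")
    case True
    show ?thesis
    proof (cases "Poly_Mapping.lookup t v = 0")
      case t: True
      have "Poly_Mapping.single v 1 + t - Poly_Mapping.single v 1 = t"
        by simp
      then show ?thesis using True t by (simp add: pi_of_var_def mult_single pi_deriv_single lookup_add lookup_single)
    next
      case False
      have "Poly_Mapping.single v 1 + (t - Poly_Mapping.single v 1) = t"
        using False by (intro poly_mapping_eqI) (auto simp: lookup_add lookup_minus lookup_single when_def)
      then show ?thesis using True
        by (simp add: pi_of_var_def mult_single pi_deriv_single lookup_add lookup_single distrib_right single_add add.commute)
    qed
  next
    case False
    have "Poly_Mapping.single u 1 + t - Poly_Mapping.single v 1 = Poly_Mapping.single u 1 + (t - Poly_Mapping.single v 1)"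
      using False by (intro poly_mapping_eqI) (auto simp: lookup_add lookup_minus lookup_single when_def)
    then show ?thesis using False
      by (simp add: pi_of_var_def mult_single pi_deriv_single lookup_add lookup_single when_def)
  qed
next
  case (add p q) then show ?case by (simp add: pi_deriv_add algebra_simps)
qed

lemma pi_deriv_commute: "pi_deriv u (pi_deriv v p) = pi_deriv v (pi_deriv u p)"
proof (induction p rule: pi_space_induct)
  case one
  show ?case by (simp add: pi_linear_simps(4)[OF pi_linear_deriv])
next
  case (const c p) then show ?case by (simp add: pi_linear_simps(5)[OF pi_linear_deriv])
next
  case (add p q) then show ?case by (simp add: pi_deriv_add)
next
  case (var w p)
  then show ?case
    by (cases "w = u"; cases "w = v") (simp_all add: pi_deriv_var pi_deriv_add pi_linear_simps(4)[OF pi_linear_deriv])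
qed

lemma pi_subst_single:
  assumes "finite S" "Poly_Mapping.keys t \<subseteq> S"
  shows "pi_subst s (Poly_Mapping.single t c) = pi_const c * (\<Prod>v\<in>S. s v ^ Poly_Mapping.lookup t v)"
proof -
  have "(\<Prod>v\<in>Poly_Mapping.keys t. s v ^ Poly_Mapping.lookup t v) = (\<Prod>v\<in>S. s v ^ Poly_Mapping.lookup t v)"
    using assms by (intro prod.mono_neutral_left) (auto simp: in_keys_iff)
  then show ?thesis by (cases "c = 0") (simp_all add: pi_subst_def)
qed

lemma pi_subst_add: "pi_subst s (p + q) = pi_subst s p + pi_subst s q"
  unfolding pi_subst_def
  by (rule setsum_keys_plus_distrib) (simp_all add: algebra_simps pi_const_add)

lemma pi_subst_mult: "pi_subst s (p * q) = pi_subst s p * pi_subst s q"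
proof (induction p rule: poly_mapping_single_add_induct)
  case zero then show ?case by (simp add: pi_subst_def)
next
  case (single t c)
  show ?case
  proof (induction q rule: poly_mapping_single_add_induct)
    case zero then show ?case by (simp add: pi_subst_def)
  next
    case (single u d)
    let ?S = "Poly_Mapping.keys t \<union> Poly_Mapping.keys u"
    have "pi_subst s (Poly_Mapping.single (t + u) (c * d)) = pi_const (c * d) * (\<Prod>v\<in>?S. s v ^ Poly_Mapping.lookup (t + u) v)"
      by (rule pi_subst_single) (use keys_add[of t u] in auto)
    moreover have "pi_subst s (Poly_Mapping.single t c) = pi_const c * (\<Prod>v\<in>?S. s v ^ Poly_Mapping.lookup t v)"
        "pi_subst s (Poly_Mapping.single u d) = pi_const d * (\<Prod>v\<in>?S. s v ^ Poly_Mapping.lookup u v)"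
      by (rule pi_subst_single; simp)+
    ultimately show ?case
      by (simp add: mult_single pi_const_mult lookup_add power_add prod.distrib mult_ac)
  next
    case (add p q) then show ?case by (simp add: pi_subst_add algebra_simps)
  qed
next
  case (add p q) then show ?case by (simp add: pi_subst_add algebra_simps)
qed

lemma pi_subst_const [simp]: "pi_subst s (pi_const c) = pi_const c"
  using pi_subst_single[of "{}" 0 s c] by (simp add: pi_const_def)

lemma pi_subst_one [simp]: "pi_subst s 1 = 1"
  using pi_subst_const[of s 1] by (simp del: pi_subst_const)

lemma pi_subst_var [simp]: "pi_subst s (pi_of_var v) = s v"
  using pi_subst_single[of "{v}" "Poly_Mapping.single v 1" s 1] by (simp add: pi_of_var_def)

lemma pi_linear_subst: "pi_linear (pi_subst s)"
  by (rule pi_linearI) (simp_all add: pi_subst_add pi_subst_mult)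

abbreviation xvar :: "nat \<Rightarrow> pi_space" where "xvar n \<equiv> pi_of_var (Xvar n)"
abbreviation yvar :: "nat \<Rightarrow> pi_space" where "yvar n \<equiv> pi_of_var (Yvar n)"

section \<open>Exponential series of operators\<close>

lemma series_power_coeff_linear:
  assumes "\<And>k. pi_linear (A k)"
  shows "pi_linear (series_power_coeff A r j)"
proof (induction r arbitrary: j)
  case 0 show ?case by (rule pi_linearI) (simp_all)
next
  case (Suc r)
  show ?case
    by (rule pi_linearI)
      (simp_all add: pi_linear_simps[OF assms] pi_linear_simps[OF Suc] sum.distrib sum_distrib_left)
qed

lemma series_exp_coeff_linear:
  assumes "\<And>k. pi_linear (A k)"
  shows "pi_linear (series_exp_coeff A j)"
  by (rule pi_linearI)
    (simp_all add: series_exp_coeff_def pi_linear_simps[OF series_power_coeff_linear[OF assms]]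
      sum.distrib sum_distrib_left distrib_left mult.left_commute)

lemma series_power_coeff_eq_0: "j < r \<Longrightarrow> (\<And>k. pi_linear (A k)) \<Longrightarrow> series_power_coeff A r j p = 0"
proof (induction r arbitrary: j)
  case (Suc r)
  have "A k (series_power_coeff A r (j - k) p) = 0" if "k \<in> {1..j}" for k
  proof -
    have "j - k < r" using that Suc.prems by auto
    then show ?thesis using Suc.IH[OF _ Suc.prems(2)] by (simp add: pi_linear_simps[OF Suc.prems(2)])
  qed
  then show ?case by simp
qed simp

lemma sum_triangle_swap:
  fixes g :: "nat \<Rightarrow> nat \<Rightarrow> 'a::comm_monoid_add"
  shows "(\<Sum>k=1..j. \<Sum>i=1..j - k. g k i) = (\<Sum>i=1..j. \<Sum>k=1..j - i. g k i)"
proof -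
  have "(\<Sum>k=1..j. \<Sum>i=1..j - k. g k i) = (\<Sum>k=1..j. \<Sum>i=1..j. if k + i \<le> j then g k i else 0)"
    by (intro sum.cong refl sum.mono_neutral_cong_left) auto
  also have "\<dots> = (\<Sum>i=1..j. \<Sum>k=1..j. if k + i \<le> j then g k i else 0)" by (rule sum.swap)
  also have "\<dots> = (\<Sum>i=1..j. \<Sum>k=1..j - i. g k i)"
    by (intro sum.cong refl sum.mono_neutral_cong_right) auto
  finally show ?thesis .
qed

text \<open>
  The derivative of a power, \<open>(A\<^sup>r\<^sup>+\<^sup>1)' = (r + 1) A' A\<^sup>r\<close>, for commuting coefficients.
\<close>
lemma series_power_coeff_rec:
  assumes lin: "\<And>k. pi_linear (A k)" and comm: "\<And>i k p. A i (A k p) = A k (A i p)"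
  shows "of_nat j * series_power_coeff A (Suc r) j p
    = of_nat (Suc r) * (\<Sum>k=1..j. of_nat k * A k (series_power_coeff A r (j - k) p))"
proof (induction r arbitrary: j)
  case 0
  have "(of_nat j :: pi_space) * (A k (if j - k = 0 then p else 0)) = of_nat k * A k (if j - k = 0 then p else 0)" if "k \<in> {1..j}" for k
    using that by (auto simp: pi_linear_simps[OF lin])
  then show ?case by (simp add: sum_distrib_left)
next
  case (Suc r)
  note L = pi_linear_simps[OF lin]
  let ?P = "series_power_coeff A"
  have "of_nat j * ?P (Suc (Suc r)) j p = (\<Sum>k=1..j. of_nat j * A k (?P (Suc r) (j - k) p))"
    by (simp add: sum_distrib_left)
  also have "\<dots> = (\<Sum>k=1..j. of_nat k * A k (?P (Suc r) (j - k) p) + A k (of_nat (j - k) * ?P (Suc r) (j - k) p))"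
  proof (rule sum.cong)
    fix k assume "k \<in> {1..j}"
    then have "(of_nat j :: pi_space) = of_nat k + of_nat (j - k)" by (simp flip: of_nat_add)
    then show "of_nat j * A k (?P (Suc r) (j - k) p) = of_nat k * A k (?P (Suc r) (j - k) p) + A k (of_nat (j - k) * ?P (Suc r) (j - k) p)"
      unfolding L by (simp only: ring_distribs)
  qed simp
  also have "\<dots> = (\<Sum>k=1..j. of_nat k * A k (?P (Suc r) (j - k) p))
      + (\<Sum>k=1..j. A k (of_nat (Suc r) * (\<Sum>i=1..j - k. of_nat i * A i (?P r (j - k - i) p))))"
    by (simp only: sum.distrib Suc.IH)
  also have "(\<Sum>k=1..j. A k (of_nat (Suc r) * (\<Sum>i=1..j - k. of_nat i * A i (?P r (j - k - i) p))))
      = (\<Sum>k=1..j. \<Sum>i=1..j - k. of_nat (Suc r) * (of_nat i * A i (A k (?P r (j - i - k) p))))"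
  proof (intro sum.cong refl)
    fix k i
    have "A k (of_nat (Suc r) * (\<Sum>i=1..j - k. of_nat i * A i (?P r (j - k - i) p)))
        = (\<Sum>i=1..j - k. of_nat (Suc r) * (of_nat i * A k (A i (?P r (j - k - i) p))))" for k
      by (simp only: L sum_distrib_left)
    also have "\<dots> k = (\<Sum>i=1..j - k. of_nat (Suc r) * (of_nat i * A i (A k (?P r (j - i - k) p))))" for k
      by (intro sum.cong refl) (simp only: comm[of k] Nat.diff_commute[of j k])
    finally show "A k (of_nat (Suc r) * (\<Sum>i=1..j - k. of_nat i * A i (?P r (j - k - i) p)))
        = (\<Sum>i=1..j - k. of_nat (Suc r) * (of_nat i * A i (A k (?P r (j - i - k) p))))" .
  qed
  also have "\<dots> = (\<Sum>i=1..j. \<Sum>k=1..j - i. of_nat (Suc r) * (of_nat i * A i (A k (?P r (j - i - k) p))))"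
    by (rule sum_triangle_swap)
  also have "\<dots> = of_nat (Suc r) * (\<Sum>i=1..j. of_nat i * A i (?P (Suc r) (j - i) p))"
    by (simp add: L sum_distrib_left)
  finally show ?case by (simp add: algebra_simps)
qed

lemma series_exp_coeff_0 [simp]: "series_exp_coeff A 0 p = p"
  by (simp add: series_exp_coeff_def)

text \<open>
  The differential equation \<open>(exp A)' = A' exp A\<close>.  It determines the coefficients recursively, and
  all that is needed about the exponentials is derived from it.
\<close>
lemma series_exp_coeff_rec:
  assumes lin: "\<And>k. pi_linear (A k)" and comm: "\<And>i k p. A i (A k p) = A k (A i p)"
  shows "of_nat j * series_exp_coeff A j p = (\<Sum>k=1..j. of_nat k * A k (series_exp_coeff A (j - k) p))"
proof -
  note L = pi_linear_simps[OF lin]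
  let ?P = "series_power_coeff A"
  have exp_eq: "series_exp_coeff A i p = (\<Sum>r\<le>n. pi_const (1 / fact r) * ?P r i p)" if "i \<le> n" for i n
    unfolding series_exp_coeff_def
    by (rule sum.mono_neutral_left) (use that in \<open>auto simp: series_power_coeff_eq_0[OF _ lin]\<close>)
  have fact: "pi_const (1 / fact (Suc r)) * (of_nat (Suc r) * q) = pi_const (1 / fact r) * q" for r q
    unfolding pi_const_of_nat[symmetric] pi_const_mult_eq by (simp add: field_simps del: of_nat_Suc)
  show ?thesis
  proof (cases j)
    case 0 then show ?thesis by simp
  next
    case (Suc n)
    have "of_nat j * series_exp_coeff A j p = (\<Sum>r\<le>Suc n. of_nat j * (pi_const (1 / fact r) * ?P r j p))"
      unfolding Suc by (simp only: series_exp_coeff_def sum_distrib_left)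
    also have "\<dots> = (\<Sum>r\<le>n. of_nat j * (pi_const (1 / fact (Suc r)) * ?P (Suc r) j p))"
      by (subst sum.atMost_Suc_shift) (simp add: Suc)
    also have "\<dots> = (\<Sum>r\<le>n. pi_const (1 / fact r) * (\<Sum>k=1..j. of_nat k * A k (?P r (j - k) p)))"
    proof (rule sum.cong)
      fix r
      have "of_nat j * (pi_const (1 / fact (Suc r)) * ?P (Suc r) j p) = pi_const (1 / fact (Suc r)) * (of_nat j * ?P (Suc r) j p)"
        by (simp only: mult.left_commute)
      then show "of_nat j * (pi_const (1 / fact (Suc r)) * ?P (Suc r) j p) = pi_const (1 / fact r) * (\<Sum>k=1..j. of_nat k * A k (?P r (j - k) p))"
        by (simp only: series_power_coeff_rec[OF lin comm] fact)
    qed simp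
    also have "\<dots> = (\<Sum>k=1..j. \<Sum>r\<le>n. pi_const (1 / fact r) * (of_nat k * A k (?P r (j - k) p)))"
      unfolding sum_distrib_left by (rule sum.swap)
    also have "\<dots> = (\<Sum>k=1..j. of_nat k * A k (series_exp_coeff A (j - k) p))"
    proof (rule sum.cong)
      fix k assume "k \<in> {1..j}"
      then have "series_exp_coeff A (j - k) p = (\<Sum>r\<le>n. pi_const (1 / fact r) * ?P r (j - k) p)"
        by (intro exp_eq) (auto simp: Suc)
      then show "(\<Sum>r\<le>n. pi_const (1 / fact r) * (of_nat k * A k (?P r (j - k) p))) = of_nat k * A k (series_exp_coeff A (j - k) p)"
        by (simp add: L sum_distrib_left mult.left_commute)
    qed simp
    finally show ?thesis .
  qed
qed

section \<open>The vertex operators of multiples of x\<close>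

lemma pi_linear_xop: "pi_linear (xop n)"
  by (rule pi_linearI) (simp_all add: xop_def pi_linear_simps[OF pi_linear_deriv] distrib_left mult.left_commute)

lemma pi_linear_yop: "pi_linear (yop n)"
  by (rule pi_linearI) (simp_all add: yop_def pi_linear_simps[OF pi_linear_deriv] distrib_left mult.left_commute)

lemma xop_neg: "xop (- int (Suc k)) p = xvar k * p"
  by (simp add: xop_def)

lemma xop_pos: "n > 0 \<Longrightarrow> xop n p = of_int (2 * n) * pi_deriv (Yvar (nat n)) p"
  using pi_const_of_int[of "2 * n"] by (simp add: xop_def del: pi_const_of_int)

lemma xop_zero: "xop 0 p = - p"
  by (simp add: xop_def)

lemma xop_xvar: "xop n (xvar i * p) = xvar i * xop n p"
  by (simp add: xop_def pi_deriv_var mult.left_commute)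

lemma xop_yvar: "xop n (yvar j * p) = yvar j * xop n p + (if n = int j then of_int (2 * n) * p else 0)"
proof (cases "n > 0")
  case True
  then show ?thesis by (auto simp: xop_pos pi_deriv_var distrib_left mult.left_commute)
qed (auto simp: xop_def mult.left_commute)

lemma xop_one: "n > 0 \<Longrightarrow> xop n 1 = 0"
  by (simp add: xop_pos)

lemma xop_commute: "xop m (xop n p) = xop n (xop m p)"
proof (induction p rule: pi_space_induct)
  case one
  have "xop m (xop n 1) = xop n (xop m 1)" if "m \<le> 0 \<or> n \<le> 0" for m n
  proof -
    have "xop m (xop n 1) = xop n (xop m 1)" if "n \<le> 0" for m n
    proof (cases "n = 0")
      case True then show ?thesis by (simp add: xop_zero pi_linear_simps[OF pi_linear_xop])
    next
      case False
      with that obtain i where "n = - int (Suc i)" by (metis int_cases2 neg_0_equal_iff_equal of_nat_0 of_nat_0_le_iff of_nat_eq_0_iff order_antisym old.nat.exhaust)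
      then show ?thesis using xop_xvar[of m i 1] by (simp add: xop_neg del: of_nat_Suc)
    qed
    then show ?thesis using that by metis
  qed
  then show ?case by (cases "m > 0 \<and> n > 0") (auto simp: xop_one pi_linear_simps[OF pi_linear_xop])
next
  case (const c p) then show ?case by (simp add: pi_linear_simps[OF pi_linear_xop])
next
  case (add p q) then show ?case by (simp add: pi_linear_simps[OF pi_linear_xop])
next
  case (var v p)
  then show ?case
    by (cases v) (simp_all add: xop_xvar xop_yvar pi_linear_simps[OF pi_linear_xop] del: of_int_mult)
qed

text \<open>
  The exponents in the two exponential factors of the vertex operator of \<open>mx\<close>.
\<close>
definition x_series :: "int \<Rightarrow> nat \<Rightarrow> pi_space \<Rightarrow> pi_space" where
  "x_series m k p = pi_const (of_int m / of_nat k) * xop (- int k) p"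

definition x_dual_series :: "int \<Rightarrow> nat \<Rightarrow> pi_space \<Rightarrow> pi_space" where
  "x_dual_series m k p = pi_const (- of_int m / of_nat k) * xop (int k) p"

lemma pi_linear_x_series: "pi_linear (x_series m k)" "pi_linear (x_dual_series m k)"
  by (rule pi_linearI; simp add: x_series_def x_dual_series_def pi_linear_simps[OF pi_linear_xop] distrib_left mult.left_commute)+

lemma x_series_commute:
  "x_series m i (x_series m k p) = x_series m k (x_series m i p)"
  "x_dual_series m i (x_dual_series m k p) = x_dual_series m k (x_dual_series m i p)"
  by (simp_all add: x_series_def x_dual_series_def pi_linear_simps[OF pi_linear_xop] xop_commute mult.left_commute)

lemma of_nat_x_series: "k \<ge> 1 \<Longrightarrow> of_nat k * x_series m k p = of_int m * (xvar (k - 1) * p)"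
proof -
  assume "k \<ge> 1"
  then have "of_nat k * (pi_const (of_int m / of_nat k) * q) = of_int m * q" for q
    unfolding pi_const_of_nat[symmetric] pi_const_of_int[symmetric] pi_const_mult_eq by simp
  moreover have "xop (- int k) p = xvar (k - 1) * p"
    using xop_neg[of "k - 1"] \<open>k \<ge> 1\<close> by simp
  ultimately show ?thesis by (simp add: x_series_def)
qed

lemma x_dual_series_eq: "k \<ge> 1 \<Longrightarrow> x_dual_series m k p = - (of_int (2 * m) * pi_deriv (Yvar k) p)"
proof -
  assume "k \<ge> 1"
  then have "pi_const (- of_int m / of_nat k) * (of_int (2 * int k) * q) = - (of_int (2 * m) * q)" for q
  proof -
    have "- of_int m / of_nat k * of_int (2 * int k) = (- of_int (2 * m) :: complex)"
      using \<open>k \<ge> 1\<close> by (simp add: field_simps)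
    then show ?thesis
      unfolding pi_const_of_int[symmetric] pi_const_mult_eq by (simp only: pi_const_minus mult_minus_left)
  qed
  then show ?thesis using \<open>k \<ge> 1\<close> by (simp add: x_dual_series_def xop_pos del: of_int_mult)
qed

text \<open>
  The coefficient of \<open>z\<^sup>i\<close> in \<open>exp (m \<Sum>k\<ge>1. x(-k) z\<^sup>k / k)\<close>, a polynomial in the variables \<open>x(-k)\<close>.
\<close>
definition exp_mode :: "int \<Rightarrow> nat \<Rightarrow> pi_space" where
  "exp_mode m i = series_exp_coeff (x_series m) i 1"

lemma exp_mode_0 [simp]: "exp_mode m 0 = 1"
  by (simp add: exp_mode_def)

lemma exp_mode_Suc_rec:
  "of_nat (Suc j) * exp_mode m (Suc j) = of_int m * (\<Sum>k\<le>j. xvar k * exp_mode m (j - k))"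
proof -
  have "of_nat (Suc j) * exp_mode m (Suc j) = (\<Sum>k=1..Suc j. of_int m * (xvar (k - 1) * exp_mode m (Suc j - k)))"
    unfolding exp_mode_def series_exp_coeff_rec[OF pi_linear_x_series(1) x_series_commute(1)]
    by (intro sum.cong refl of_nat_x_series) simp
  also have "\<dots> = (\<Sum>k\<le>j. of_int m * (xvar k * exp_mode m (j - k)))"
    by (rule sum.reindex_bij_witness[of _ Suc "\<lambda>k. k - 1"]) auto
  finally show ?thesis by (simp add: sum_distrib_left)
qed

text \<open>
  An operator that commutes with the \<open>x(-k)\<close> commutes with every polynomial in them; the recursion
  for the coefficients makes this an induction.
\<close>
lemma exp_mode_commute:
  assumes F: "pi_linear F" and x: "\<And>i p. F (xvar i * p) = xvar i * F p"
  shows "F (exp_mode m j * p) = exp_mode m j * F p"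
proof (induction j arbitrary: p rule: less_induct)
  case (less j)
  show ?case
  proof (cases j)
    case (Suc n)
    have "of_nat (Suc n) * F (exp_mode m j * p) = F ((of_nat (Suc n) * exp_mode m (Suc n)) * p)"
      by (simp only: pi_linear_simps[OF F] mult.assoc Suc)
    also have "\<dots> = of_int m * (\<Sum>k\<le>n. F (xvar k * (exp_mode m (n - k) * p)))"
      unfolding exp_mode_Suc_rec by (simp only: pi_linear_simps[OF F] sum_distrib_right mult.assoc)
    also have "(\<Sum>k\<le>n. F (xvar k * (exp_mode m (n - k) * p))) = (\<Sum>k\<le>n. xvar k * (exp_mode m (n - k) * F p))"
      by (intro sum.cong refl) (simp add: x less Suc)
    also have "of_int m * \<dots> = (of_nat (Suc n) * exp_mode m (Suc n)) * F p"
      unfolding exp_mode_Suc_rec by (simp only: sum_distrib_right mult.assoc)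
    finally show ?thesis unfolding Suc mult.assoc by (rule of_nat_mult_cancel_pi)
  qed simp
qed

lemma series_exp_coeff_x_series: "series_exp_coeff (x_series m) j p = exp_mode m j * p"
proof (induction j rule: less_induct)
  case (less j)
  show ?case
  proof (cases j)
    case (Suc n)
    have "of_nat (Suc n) * series_exp_coeff (x_series m) (Suc n) p
        = (\<Sum>k=1..Suc n. of_nat k * x_series m k (series_exp_coeff (x_series m) (Suc n - k) p))"
      by (rule series_exp_coeff_rec[OF pi_linear_x_series(1) x_series_commute(1)])
    also have "\<dots> = (\<Sum>k=1..Suc n. of_nat k * x_series m k (exp_mode m (Suc n - k)) * p)"
    proof (intro sum.cong refl)
      fix k assume k: "k \<in> {1..Suc n}"
      then have "series_exp_coeff (x_series m) (Suc n - k) p = exp_mode m (Suc n - k) * p"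
        by (intro less) (auto simp: Suc)
      then show "of_nat k * x_series m k (series_exp_coeff (x_series m) (Suc n - k) p)
          = of_nat k * x_series m k (exp_mode m (Suc n - k)) * p"
        using k by (simp add: of_nat_x_series mult.assoc)
    qed
    also have "\<dots> = (\<Sum>k=1..Suc n. of_nat k * x_series m k (exp_mode m (Suc n - k))) * p"
      by (simp only: sum_distrib_right)
    also have "\<dots> = (of_nat (Suc n) * exp_mode m (Suc n)) * p"
      unfolding exp_mode_def series_exp_coeff_rec[OF pi_linear_x_series(1) x_series_commute(1)] ..
    finally show ?thesis unfolding Suc mult.assoc by (rule of_nat_mult_cancel_pi)
  qed simp
qed

text \<open>
  The product of the series for \<open>m\<close> and \<open>n\<close> solves the differential equation of the series for \<open>m + n\<close>.
\<close>
lemma exp_mode_add: "(\<Sum>i\<le>N. exp_mode m i * exp_mode n (N - i)) = exp_mode (m + n) N"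
proof -
  define f where "f m = Abs_fps (exp_mode m)" for m
  define g where "g = Abs_fps xvar"
  have g_nth: "fps_nth g i = xvar i" for i by (simp add: g_def)
  have deriv: "fps_deriv (f m) = of_int m * (g * f m)" for m
    by (rule fps_ext) (simp add: f_def g_nth fps_mult_nth[of g] fps_of_int[symmetric] exp_mode_Suc_rec atLeast0AtMost del: of_nat_Suc)
  define h where "h = f m * f n"
  have "fps_deriv h = of_int (m + n) * (g * h)"
    by (simp add: h_def deriv algebra_simps)
  then have "fps_nth (fps_deriv h) j = fps_nth (fps_const (of_int (m + n)) * (g * h)) j" for j
    by (simp only: fps_of_int)
  then have rec: "of_nat (Suc j) * fps_nth h (Suc j) = of_int (m + n) * (\<Sum>k\<le>j. xvar k * fps_nth h (j - k))" for j
    by (simp add: fps_mult_nth[of g] g_nth atLeast0AtMost del: of_nat_Suc of_int_add)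
  have "fps_nth h N = exp_mode (m + n) N"
  proof (induction N rule: less_induct)
    case (less N)
    show ?case
    proof (cases N)
      case 0 then show ?thesis by (simp add: f_def h_def)
    next
      case (Suc j)
      have "of_nat (Suc j) * fps_nth h (Suc j) = of_nat (Suc j) * exp_mode (m + n) (Suc j)"
        unfolding rec exp_mode_Suc_rec
        by (intro arg_cong2[where f = "(*)"] sum.cong refl less) (simp add: Suc)
      then show ?thesis unfolding Suc by (rule of_nat_mult_cancel_pi)
    qed
  qed
  then show ?thesis by (simp add: f_def h_def fps_mult_nth atLeast0AtMost)
qed

text \<open>
  The coefficient of \<open>z\<^sup>-\<^sup>j\<close> in \<open>exp (-m \<Sum>k\<ge>1. x(k) z\<^sup>-\<^sup>k / k)\<close>.  Since \<open>x(k)\<close> is \<open>2k\<close> times the derivative with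
  respect to \<open>y(-k)\<close>, the series substitutes \<open>y(-k) - 2m z\<^sup>-\<^sup>k\<close> for \<open>y(-k)\<close>.
\<close>
definition exp_shift :: "int \<Rightarrow> nat \<Rightarrow> pi_space \<Rightarrow> pi_space" where
  "exp_shift m j p = series_exp_coeff (x_dual_series m) j p"

lemma pi_linear_exp_shift: "pi_linear (exp_shift m j)"
  using series_exp_coeff_linear[of "x_dual_series m" j, OF pi_linear_x_series(2)]
  by (simp add: exp_shift_def[abs_def])

lemma exp_shift_0 [simp]: "exp_shift m 0 p = p"
  by (simp add: exp_shift_def)

lemma exp_shift_rec:
  "of_nat j * exp_shift m j p = (\<Sum>k=1..j. of_nat k * x_dual_series m k (exp_shift m (j - k) p))"
  unfolding exp_shift_def by (rule series_exp_coeff_rec[OF pi_linear_x_series(2) x_series_commute(2)])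

lemma exp_shift_commute:
  assumes F: "pi_linear F" and "\<And>k p. k \<ge> 1 \<Longrightarrow> x_dual_series m k (F p) = F (x_dual_series m k p)"
  shows "exp_shift m j (F p) = F (exp_shift m j p)"
proof (induction j rule: less_induct)
  case (less j)
  show ?case
  proof (cases j)
    case (Suc n)
    have "of_nat (Suc n) * exp_shift m (Suc n) (F p) = (\<Sum>k=1..Suc n. of_nat k * x_dual_series m k (F (exp_shift m (Suc n - k) p)))"
      unfolding exp_shift_rec by (intro sum.cong refl) (simp add: less Suc)
    also have "\<dots> = F (of_nat (Suc n) * exp_shift m (Suc n) p)"
      unfolding exp_shift_rec pi_linear_simps[OF F] by (intro sum.cong refl) (simp add: assms(2))
    also have "\<dots> = of_nat (Suc n) * F (exp_shift m (Suc n) p)" by (rule pi_linear_simps[OF F])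
    finally show ?thesis unfolding Suc by (rule of_nat_mult_cancel_pi)
  qed simp
qed

lemma exp_shift_xvar: "exp_shift m j (xvar i * p) = xvar i * exp_shift m j p"
  by (rule exp_shift_commute) (simp_all add: x_dual_series_def xop_xvar mult.left_commute)

lemma exp_shift_yvar0: "exp_shift m j (yvar 0 * p) = yvar 0 * exp_shift m j p"
  by (rule exp_shift_commute) (simp_all add: x_dual_series_def xop_yvar mult.left_commute)

lemma exp_shift_one: "j > 0 \<Longrightarrow> exp_shift m j 1 = 0"
proof (induction j rule: less_induct)
  case (less j)
  then obtain n where Suc: "j = Suc n" by (cases j) auto
  have "of_nat (Suc n) * exp_shift m (Suc n) 1 = (\<Sum>k=1..Suc n. 0)"
    unfolding exp_shift_rec
  proof (intro sum.cong refl)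
    fix k assume "k \<in> {1..Suc n}"
    then show "of_nat k * x_dual_series m k (exp_shift m (Suc n - k) 1) = 0"
      using less.IH[of "Suc n - k"] Suc by (cases "Suc n - k = 0") (auto simp: x_dual_series_eq pi_linear_simps(4)[OF pi_linear_deriv])
  qed
  also have "\<dots> = of_nat (Suc n) * 0" by simp
  finally show ?case unfolding Suc by (rule of_nat_mult_cancel_pi)
qed

text \<open>
  The substitution \<open>y(-i) \<mapsto> y(-i) - 2m z\<^sup>-\<^sup>i\<close>, coefficient by coefficient.
\<close>
lemma exp_shift_yvar:
  assumes "i \<ge> 1"
  shows "exp_shift m j (yvar i * p) = yvar i * exp_shift m j p
    - (if i \<le> j then of_int (2 * m) * exp_shift m (j - i) p else 0)"
proof (induction j rule: less_induct)
  case (less j)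
  note L = pi_linear_simps[OF pi_linear_x_series(2)]
  let ?d = "\<lambda>k. if i \<le> k then of_int (2 * m) * exp_shift m (k - i) p else 0"
  have A: "x_dual_series m k (yvar i * q) = yvar i * x_dual_series m k q - (if k = i then of_int (2 * m) * q else 0)"
    if "k \<ge> 1" for k q
    using that by (simp add: x_dual_series_eq pi_deriv_var distrib_left mult.left_commute)
  show ?case
  proof (cases j)
    case 0 then show ?thesis using assms by simp
  next
    case (Suc n)
    have "of_nat j * exp_shift m j (yvar i * p)
        = (\<Sum>k=1..j. of_nat k * x_dual_series m k (yvar i * exp_shift m (j - k) p - ?d (j - k)))"
      unfolding exp_shift_rec by (intro sum.cong refl) (simp add: less)
    also have "\<dots> = (\<Sum>k=1..j. yvar i * (of_nat k * x_dual_series m k (exp_shift m (j - k) p))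
        - (if k = i then of_nat k * (of_int (2 * m) * exp_shift m (j - k) p) else 0)
        - of_nat k * x_dual_series m k (?d (j - k)))"
      by (intro sum.cong refl) (auto simp: L A algebra_simps)
    also have "\<dots> = yvar i * (of_nat j * exp_shift m j p)
        - (\<Sum>k=1..j. if k = i then of_nat k * (of_int (2 * m) * exp_shift m (j - k) p) else 0)
        - (\<Sum>k=1..j. of_nat k * x_dual_series m k (?d (j - k)))"
      by (simp only: sum_subtractf sum_distrib_left exp_shift_rec)
    also have "(\<Sum>k=1..j. if k = i then of_nat k * (of_int (2 * m) * exp_shift m (j - k) p) else 0)
        = (if i \<le> j then of_nat i * (of_int (2 * m) * exp_shift m (j - i) p) else 0)"
      using assms by (subst sum.delta) auto
    also have "(\<Sum>k=1..j. of_nat k * x_dual_series m k (?d (j - k)))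
        = (if i \<le> j then of_nat (j - i) * (of_int (2 * m) * exp_shift m (j - i) p) else 0)"
    proof (cases "i \<le> j")
      case True
      have "(\<Sum>k=1..j. of_nat k * x_dual_series m k (?d (j - k)))
          = (\<Sum>k=1..j - i. of_int (2 * m) * (of_nat k * x_dual_series m k (exp_shift m (j - i - k) p)))"
      proof (rule sum.mono_neutral_cong_right)
        show "\<forall>k\<in>{1..j} - {1..j - i}. of_nat k * x_dual_series m k (?d (j - k)) = 0"
          using True by (auto simp: L)
        fix k assume "k \<in> {1..j - i}"
        then have "i \<le> j - k" "j - k - i = j - i - k" using True by auto
        then show "of_nat k * x_dual_series m k (?d (j - k)) = of_int (2 * m) * (of_nat k * x_dual_series m k (exp_shift m (j - i - k) p))"
          by (simp add: L mult.left_commute del: of_int_mult)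
      qed auto
      also have "\<dots> = of_int (2 * m) * (of_nat (j - i) * exp_shift m (j - i) p)"
        by (simp only: sum_distrib_left exp_shift_rec)
      finally show ?thesis using True by (simp add: mult.left_commute del: of_int_mult)
    next
      case False
      then show ?thesis by (auto simp: L intro!: sum.neutral)
    qed
    also have "yvar i * (of_nat j * exp_shift m j p)
        - (if i \<le> j then of_nat i * (of_int (2 * m) * exp_shift m (j - i) p) else 0)
        - (if i \<le> j then of_nat (j - i) * (of_int (2 * m) * exp_shift m (j - i) p) else 0)
        = of_nat j * (yvar i * exp_shift m j p - ?d j)"
    proof (cases "i \<le> j")
      case True
      then have "(of_nat j :: pi_space) = of_nat i + of_nat (j - i)" by (simp flip: of_nat_add)
      then show ?thesis using True by (simp add: ring_distribs mult.left_commute del: of_int_mult)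
    qed (simp add: mult.left_commute)
    finally show ?thesis unfolding Suc by (rule of_nat_mult_cancel_pi)
  qed
qed

lemma exp_shift_bound: "\<exists>N. \<forall>j\<ge>N. exp_shift m j p = 0"
proof (induction p rule: pi_space_induct)
  case one
  show ?case by (rule exI[of _ 1]) (simp add: exp_shift_one)
next
  case (const c p)
  then obtain N where "\<forall>j\<ge>N. exp_shift m j p = 0" by blast
  then show ?case by (intro exI[of _ N]) (simp add: pi_linear_simps[OF pi_linear_exp_shift])
next
  case (add p q)
  then obtain M N where "\<forall>j\<ge>M. exp_shift m j p = 0" "\<forall>j\<ge>N. exp_shift m j q = 0" by blast
  then show ?case by (intro exI[of _ "max M N"]) (simp add: pi_linear_simps[OF pi_linear_exp_shift])
next
  case (var v p)
  then obtain N where N: "\<forall>j\<ge>N. exp_shift m j p = 0" by blast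
  show ?case
  proof (cases v)
    case (Xvar i) then show ?thesis using N by (intro exI[of _ N]) (simp add: exp_shift_xvar)
  next
    case (Yvar i)
    show ?thesis
    proof (cases "i = 0")
      case True then show ?thesis using N Yvar by (intro exI[of _ N]) (simp add: exp_shift_yvar0)
    next
      case False
      then show ?thesis using N Yvar
        by (intro exI[of _ "N + i"]) (auto simp: exp_shift_yvar)
    qed
  qed
qed


text \<open>
  Extension by zero to integer indices, so that index shifts need no side conditions.
\<close>
definition exp_mode_int :: "int \<Rightarrow> int \<Rightarrow> pi_space" where
  "exp_mode_int m i = (if i < 0 then 0 else exp_mode m (nat i))"

text \<open>
  The vertex operator without its factor \<open>E\<^sup>m\<close>.
\<close>
definition pre_vertex :: "int \<Rightarrow> int \<Rightarrow> pi_space \<Rightarrow> pi_space" where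
  "pre_vertex m d p = Sum_any (\<lambda>(i, j). if - m + int i - int j = d
     then series_exp_coeff (x_series m) i (series_exp_coeff (x_dual_series m) j p) else 0)"

lemma Y_exp_coeff_eq: "Y_exp_coeff l m d p = E_op l m (pre_vertex m d p)"
  unfolding Y_exp_coeff_def pre_vertex_def x_series_def[abs_def] x_dual_series_def[abs_def] ..

text \<open>
  The exponents fix \<open>i\<close> in terms of \<open>j\<close>, and \<open>j\<close> is bounded because the shift series is finite on
  \<open>p\<close>.
\<close>
lemma pre_vertex_eq:
  assumes N: "\<forall>j\<ge>N. exp_shift m j p = 0"
  shows "pre_vertex m d p = (\<Sum>j<N. exp_mode_int m (d + m + int j) * exp_shift m j p)"
proof -
  let ?f = "\<lambda>(i, j). if - m + int i - int j = d
     then series_exp_coeff (x_series m) i (series_exp_coeff (x_dual_series m) j p) else 0"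
  let ?J = "{j. j < N \<and> 0 \<le> d + m + int j}" and ?h = "\<lambda>j. (nat (d + m + int j), j)"
  have f: "?f (i, j) = (if int i = d + m + int j then exp_mode m i * exp_shift m j p else 0)" for i j
    by (auto simp: series_exp_coeff_x_series exp_shift_def)
  have "pre_vertex m d p = sum ?f (?h ` ?J)"
    unfolding pre_vertex_def
  proof (rule Sum_any_eq_sum)
    show "finite (?h ` ?J)" by simp
    fix x assume x: "x \<notin> ?h ` ?J"
    obtain i j where ij: "x = (i, j)" by (cases x)
    show "?f x = 0"
    proof (cases "int i = d + m + int j")
      case True
      then have "i = nat (d + m + int j)" "0 \<le> d + m + int j" by simp_all
      then have "j \<ge> N" using x ij by (force simp: image_iff)
      then show ?thesis using N unfolding ij f by simp
    next
      case False
      then show ?thesis unfolding ij f by simp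
    qed
  qed
  also have "\<dots> = (\<Sum>j\<in>?J. ?f (?h j))"
    by (subst sum.reindex) (auto simp: inj_on_def)
  also have "\<dots> = (\<Sum>j<N. exp_mode_int m (d + m + int j) * exp_shift m j p)"
    unfolding f by (rule sum.mono_neutral_cong_left) (auto simp: exp_mode_int_def)
  finally show ?thesis .
qed

lemma exp_shift_bound_pair:
  obtains N where "\<forall>j\<ge>N. exp_shift m j p = 0" "\<forall>j\<ge>N. exp_shift m j q = 0"
proof -
  obtain M N where "\<forall>j\<ge>M. exp_shift m j p = 0" "\<forall>j\<ge>N. exp_shift m j q = 0"
    using exp_shift_bound by blast
  then show ?thesis by (intro that[of "max M N"]) auto
qed

lemma pi_linear_pre_vertex: "pi_linear (pre_vertex m d)"
proof (rule pi_linearI)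
  note L = pi_linear_simps[OF pi_linear_exp_shift]
  fix p q
  obtain N where N: "\<forall>j\<ge>N. exp_shift m j p = 0" "\<forall>j\<ge>N. exp_shift m j q = 0"
    by (rule exp_shift_bound_pair[of m p q]) blast
  then have "\<forall>j\<ge>N. exp_shift m j (p + q) = 0" by (simp add: L)
  then show "pre_vertex m d (p + q) = pre_vertex m d p + pre_vertex m d q"
    using pre_vertex_eq[OF N(1)] pre_vertex_eq[OF N(2)] pre_vertex_eq[of N m "p + q"]
    by (simp add: L distrib_left sum.distrib)
next
  note L = pi_linear_simps[OF pi_linear_exp_shift]
  fix c p
  obtain N where N: "\<forall>j\<ge>N. exp_shift m j p = 0" "\<forall>j\<ge>N. exp_shift m j p = 0"
    by (rule exp_shift_bound_pair[of m p p]) blast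
  then have "\<forall>j\<ge>N. exp_shift m j (pi_const c * p) = 0" by (simp add: L)
  then show "pre_vertex m d (pi_const c * p) = pi_const c * pre_vertex m d p"
    using pre_vertex_eq[OF N(1)] pre_vertex_eq[of N m "pi_const c * p"]
    by (simp add: L sum_distrib_left mult.left_commute)
qed

lemma pre_vertex_one: "pre_vertex m d 1 = exp_mode_int m (d + m)"
  using pre_vertex_eq[of 1 m 1 d] by (simp add: exp_shift_one)

lemma pre_vertex_commute:
  assumes "\<And>j. exp_shift m j (v * p) = v * exp_shift m j p"
  shows "pre_vertex m d (v * p) = v * pre_vertex m d p"
proof -
  obtain N where N: "\<forall>j\<ge>N. exp_shift m j p = 0" "\<forall>j\<ge>N. exp_shift m j (v * p) = 0"
    by (rule exp_shift_bound_pair[of m p "v * p"]) blast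
  show ?thesis
    using pre_vertex_eq[OF N(1)] pre_vertex_eq[OF N(2)]
    by (simp add: assms sum_distrib_left mult.left_commute)
qed

lemma pre_vertex_yvar:
  assumes "i \<ge> 1"
  shows "pre_vertex m d (yvar i * p) = yvar i * pre_vertex m d p - of_int (2 * m) * pre_vertex m (d + int i) p"
proof -
  obtain N0 where N0: "\<forall>j\<ge>N0. exp_shift m j p = 0" "\<forall>j\<ge>N0. exp_shift m j (yvar i * p) = 0"
    by (rule exp_shift_bound_pair[of m p "yvar i * p"]) blast
  let ?N = "N0 + i"
  have N: "\<forall>j\<ge>?N. exp_shift m j p = 0" "\<forall>j\<ge>?N. exp_shift m j (yvar i * p) = 0" using N0 by auto
  have "pre_vertex m d (yvar i * p)
      = (\<Sum>j<?N. yvar i * (exp_mode_int m (d + m + int j) * exp_shift m j p)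
          - (if i \<le> j then of_int (2 * m) * (exp_mode_int m (d + m + int j) * exp_shift m (j - i) p) else 0))"
    unfolding pre_vertex_eq[OF N(2)] exp_shift_yvar[OF assms]
    by (intro sum.cong refl) (auto simp: right_diff_distrib mult.left_commute)
  also have "\<dots> = yvar i * pre_vertex m d p
      - (\<Sum>j<?N. if i \<le> j then of_int (2 * m) * (exp_mode_int m (d + m + int j) * exp_shift m (j - i) p) else 0)"
    by (simp only: sum_subtractf pre_vertex_eq[OF N(1)] sum_distrib_left)
  also have "(\<Sum>j<?N. if i \<le> j then of_int (2 * m) * (exp_mode_int m (d + m + int j) * exp_shift m (j - i) p) else 0)
      = (\<Sum>j\<in>{i..<?N}. of_int (2 * m) * (exp_mode_int m (d + m + int j) * exp_shift m (j - i) p))"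
    by (rule sum.mono_neutral_cong_right) auto
  also have "\<dots> = (\<Sum>j<N0. of_int (2 * m) * (exp_mode_int m (d + int i + m + int j) * exp_shift m j p))"
    by (rule sum.reindex_bij_witness[of _ "\<lambda>j. j + i" "\<lambda>j. j - i"]) (auto simp: algebra_simps)
  also have "\<dots> = of_int (2 * m) * pre_vertex m (d + int i) p"
    by (simp only: pre_vertex_eq[OF N0(1)] sum_distrib_left)
  finally show ?thesis .
qed

lemma pi_linear_E_op: "pi_linear (E_op l m)"
  by (rule pi_linearI) (simp_all add: E_op_def pi_linear_simps[OF pi_linear_subst] distrib_left mult.left_commute)

lemma E_op_one: "E_op l m 1 = pi_const (l powi m)"
  by (simp add: E_op_def)

lemma E_op_xvar: "E_op l m (xvar i * p) = xvar i * E_op l m p"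
  by (simp add: E_op_def pi_subst_mult mult.left_commute)

lemma E_op_yvar: "E_op l m (yvar i * p) = yvar i * E_op l m p - (if i = 0 then of_int (2 * m) * E_op l m p else 0)"
proof -
  have "pi_const (2 * of_int m) = of_int (2 * m)"
    using pi_const_of_int[of "2 * m"] by (simp del: pi_const_of_int)
  then show ?thesis by (simp add: E_op_def pi_subst_mult mult.left_commute left_diff_distrib right_diff_distrib)
qed

text \<open>
  The modes of the field of \<open>e\<^bsup>mx\<^esup>\<close>, indexed by degree: \<open>Y(e\<^bsup>mx\<^esup>, z)\<close> is the sum over \<open>n\<close> of the modes
  times \<open>z\<^bsup>-n-m\<^esup>\<close>.  With this indexing all product formulas are additive in \<open>n\<close>.
\<close>
definition vertex_mode :: "complex \<Rightarrow> int \<Rightarrow> int \<Rightarrow> pi_space \<Rightarrow> pi_space" where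
  "vertex_mode l m n = Y_exp_coeff l m (- n - m)"

lemma a_op_eq: "a_op l = vertex_mode l 1"
  and a_inv_op_eq: "a_inv_op l = vertex_mode l (- 1)"
  by (simp_all add: fun_eq_iff a_op_def a_inv_op_def vertex_mode_def)

lemma pi_linear_vertex_mode: "pi_linear (vertex_mode l m n)"
  unfolding vertex_mode_def Y_exp_coeff_eq[abs_def]
  by (rule pi_linear_compose[OF pi_linear_E_op pi_linear_pre_vertex])

lemma vertex_mode_xvar: "vertex_mode l m n (xvar i * p) = xvar i * vertex_mode l m n p"
  by (simp add: vertex_mode_def Y_exp_coeff_eq pre_vertex_commute exp_shift_xvar E_op_xvar)

text \<open>
  For \<open>i \<ge> 1\<close> the correction comes from the shift series, for \<open>i = 0\<close> from \<open>E\<^sup>m\<close>.  Together with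
  \<open>vertex_mode_xvar\<close> and \<open>vertex_mode_one\<close> this determines the operator.
\<close>
lemma vertex_mode_yvar:
  "vertex_mode l m n (yvar i * p) = yvar i * vertex_mode l m n p - of_int (2 * m) * vertex_mode l m (n - int i) p"
proof (cases "i = 0")
  case True
  then show ?thesis
    by (simp add: vertex_mode_def Y_exp_coeff_eq pre_vertex_commute exp_shift_yvar0 E_op_yvar)
next
  case False
  have "pre_vertex m (- n - m + int i) p = pre_vertex m (int i - n - m) p"
    by (intro arg_cong2[where f = "pre_vertex m"]) simp_all
  then show ?thesis using False
    by (simp add: vertex_mode_def Y_exp_coeff_eq pre_vertex_yvar E_op_yvar pi_linear_simps[OF pi_linear_E_op] del: of_int_mult)
qed

lemma E_op_exp_modez: "E_op l m (exp_mode_int n i) = pi_const (l powi m) * exp_mode_int n i"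
  using exp_mode_commute[OF pi_linear_E_op E_op_xvar, of l m n _ 1]
  by (simp add: exp_mode_int_def E_op_one pi_linear_simps[OF pi_linear_E_op])

lemma vertex_mode_one: "vertex_mode l m n 1 = pi_const (l powi m) * exp_mode_int m (- n)"
  by (simp add: vertex_mode_def Y_exp_coeff_eq pre_vertex_one E_op_exp_modez)

lemma vertex_mode_exp_mode: "vertex_mode l m n (exp_mode k j * p) = exp_mode k j * vertex_mode l m n p"
  by (rule exp_mode_commute[OF pi_linear_vertex_mode vertex_mode_xvar])

lemma vertex_mode_exp_modez: "vertex_mode l m n (exp_mode_int k j * p) = exp_mode_int k j * vertex_mode l m n p"
  by (simp add: exp_mode_int_def vertex_mode_exp_mode pi_linear_simps[OF pi_linear_vertex_mode])

section \<open>Commutators and products of the vertex operators\<close>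

lemma field_modes_pi_spaceI:
  assumes lin: "\<And>n. pi_linear (A n)" and one: "\<exists>N. \<forall>n\<ge>N. A n 1 = 0"
    and var: "\<And>v p N. \<forall>n\<ge>N. A n p = 0 \<Longrightarrow> \<exists>N. \<forall>n\<ge>N. A n (pi_of_var v * p) = 0"
  shows "field_modes A"
proof (rule field_modesI)
  note L = pi_linear_simps[OF lin]
  show "Modules.additive (A n)" for n by (rule pi_linear_additive[OF lin])
  fix p show "\<exists>N. \<forall>n\<ge>N. A n p = 0"
  proof (induction p rule: pi_space_induct)
    case one show ?case by (rule assms(2))
  next
    case (const c p)
    then obtain N where "\<forall>n\<ge>N. A n p = 0" by blast
    then show ?case by (intro exI[of _ N]) (simp add: L)
  next
    case (add p q)
    then obtain M N where "\<forall>n\<ge>M. A n p = 0" "\<forall>n\<ge>N. A n q = 0" by blast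
    then show ?case by (intro exI[of _ "max M N"]) (simp add: L)
  next
    case (var v p) then show ?case using assms(3) by blast
  qed
qed

lemma field_modes_vertex_mode: "field_modes (vertex_mode l m)"
proof (rule field_modes_pi_spaceI[OF pi_linear_vertex_mode])
  show "\<exists>N. \<forall>n\<ge>N. vertex_mode l m n 1 = 0"
    by (rule exI[of _ 1]) (simp add: vertex_mode_one exp_mode_int_def)
  fix v p and N :: int assume N: "\<forall>n\<ge>N. vertex_mode l m n p = 0"
  show "\<exists>N. \<forall>n\<ge>N. vertex_mode l m n (pi_of_var v * p) = 0"
  proof (cases v)
    case (Xvar i) then show ?thesis using N by (intro exI[of _ N]) (simp add: vertex_mode_xvar)
  next
    case (Yvar i) then show ?thesis using N by (intro exI[of _ "N + int i"]) (simp add: vertex_mode_yvar)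
  qed
qed

lemma field_modes_xop: "field_modes xop"
proof (rule field_modes_pi_spaceI[OF pi_linear_xop])
  show "\<exists>N. \<forall>n\<ge>N. xop n 1 = 0" by (rule exI[of _ 1]) (simp add: xop_one)
  fix v p and N :: int assume N: "\<forall>n\<ge>N. xop n p = 0"
  show "\<exists>N. \<forall>n\<ge>N. xop n (pi_of_var v * p) = 0"
  proof (cases v)
    case (Xvar i) then show ?thesis using N by (intro exI[of _ N]) (simp add: xop_xvar)
  next
    case (Yvar i) then show ?thesis using N by (intro exI[of _ "max N (int i + 1)"]) (simp add: xop_yvar)
  qed
qed

lemma yop_nonpos: "n \<le> 0 \<Longrightarrow> yop n p = yvar (nat (- n)) * p"
  by (simp add: yop_def)

lemma yop_pos: "n > 0 \<Longrightarrow> yop n p = of_int (2 * n) * pi_deriv (Xvar (nat (n - 1))) p"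
  using pi_const_of_int[of "2 * n"] by (simp add: yop_def del: pi_const_of_int)

lemma yop_one: "n > 0 \<Longrightarrow> yop n 1 = 0"
  by (simp add: yop_pos)

lemma yop_xvar: "yop n (xvar i * p) = xvar i * yop n p + (if n = int i + 1 then of_int (2 * n) * p else 0)"
proof (cases "n > 0")
  case True
  then show ?thesis by (auto simp: yop_pos pi_deriv_var distrib_left mult.left_commute)
qed (auto simp: yop_nonpos mult.left_commute)

lemma yop_yvar: "yop n (yvar i * p) = yvar i * yop n p"
  by (simp add: yop_def pi_deriv_var mult.left_commute)

lemma yop_commute: "yop m (yop n p) = yop n (yop m p)"
proof (cases "m \<le> 0 \<or> n \<le> 0")
  case True
  then show ?thesis by (metis yop_nonpos yop_yvar)
next
  case False
  then show ?thesis
    by (simp add: yop_pos pi_linear_simps[OF pi_linear_deriv] pi_deriv_commute mult.left_commute del: of_int_mult)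
qed

lemma xop_yop_commutator:
  "xop m (yop n p) - yop n (xop m p) = (if m + n = 0 then of_int (2 * m) * p else 0)"
proof -
  consider "n \<le> 0" | "m = 0" | "m < 0" "n > 0" | "m > 0" "n > 0" by linarith
  then show ?thesis
  proof cases
    case 1 then show ?thesis by (auto simp: yop_nonpos xop_yvar)
  next
    case 2 then show ?thesis by (simp add: xop_zero pi_linear_simps[OF pi_linear_yop])
  next
    case 3
    then have m: "xop m q = xvar (nat (- m - 1)) * q" for q by (simp add: xop_def)
    show ?thesis using 3 unfolding m yop_xvar by (cases "m = - n") auto
  next
    case 4
    then show ?thesis
      by (simp add: xop_pos yop_pos pi_linear_simps[OF pi_linear_deriv] pi_deriv_commute[of "Xvar _"] mult.left_commute del: of_int_mult)
  qed
qed

lemma field_modes_yop: "field_modes yop"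
proof (rule field_modes_pi_spaceI[OF pi_linear_yop])
  show "\<exists>N. \<forall>n\<ge>N. yop n 1 = 0" by (rule exI[of _ 1]) (simp add: yop_one)
  fix v p and N :: int assume N: "\<forall>n\<ge>N. yop n p = 0"
  show "\<exists>N. \<forall>n\<ge>N. yop n (pi_of_var v * p) = 0"
  proof (cases v)
    case (Xvar i) then show ?thesis using N by (intro exI[of _ "max N (int i + 2)"]) (simp add: yop_xvar)
  next
    case (Yvar i) then show ?thesis using N by (intro exI[of _ N]) (simp add: yop_yvar)
  qed
qed

lemma exp_mode_int_rec:
  assumes "j \<le> int K"
  shows "of_int m * (\<Sum>k<K. xvar k * exp_mode_int m (j - 1 - int k)) = of_int j * exp_mode_int m j"
proof (cases "j \<le> 0")
  case True
  then have "(\<Sum>k<K. xvar k * exp_mode_int m (j - 1 - int k)) = 0"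
    by (intro sum.neutral) (simp add: exp_mode_int_def)
  then show ?thesis using True by (simp add: exp_mode_int_def)
next
  case False
  then obtain n where n: "j = int (Suc n)" by (metis int_cases zero_less_imp_eq_int not_le gr0_implies_Suc of_nat_0_less_iff)
  have "(\<Sum>k<K. xvar k * exp_mode_int m (j - 1 - int k)) = (\<Sum>k\<le>n. xvar k * exp_mode m (n - k))"
    by (rule sum.mono_neutral_cong_right) (use assms n in \<open>auto simp: exp_mode_int_def nat_diff_distrib nat_int_add\<close>)
  then show ?thesis using exp_mode_Suc_rec[of n m] n by (simp add: exp_mode_int_def del: of_nat_Suc)
qed

text \<open>
  For \<open>i > 0\<close> the operator \<open>y(i)\<close> is \<open>2i\<close> times the derivative with respect to \<open>x(-i)\<close>, and this
  derivative of the exponential series is \<open>m z\<^sup>i / i\<close> times the series.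
\<close>
lemma yop_exp_mode:
  assumes "i > 0"
  shows "yop i (exp_mode m j) = of_int (2 * m) * exp_mode_int m (int j - i)"
proof (induction j rule: less_induct)
  case (less j)
  note L = pi_linear_simps[OF pi_linear_yop]
  show ?case
  proof (cases j)
    case 0 then show ?thesis using assms by (simp add: yop_one exp_mode_int_def)
  next
    case (Suc n)
    have "of_nat (Suc n) * yop i (exp_mode m (Suc n)) = of_int m * (\<Sum>k\<le>n. yop i (xvar k * exp_mode m (n - k)))"
      using arg_cong[OF exp_mode_Suc_rec[of n m], of "yop i"] by (simp only: L)
    also have "(\<Sum>k\<le>n. yop i (xvar k * exp_mode m (n - k)))
        = (\<Sum>k\<le>n. of_int (2 * m) * (xvar k * exp_mode_int m (int (Suc n) - i - 1 - int k))
             + (if k = nat (i - 1) then of_int (2 * i) * exp_mode_int m (int (Suc n) - i) else 0))"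
    proof (intro sum.cong refl)
      fix k assume k: "k \<in> {..n}"
      have "yop i (exp_mode m (n - k)) = of_int (2 * m) * exp_mode_int m (int (n - k) - i)"
        by (rule less) (simp add: Suc)
      also have "int (n - k) - i = int (Suc n) - i - 1 - int k" using k by auto
      finally have y: "yop i (exp_mode m (n - k)) = of_int (2 * m) * exp_mode_int m (int (Suc n) - i - 1 - int k)" .
      have "exp_mode m (n - k) = exp_mode_int m (int (Suc n) - i)" if "i = int k + 1"
        using that k by (auto simp: exp_mode_int_def nat_diff_distrib)
      moreover have "i = int k + 1 \<longleftrightarrow> k = nat (i - 1)" using assms by auto
      ultimately show "yop i (xvar k * exp_mode m (n - k)) = of_int (2 * m) * (xvar k * exp_mode_int m (int (Suc n) - i - 1 - int k))
             + (if k = nat (i - 1) then of_int (2 * i) * exp_mode_int m (int (Suc n) - i) else 0)"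
        unfolding yop_xvar y by (cases "k = nat (i - 1)") (simp_all only: mult.left_commute if_True if_False simp_thms)
    qed
    also have "\<dots> = of_int (2 * m) * (\<Sum>k<Suc n. xvar k * exp_mode_int m (int (Suc n) - i - 1 - int k))
        + (\<Sum>k\<le>n. if k = nat (i - 1) then of_int (2 * i) * exp_mode_int m (int (Suc n) - i) else 0)"
      by (simp only: sum.distrib sum_distrib_left lessThan_Suc_atMost)
    also have "(\<Sum>k\<le>n. if k = nat (i - 1) then of_int (2 * i) * exp_mode_int m (int (Suc n) - i) else 0)
        = of_int (2 * i) * exp_mode_int m (int (Suc n) - i)"
      using assms by (subst sum.delta) (auto simp: exp_mode_int_def)
    also have "of_int m * (of_int (2 * m) * (\<Sum>k<Suc n. xvar k * exp_mode_int m (int (Suc n) - i - 1 - int k))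
         + of_int (2 * i) * exp_mode_int m (int (Suc n) - i))
        = of_int (2 * m) * (of_int m * (\<Sum>k<Suc n. xvar k * exp_mode_int m (int (Suc n) - i - 1 - int k)))
         + of_int (2 * m * i) * exp_mode_int m (int (Suc n) - i)"
      by (simp add: algebra_simps)
    also have "of_int m * (\<Sum>k<Suc n. xvar k * exp_mode_int m (int (Suc n) - i - 1 - int k))
        = of_int (int (Suc n) - i) * exp_mode_int m (int (Suc n) - i)"
      by (rule exp_mode_int_rec) (use assms in simp)
    also have "of_int (2 * m) * (of_int (int (Suc n) - i) * exp_mode_int m (int (Suc n) - i))
         + of_int (2 * m * i) * exp_mode_int m (int (Suc n) - i)
        = of_nat (Suc n) * (of_int (2 * m) * exp_mode_int m (int (Suc n) - i))"
      by (simp add: algebra_simps)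
    finally show ?thesis unfolding Suc by (rule of_nat_mult_cancel_pi)
  qed
qed

text \<open>
  Both sides have the same commutators with the variables, because \<open>\<langle>x, x\<rangle> = 0\<close>, and the same value
  at 1.
\<close>
lemma vertex_mode_commute:
  "vertex_mode l m j (vertex_mode l n k p) = vertex_mode l n k (vertex_mode l m j p)"
proof (induction p arbitrary: j k rule: pi_space_induct)
  case one
  show ?case
    by (simp add: vertex_mode_one pi_linear_simps(5)[OF pi_linear_vertex_mode] vertex_mode_exp_modez
        vertex_mode_exp_modez[where p = 1, simplified] mult_ac)
next
  case (const c p) then show ?case by (simp add: pi_linear_simps(5)[OF pi_linear_vertex_mode])
next
  case (add p q) then show ?case by (simp add: pi_linear_simps(1)[OF pi_linear_vertex_mode])
next
  case (var v p)
  show ?case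
  proof (cases v)
    case (Xvar i) then show ?thesis by (simp add: vertex_mode_xvar var)
  next
    case (Yvar i)
    then show ?thesis
      by (simp add: vertex_mode_yvar pi_linear_simps(2,6)[OF pi_linear_vertex_mode] var del: of_int_mult)
  qed
qed

lemma xop_vertex_mode: "xop i (vertex_mode l m n p) = vertex_mode l m n (xop i p)"
proof -
  note Lx = pi_linear_simps[OF pi_linear_xop] and Lv = pi_linear_simps[OF pi_linear_vertex_mode]
  consider "i < 0" | "i = 0" | "i > 0" by linarith
  then show ?thesis
  proof cases
    case 1 then show ?thesis by (simp add: xop_def vertex_mode_xvar)
  next
    case 2 then show ?thesis by (simp add: xop_zero Lv)
  next
    case 3
    show ?thesis
    proof (induction p arbitrary: n rule: pi_space_induct)
      case one
      have "xop i (exp_mode k j) = 0" for k j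
        using exp_mode_commute[OF pi_linear_xop xop_xvar, of i k j 1] 3 by (simp add: xop_one)
      then show ?case using 3 by (simp add: xop_one Lv Lx vertex_mode_one exp_mode_int_def)
    next
      case (const c p) then show ?case by (simp add: Lv(5) Lx(5))
    next
      case (add p q) then show ?case by (simp add: Lv(1) Lx(1))
    next
      case (var v p)
      show ?case
      proof (cases v)
        case (Xvar i) then show ?thesis by (simp add: vertex_mode_xvar xop_xvar var)
      next
        case (Yvar j)
        then show ?thesis
          by (simp add: vertex_mode_yvar xop_yvar Lv(1,2,4,6) Lx(1,2,6) var del: of_int_mult)
      qed
    qed
  qed
qed

lemma yop_vertex_mode:
  "yop i (vertex_mode l m n p) - vertex_mode l m n (yop i p) = of_int (2 * m) * vertex_mode l m (n + i) p"
proof (cases "i \<le> 0")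
  case True
  then show ?thesis by (simp add: yop_nonpos vertex_mode_yvar)
next
  case False
  note Ly = pi_linear_simps[OF pi_linear_yop] and Lv = pi_linear_simps[OF pi_linear_vertex_mode]
  have "yop i (vertex_mode l m n p) = vertex_mode l m n (yop i p) + of_int (2 * m) * vertex_mode l m (n + i) p"
  proof (induction p arbitrary: n rule: pi_space_induct)
    case one
    have "yop i (exp_mode_int m (- n)) = of_int (2 * m) * exp_mode_int m (- n - i)"
      using False by (auto simp: exp_mode_int_def[of m "- n"] yop_exp_mode Ly) (simp add: exp_mode_int_def)
    then show ?case using False
      by (simp add: yop_one Lv(4) Ly(5) vertex_mode_one mult.left_commute minus_diff_commute[of i n] del: of_int_mult)
  next
    case (const c p) then show ?case by (simp add: Lv(5) Ly(5) distrib_left mult.left_commute)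
  next
    case (add p q) then show ?case by (simp add: Lv(1) Ly(1) distrib_left)
  next
    case (var v p)
    show ?case
    proof (cases v)
      case (Xvar j)
      have "vertex_mode l m n (if i = int j + 1 then of_int (2 * i) * p else 0)
          = (if i = int j + 1 then of_int (2 * i) * vertex_mode l m n p else 0)"
      proof (cases "i = int j + 1")
        case True show ?thesis unfolding if_P[OF True] by (rule Lv(6))
      next
        case False show ?thesis unfolding if_not_P[OF False] by (rule Lv(4))
      qed
      then show ?thesis
        unfolding Xvar vertex_mode_xvar yop_xvar Lv(1) var by (simp only: distrib_left mult.left_commute ac_simps)
    next
      case (Yvar j)
      have "vertex_mode l m (n - int j + i) p = vertex_mode l m (n + i - int j) p"
        by (simp add: algebra_simps)
      then show ?thesis
        by (simp add: Yvar vertex_mode_yvar yop_yvar var Ly(2,6) distrib_left right_diff_distrib mult.left_commute del: of_int_mult)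
    qed
  qed
  then show ?thesis by simp
qed

lemma vertex_mode_zero: "vertex_mode l 0 n p = vacuum_modes n p"
proof (induction p arbitrary: n rule: pi_space_induct)
  case one
  have "exp_mode 0 j = (if j = 0 then 1 else 0)" for j
  proof (cases j)
    case (Suc k)
    have "of_nat (Suc k) * exp_mode 0 (Suc k) = of_nat (Suc k) * 0" unfolding exp_mode_Suc_rec by simp
    then show ?thesis unfolding Suc by (simp add: of_nat_mult_cancel_pi)
  qed simp
  then show ?case by (auto simp: vertex_mode_one exp_mode_int_def vacuum_modes_def)
next
  case (const c p) then show ?case by (simp add: pi_linear_simps(5)[OF pi_linear_vertex_mode] vacuum_modes_def)
next
  case (add p q) then show ?case by (simp add: pi_linear_simps(1)[OF pi_linear_vertex_mode] vacuum_modes_def)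
next
  case (var v p) then show ?case by (cases v) (simp_all add: vertex_mode_xvar vertex_mode_yvar vacuum_modes_def)
qed

text \<open>
  The identity \<open>Y(e\<^bsup>mx\<^esup>, z) Y(e\<^bsup>nx\<^esup>, z) = Y(e\<^bsup>(m+n)x\<^esup>, z)\<close>.  By the derivation rule both sides have the same
  commutators with the variables, and at 1 they agree by \<open>exp_mode_add\<close>.
\<close>
lemma vertex_mode_product:
  assumes l: "l \<noteq> 0"
  shows "nop (vertex_mode l m) (vertex_mode l n) N p = vertex_mode l (m + n) N p"
proof (induction p arbitrary: N rule: pi_space_induct)
  let ?A = "vertex_mode l m" and ?B = "vertex_mode l n"
  note F = field_modes_vertex_mode
  have mult: "Modules.additive (\<lambda>p. q * p)" for q :: pi_space by standard (simp add: distrib_left)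
  {
    case one
    have summand: "nop_term ?A ?B N 1 k = pi_const (l powi (m + n)) * (exp_mode_int m (- k) * exp_mode_int n (k - N))" for k
    proof -
      have "nop_term ?A ?B N 1 k = ?A k (?B (N - k) 1)"
        by (simp add: nop_term_def vertex_mode_commute)
      also have "\<dots> = pi_const (l powi n) * (exp_mode_int n (k - N) * ?A k 1)"
        using vertex_mode_exp_modez[of l m k n "k - N" 1]
        by (simp add: vertex_mode_one[of l n] pi_linear_simps(5)[OF pi_linear_vertex_mode])
      also have "\<dots> = pi_const (l powi (m + n)) * (exp_mode_int m (- k) * exp_mode_int n (k - N))"
        using l by (simp add: vertex_mode_one power_int_add pi_const_mult mult_ac)
      finally show ?thesis .
    qed
    have "nop ?A ?B N 1 = (\<Sum>k\<in>{N..0}. pi_const (l powi (m + n)) * (exp_mode_int m (- k) * exp_mode_int n (k - N)))"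
      unfolding nop_def summand[abs_def]
      by (rule Sum_any_eq_sum) (auto simp: exp_mode_int_def)
    also have "\<dots> = pi_const (l powi (m + n)) * exp_mode_int (m + n) (- N)"
    proof (cases "N \<le> 0")
      case True
      have "(\<Sum>k\<in>{N..0}. exp_mode_int m (- k) * exp_mode_int n (k - N)) = (\<Sum>i\<le>nat (- N). exp_mode m i * exp_mode n (nat (- N) - i))"
        by (rule sum.reindex_bij_witness[of _ "\<lambda>i. - int i" "\<lambda>k. nat (- k)"])
          (use True in \<open>auto simp: exp_mode_int_def nat_diff_distrib[symmetric] algebra_simps\<close>)
      then show ?thesis using True by (simp add: exp_mode_add exp_mode_int_def sum_distrib_left[symmetric])
    qed (simp add: exp_mode_int_def)
    finally show ?case by (simp add: vertex_mode_one)
  next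
    case (const c p)
    have "pi_const c * nop ?A ?B N p = nop ?A ?B N (pi_const c * p)"
      by (rule nop_intertwine[OF mult F F]) (simp_all add: pi_linear_simps(5)[OF pi_linear_vertex_mode])
    then show ?case using const by (simp add: pi_linear_simps(5)[OF pi_linear_vertex_mode])
  next
    case (add p q)
    then show ?case
      by (simp add: field_modes_simps(1)[OF field_modes_nop[OF F F]] pi_linear_simps(1)[OF pi_linear_vertex_mode])
  next
    case (var v p)
    show ?case
    proof (cases v)
      case (Xvar i)
      have "xvar i * nop ?A ?B N p = nop ?A ?B N (xvar i * p)"
        by (rule nop_intertwine[OF mult F F]) (simp_all add: vertex_mode_xvar)
      then show ?thesis using var Xvar by (simp add: vertex_mode_xvar)
    next
      case (Yvar i)
      have "yvar i * nop ?A ?B N p - nop ?A ?B N (yvar i * p)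
          = nop (\<lambda>k v. of_int (2 * m) * ?A (k + (- int i)) v) ?B N p + nop ?A (\<lambda>k v. of_int (2 * n) * ?B (k + (- int i)) v) N p"
        by (rule nop_derivation[OF mult F F]) (simp_all add: vertex_mode_yvar)
      also have "\<dots> = of_int (2 * m) * nop (\<lambda>k. ?A (k + (- int i))) ?B N p + of_int (2 * n) * nop ?A (\<lambda>k. ?B (k + (- int i))) N p"
        by (simp only: nop_of_int_left[OF field_modes_shift[OF F] F] nop_of_int_right[OF F field_modes_shift[OF F]])
      also have "\<dots> = of_int (2 * m) * nop ?A ?B (N - int i) p + of_int (2 * n) * nop ?A ?B (N - int i) p"
        using nop_shift_right[of ?A ?B "- int i" N p]
          nop_commuting_shift_left[OF F F, of l m l n "- int i" N p] vertex_mode_commute[of l] by simp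
      also have "\<dots> = of_int (2 * (m + n)) * vertex_mode l (m + n) (N - int i) p"
        by (simp add: var algebra_simps)
      finally have "nop ?A ?B N (yvar i * p) = yvar i * nop ?A ?B N p - of_int (2 * (m + n)) * vertex_mode l (m + n) (N - int i) p"
        by (simp add: algebra_simps)
      then show ?thesis unfolding Yvar vertex_mode_yvar var .
    qed
  }
qed

text \<open>
  The identity \<open>\<partial>\<^sub>z a(z) = x(z) a(z)\<close>, proved in the same way as the product formula.
\<close>
lemma nop_xop_vertex_mode:
  "nop xop (vertex_mode l 1) n p = - (of_int (n + 1) * vertex_mode l 1 n p)"
proof (induction p arbitrary: n rule: pi_space_induct)
  let ?A = "vertex_mode l 1"
  note F = field_modes_vertex_mode and X = field_modes_xop
  have mult: "Modules.additive (\<lambda>p. q * p)" for q :: pi_space by standard (simp add: distrib_left)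
  {
    case one
    \<comment> \<open>The modes x(k) with k < n kill the value of the other factor at 1.\<close>
    define K where "K = nat (max 0 (- n))"
    have "nop xop ?A n 1 = (\<Sum>k\<in>{- int K..0}. nop_term xop ?A n 1 k)"
      unfolding nop_def
    proof (rule Sum_any_eq_sum)
      fix k assume "k \<notin> {- int K..0}"
      then consider "k < - int K" | "k > 0" by force
      then show "nop_term xop ?A n 1 k = 0"
      proof cases
        case 1
        then have "n - k > 0" "k < 0" by (auto simp: K_def split: if_splits)
        then show ?thesis by (simp add: nop_term_def vertex_mode_one exp_mode_int_def pi_linear_simps(4)[OF pi_linear_xop])
      next
        case 2
        then show ?thesis by (simp add: nop_term_def xop_one pi_linear_simps(4)[OF pi_linear_vertex_mode])
      qed
    qed simp
    also have "{- int K..0} = insert 0 {- int K..<0}" by auto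
    also have "(\<Sum>k\<in>insert 0 {- int K..<0}. nop_term xop ?A n 1 k) = - ?A n 1 + (\<Sum>k\<in>{- int K..<0}. nop_term xop ?A n 1 k)"
      by (simp add: nop_term_def xop_zero pi_linear_simps(3)[OF pi_linear_vertex_mode])
    also have "(\<Sum>k\<in>{- int K..<0}. nop_term xop ?A n 1 k) = (\<Sum>k<K. pi_const l * (xvar k * exp_mode_int 1 (- n - 1 - int k)))"
    proof (rule sum.reindex_bij_witness[of _ "\<lambda>k. - int k - 1" "\<lambda>k. nat (- k - 1)"])
      fix k assume "k \<in> {- int K..<0}"
      then show "pi_const l * (xvar (nat (- k - 1)) * exp_mode_int 1 (- n - 1 - int (nat (- k - 1)))) = nop_term xop ?A n 1 k"
        by (simp add: nop_term_def xop_def vertex_mode_one mult_ac)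
    qed auto
    also have "\<dots> = pi_const l * (\<Sum>k<K. xvar k * exp_mode_int 1 (- n - 1 - int k))"
      by (rule sum_distrib_left[symmetric])
    also have "\<dots> = pi_const l * (of_int (- n) * exp_mode_int 1 (- n))"
      using exp_mode_int_rec[of "- n" K 1] by (simp add: K_def)
    finally show ?case by (simp add: vertex_mode_one algebra_simps)
  next
    case (const c p)
    have "pi_const c * nop xop ?A n p = nop xop ?A n (pi_const c * p)"
      by (rule nop_intertwine[OF mult X F]) (simp_all add: pi_linear_simps(5)[OF pi_linear_vertex_mode] pi_linear_simps(5)[OF pi_linear_xop])
    then show ?case using const by (simp add: pi_linear_simps(5)[OF pi_linear_vertex_mode] mult.left_commute)
  next
    case (add p q)
    then show ?case
      by (simp add: field_modes_simps(1)[OF field_modes_nop[OF X F]] pi_linear_simps(1)[OF pi_linear_vertex_mode] distrib_left)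
  next
    case (var v p)
    show ?case
    proof (cases v)
      case (Xvar i)
      have "xvar i * nop xop ?A n p = nop xop ?A n (xvar i * p)"
        by (rule nop_intertwine[OF mult X F]) (simp_all add: vertex_mode_xvar xop_xvar)
      then show ?thesis using var Xvar by (simp add: vertex_mode_xvar mult.left_commute)
    next
      case (Yvar i)
      have "yvar i * nop xop ?A n p - nop xop ?A n (yvar i * p)
          = nop (\<lambda>k v. of_int (2 * k) * vacuum_modes (- int i + k) (- v)) ?A n p + nop xop (\<lambda>k v. of_int 2 * ?A (k + (- int i)) v) n p"
        by (rule nop_derivation[OF mult X F]) (auto simp: vertex_mode_yvar xop_yvar vacuum_modes_def)
      also have "nop (\<lambda>k v. of_int (2 * k) * vacuum_modes (- int i + k) (- v)) ?A n p
          = nop (\<lambda>k v. of_int (- 2 * k) * vacuum_modes (- int i + k) v) ?A n p"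
        by (rule nop_cong) (simp_all add: vacuum_modes_def)
      also have "\<dots> = of_int (- 2 * int i) * ?A (n - int i) p"
        using nop_delta_left[OF F, of "\<lambda>k. - 2 * k" "- int i" l 1 n p] by simp
      also have "nop xop (\<lambda>k v. of_int 2 * ?A (k + (- int i)) v) n p = of_int 2 * nop xop (\<lambda>k. ?A (k + (- int i))) n p"
        by (rule nop_of_int_right[OF X field_modes_shift[OF F]])
      also have "nop xop (\<lambda>k. ?A (k + (- int i))) n p = nop xop ?A (n - int i) p"
        using nop_shift_right[of xop ?A "- int i" n p] by simp
      finally have "nop xop ?A n (yvar i * p) = yvar i * nop xop ?A n p + of_int (2 * int i) * ?A (n - int i) p
          - of_int 2 * nop xop ?A (n - int i) p"
        by (simp add: algebra_simps)
      then show ?thesis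
        unfolding Yvar vertex_mode_yvar var by (simp add: algebra_simps)
    qed
  }
qed

section \<open>The Wakimoto currents at the critical level\<close>

lemma field_modes_alpha: "field_modes alpha_op"
proof (rule field_modesI)
  note L = pi_linear_simps[OF pi_linear_xop] pi_linear_simps[OF pi_linear_yop]
  show "Modules.additive (alpha_op n)" for n
    by standard (simp add: alpha_op_def L distrib_left)
  fix p
  obtain M where "M \<ge> 0" "\<And>n. n \<ge> M \<Longrightarrow> xop n p = 0" by (rule field_modes_bound[OF field_modes_xop]) blast
  moreover obtain N where "N \<ge> 0" "\<And>n. n \<ge> N \<Longrightarrow> yop n p = 0" by (rule field_modes_bound[OF field_modes_yop]) blast
  ultimately show "\<exists>N. \<forall>n\<ge>N. alpha_op n p = 0"
    by (intro exI[of _ "max M N"]) (simp add: alpha_op_def)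
qed

lemma half_of_int: "pi_const (1 / 2) * (of_int (2 * m) * q) = of_int m * q"
proof -
  have "pi_const (1 / 2) * (pi_const (of_int (2 * m)) * q) = pi_const (of_int m) * q"
    unfolding pi_const_mult_eq by simp
  then show ?thesis unfolding pi_const_of_int .
qed

lemma alpha_vertex_commutator:
  "alpha_op k (vertex_mode l m n p) - vertex_mode l m n (alpha_op k p) = of_int m * vertex_mode l m (n + k) p"
proof -
  have "alpha_op k (vertex_mode l m n p) - vertex_mode l m n (alpha_op k p)
      = pi_const (1 / 2) * (yop k (vertex_mode l m n p) - vertex_mode l m n (yop k p))"
    by (simp add: alpha_op_def xop_vertex_mode pi_linear_simps(1,5)[OF pi_linear_vertex_mode] distrib_left right_diff_distrib)
  then show ?thesis by (simp only: yop_vertex_mode half_of_int)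
qed

lemma alpha_commutator:
  "alpha_op k (alpha_op j p) - alpha_op j (alpha_op k p) = of_int k * vacuum_modes (k + j) p"
proof -
  note Lx = pi_linear_simps(1,5)[OF pi_linear_xop] and Ly = pi_linear_simps(1,5)[OF pi_linear_yop]
  have "alpha_op k (alpha_op j p) - alpha_op j (alpha_op k p)
     = pi_const (1 / 2) * (pi_const (1 / 2) * ((xop k (yop j p) - yop j (xop k p)) - (xop j (yop k p) - yop k (xop j p))))"
    by (simp add: alpha_op_def Lx Ly xop_commute[of j] yop_commute[of j] right_diff_distrib distrib_left)
  also have "\<dots> = of_int k * vacuum_modes (k + j) p"
  proof (cases "k + j = 0")
    case True
    then have "j = - k" by simp
    have "pi_const (1/2) * (pi_const (1/2) * (of_int (2 * k) * p - of_int (2 * j) * p)) = pi_const (1/2) * (of_int k * p - of_int j * p)"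
      by (simp only: right_diff_distrib half_of_int)
    also have "of_int k * p - of_int j * p = of_int (2 * k) * p"
      using \<open>j = - k\<close> by (simp add: algebra_simps)
    also have "pi_const (1/2) * \<dots> = of_int k * p" by (rule half_of_int)
    finally show ?thesis using True by (simp add: xop_yop_commutator vacuum_modes_def add.commute[of j] del: of_int_mult)
  qed (simp add: xop_yop_commutator vacuum_modes_def add.commute[of j])
  finally show ?thesis .
qed

lemma a_star_op_eq: "a_star_op l n p = - nop alpha_op (vertex_mode l (- 1)) n p"
  unfolding a_star_op_def nop_def nop_term_def[abs_def] a_inv_op_eq ..

lemma field_modes_a_star: "field_modes (a_star_op l)"
  unfolding a_star_op_eq[abs_def]
  by (intro field_modes_minus field_modes_nop field_modes_alpha field_modes_vertex_mode)

lemma pi_linear_nop: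
  assumes A: "\<And>k. pi_linear (A k)" and B: "\<And>k. pi_linear (B k)" and "field_modes A" "field_modes B"
  shows "pi_linear (nop A B n)"
proof (rule pi_linearI)
  show "nop A B n (p + q) = nop A B n p + nop A B n q" for p q
    using field_modes_simps(1)[OF field_modes_nop[OF assms(3,4)]] .
  show "nop A B n (pi_const c * p) = pi_const c * nop A B n p" for c p
    by (rule nop_intertwine[symmetric, OF pi_linear_additive[OF pi_linear_mult] assms(3,4)])
      (simp_all add: pi_linear_simps(5)[OF A] pi_linear_simps(5)[OF B])
qed

lemma pi_linear_a_star: "pi_linear (a_star_op l n)"
proof -
  have "pi_linear (alpha_op k)" for k
    by (rule pi_linearI) (simp_all add: alpha_op_def pi_linear_simps[OF pi_linear_xop] pi_linear_simps[OF pi_linear_yop] distrib_left mult.left_commute)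
  then have "pi_linear (nop alpha_op (vertex_mode l (- 1)) n)"
    by (intro pi_linear_nop field_modes_alpha field_modes_vertex_mode pi_linear_vertex_mode)
  note L = pi_linear_simps[OF this]
  show ?thesis by (rule pi_linearI) (simp_all add: a_star_op_eq L)
qed

text \<open>
  If the commutator depends only on \<open>n + m\<close>, then exchanging \<open>n\<close> and \<open>m\<close> shows that it equals its own
  negative.
\<close>
lemma antisym_commutator_zero:
  fixes A :: "int \<Rightarrow> pi_space \<Rightarrow> pi_space"
  assumes "\<And>n m p. A n (A m p) - A m (A n p) = Z (n + m) p"
  shows "A n (A m p) = A m (A n p)"
proof -
  have "Z (n + m) p = - Z (n + m) p"
    using assms[of n m p] assms[of m n p] by (metis add.commute minus_diff_eq)
  then have "of_nat (Suc 1) * Z (n + m) p = of_nat (Suc 1) * 0" by simp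
  then have "Z (n + m) p = 0" by (rule of_nat_mult_cancel_pi)
  then show ?thesis using assms[of n m p] by simp
qed

context
  fixes l :: complex
  assumes l: "l \<noteq> 0"
begin

abbreviation (input) V where "V \<equiv> vertex_mode l"
abbreviation (input) a where "a \<equiv> vertex_mode l 1"
abbreviation (input) b where "b \<equiv> vertex_mode l (- 1)"
abbreviation (input) as where "as \<equiv> a_star_op l"

lemmas F_V = field_modes_vertex_mode[of l]
lemmas F_as = field_modes_a_star[of l]

lemma a_star_vertex_commutator:
  "as k (V n m p) - V n m (as k p) = - (of_int n * V (n - 1) (k + m) p)"
proof -
  have "V n m (nop alpha_op b k p) - nop alpha_op b k (V n m p)
      = nop (\<lambda>j v. of_int (- n) * V n (j + m) v) b k p + nop alpha_op (\<lambda>j v. 0) k p"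
    by (rule nop_derivation[OF field_modes_additive[OF F_V] field_modes_alpha F_V])
      (simp_all add: vertex_mode_commute minus_diff_eq[of "alpha_op _ _", symmetric] alpha_vertex_commutator add.commute del: minus_diff_eq)
  also have "\<dots> = - (of_int n * nop (\<lambda>j. V n (j + m)) b k p)"
    by (simp add: nop_of_int_left[OF field_modes_shift[OF F_V] F_V, of "- n", simplified] field_modes_alpha)
  also have "nop (\<lambda>j. V n (j + m)) b k p = V (n - 1) (k + m) p"
    using nop_commuting_shift_left[OF F_V F_V vertex_mode_commute] vertex_mode_product[OF l] by simp
  finally show ?thesis
    by (simp add: a_star_op_eq pi_linear_simps(3)[OF pi_linear_vertex_mode])
qed

lemma a_star_b_commutator: "as k (b m p) - b m (as k p) = V (- 2) (k + m) p"
  using a_star_vertex_commutator[of k "- 1" m p] by simp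

lemma a_a_star_commutator: "a k (as m p) - as m (a k p) = vacuum_modes (k + m) p"
  using a_star_vertex_commutator[of m 1 k p] by (simp add: vertex_mode_zero algebra_simps)

lemma alpha_a_star_commutator:
  "alpha_op k (as m p) - as m (alpha_op k p) = - (of_int k * b (m + k) p) - as (m + k) p"
proof -
  have "alpha_op k (nop alpha_op b m p) - nop alpha_op b m (alpha_op k p)
      = nop (\<lambda>j v. of_int k * vacuum_modes (k + j) v) b m p + nop alpha_op (\<lambda>j v. - b (j + k) v) m p"
    by (rule nop_derivation[OF field_modes_additive[OF field_modes_alpha] field_modes_alpha F_V])
      (simp_all add: alpha_commutator alpha_vertex_commutator)
  also have "\<dots> = of_int k * b (m + k) p + as (m + k) p"
    using nop_delta_left[OF F_V[of "- 1"], of "\<lambda>_. k" k m p]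
    by (simp add: nop_minus_right[OF field_modes_alpha field_modes_shift[OF F_V]] nop_shift_right a_star_op_eq)
  finally show ?thesis
    by (simp add: a_star_op_eq[of l m] field_modes_simps[OF field_modes_alpha] algebra_simps)
qed

text \<open>
  The double contractions with \<open>m a\<^sup>-\<^sup>2(n + m)\<close>, one from the weight in \<open>[\<alpha>(k), a\<^sup>*(m)]\<close> and one from the
  index shift, cancel; what remains depends only on \<open>n + m\<close>.
\<close>
lemma a_star_commute: "as n (as m p) = as m (as n p)"
proof (rule antisym_commutator_zero)
  fix m n p
  have comm: "index_weighted b k (b j v) = b j (index_weighted b k v)" for k j v
    by (simp add: index_weighted_def vertex_mode_commute[of l "- 1" k] pi_linear_simps(6)[OF pi_linear_vertex_mode])
  have "as m (nop alpha_op b n p) - nop alpha_op b n (as m p)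
      = nop (\<lambda>k v. (index_weighted b (k + m) v + of_int (- m) * b (k + m) v) + as (k + m) v) b n p
        + nop alpha_op (\<lambda>k. V (- 2) (k + m)) n p"
    by (rule nop_derivation[OF field_modes_additive[OF F_as] field_modes_alpha F_V])
      (simp_all add: minus_diff_eq[of "alpha_op _ _", symmetric] alpha_a_star_commutator index_weighted_shift[symmetric] a_star_b_commutator add.commute del: minus_diff_eq of_int_minus)
  also have "\<dots> = nop (\<lambda>k. index_weighted b (k + m)) b n p + of_int (- m) * nop (\<lambda>k. b (k + m)) b n p
      + nop (\<lambda>k. as (k + m)) b n p + nop alpha_op (\<lambda>k. V (- 2) (k + m)) n p"
    by (simp only: nop_add_left nop_of_int_left field_modes_shift field_modes_index_weighted field_modes_add field_modes_of_int F_V F_as)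
  also have "\<dots> = nop (index_weighted b) b (n + m) p - of_int m * nop b b (n + m) p
      + (nop as b (n + m) p + of_int m * V (- 2) (n + m) p) + nop alpha_op (V (- 2)) (n + m) p"
    using nop_shift_left[of as b "V (- 2)" m n p, OF F_as F_V] a_star_b_commutator
    by (simp add: nop_shift_right nop_commuting_shift_left F_V field_modes_index_weighted comm vertex_mode_commute[of l "- 1" _ "- 1"])
  also have "\<dots> = nop (index_weighted b) b (n + m) p + nop as b (n + m) p + nop alpha_op (V (- 2)) (n + m) p"
    using vertex_mode_product[OF l, of "- 1" "- 1" "n + m" p] by simp
  finally show "as n (as m p) - as m (as n p)
      = nop (index_weighted b) b (n + m) p + nop as b (n + m) p + nop alpha_op (V (- 2)) (n + m) p"
    unfolding a_star_op_eq[of l n] by (simp add: field_modes_simps[OF F_as])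
qed


text \<open>
  \<open>J = :a a\<^sup>*:\<close> is \<open>-h/2\<close>; \<open>N2 = :a (a\<^sup>*)\<^sup>2:\<close> is the leading term of \<open>-f\<close>.
\<close>
abbreviation (input) J where "J \<equiv> nop a as"
abbreviation (input) a2 where "a2 \<equiv> nop as as"
abbreviation (input) N2 where "N2 \<equiv> nop a a2"

lemmas F_J = field_modes_nop[OF F_V[of 1] F_as]
lemmas F_a2 = field_modes_nop[OF F_as F_as]
lemmas F_N2 = field_modes_nop[OF F_V[of 1] F_a2]

lemma pi_linear_J: "pi_linear (J n)"
  by (intro pi_linear_nop F_V F_as pi_linear_vertex_mode pi_linear_a_star)

lemma a_J_commutator: "a m (J k p) - J k (a m p) = a (k + m) p"
proof -
  have "a m (J k p) - J k (a m p) = nop (\<lambda>j v. 0) as k p + nop a (\<lambda>j. vacuum_modes (m + j)) k p"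
    by (rule nop_derivation[OF field_modes_additive[OF F_V] F_V F_as])
      (simp_all add: vertex_mode_commute[of l 1 _ 1] a_a_star_commutator)
  then show ?thesis by (simp add: F_as nop_delta_right F_V)
qed

lemma a_star_a_commutator: "as m (a k p) - a k (as m p) = - vacuum_modes (m + k) p"
  using a_a_star_commutator[of k m p] by (simp add: algebra_simps)

lemma J_a_star_commutator: "J k (as m p) - as m (J k p) = as (k + m) p"
proof -
  have "as m (J k p) - J k (as m p) = nop (\<lambda>j v. - vacuum_modes (m + j) v) as k p + nop a (\<lambda>j v. 0) k p"
    by (rule nop_derivation[OF field_modes_additive[OF F_as] F_V F_as])
      (simp_all add: a_star_commute[of m] a_star_a_commutator)
  also have "\<dots> = - as (k + m) p" by (simp add: F_as F_V nop_minus_delta_left)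
  finally show ?thesis by (simp add: algebra_simps)
qed

lemma J_b_commutator: "J k (b m p) - b m (J k p) = b (k + m) p"
proof -
  have "b m (J k p) - J k (b m p) = nop (\<lambda>j v. 0) as k p + nop a (\<lambda>j v. - V (- 2) (j + m) v) k p"
    by (rule nop_derivation[OF field_modes_additive[OF F_V] F_V F_as])
      (simp_all add: vertex_mode_commute[of l "- 1" _ 1] minus_diff_eq[of "as _ _", symmetric] a_star_b_commutator del: minus_diff_eq)
  also have "\<dots> = - b (k + m) p"
    using vertex_mode_product[OF l, of 1 "- 2" "k + m" p]
    by (simp add: F_as nop_minus_right[OF F_V field_modes_shift[OF F_V]] nop_shift_right)
  finally show ?thesis by (simp add: algebra_simps)
qed

lemma J_a_commutator: "J k (a m p) - a m (J k p) = - a (k + m) p"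
  using a_J_commutator[of m k p] by (simp add: algebra_simps)

text \<open>
  The two single contractions cancel up to an index shift, which leaves the central term.
\<close>
lemma J_J_commutator: "J k (J m p) - J m (J k p) = - (of_int k * vacuum_modes (k + m) p)"
proof -
  have "J k (J m p) - J m (J k p) = nop (\<lambda>j v. - a (j + k) v) as m p + nop a (\<lambda>j. as (j + k)) m p"
    by (rule nop_derivation[OF field_modes_additive[OF F_J] F_V F_as])
      (simp_all add: J_a_commutator J_a_star_commutator add.commute)
  also have "\<dots> = - (J (m + k) p + of_int k * vacuum_modes (m + k) p) + J (m + k) p"
    using nop_shift_left[of a as vacuum_modes k m p, OF F_V F_as a_a_star_commutator]
    by (simp add: nop_minus_left[OF field_modes_shift[OF F_V] F_as] nop_shift_right)
  finally show ?thesis by (simp add: add.commute)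
qed

lemma a_a2_commutator: "a k (a2 m p) - a2 m (a k p) = 2 * as (k + m) p"
proof -
  have "a k (a2 m p) - a2 m (a k p)
      = nop (\<lambda>j. vacuum_modes (k + j)) as m p + nop as (\<lambda>j. vacuum_modes (k + j)) m p"
    by (rule nop_derivation[OF field_modes_additive[OF F_V] F_as F_as]) (simp_all add: a_a_star_commutator)
  also have "\<dots> = 2 * as (m + k) p" by (simp add: nop_vacuum_delta_left nop_delta_right F_as)
  finally show ?thesis by (simp add: add.commute)
qed

lemma a_star_a2_commute: "as k (a2 m p) = a2 m (as k p)"
  by (rule nop_intertwine[OF field_modes_additive[OF F_as] F_as F_as]; rule a_star_commute)

lemma J_a2_commutator: "J k (a2 m p) - a2 m (J k p) = 2 * a2 (k + m) p"
proof -
  have "J k (a2 m p) - a2 m (J k p) = nop (\<lambda>j. as (j + k)) as m p + nop as (\<lambda>j. as (j + k)) m p"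
    by (rule nop_derivation[OF field_modes_additive[OF F_J] F_as F_as]) (simp_all add: J_a_star_commutator add.commute)
  then show ?thesis
    using nop_commuting_shift_left[OF F_as F_as a_star_commute, of k m p] by (simp add: nop_shift_right add.commute)
qed

text \<open>
  The current \<open>f\<close> for \<open>\<chi> = 0\<close>.
\<close>
definition f0 :: "int \<Rightarrow> pi_space \<Rightarrow> pi_space" where
  "f0 n p = - N2 n p + of_int (2 * n) * as n p"

lemma pi_linear_f0: "pi_linear (f0 n)"
proof -
  have "pi_linear (N2 n)"
    by (intro pi_linear_nop F_V F_as F_a2 pi_linear_vertex_mode pi_linear_a_star)
  note L = pi_linear_simps[OF this] pi_linear_simps[OF pi_linear_a_star]
  show ?thesis by (rule pi_linearI) (simp_all add: f0_def L distrib_left right_diff_distrib mult.left_commute)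
qed

lemma F_f0: "field_modes f0"
  unfolding f0_def[abs_def]
  by (intro field_modes_add field_modes_minus field_modes_of_int F_N2 F_as)

text \<open>
  The relation \<open>[e, f] = h\<close> at level \<open>-2\<close>; the central term comes from \<open>-2 \<partial>\<^sub>z a\<^sup>*(z)\<close>.
\<close>
lemma a_f0_commutator: "a k (f0 m p) - f0 m (a k p) = - (2 * J (k + m) p) - of_int (2 * k) * vacuum_modes (k + m) p"
proof -
  have "a k (N2 m p) - N2 m (a k p) = nop (\<lambda>j v. 0) a2 m p + nop a (\<lambda>j v. of_int 2 * as (j + k) v) m p"
    by (rule nop_derivation[OF field_modes_additive[OF F_V] F_V F_a2])
      (simp_all add: vertex_mode_commute[of l 1 _ 1] a_a2_commutator add.commute)
  also have "\<dots> = of_int 2 * J (m + k) p"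
    unfolding nop_of_int_right[OF F_V field_modes_shift[OF F_as]] nop_shift_right by (simp add: F_a2)
  finally have N: "a k (N2 m p) - N2 m (a k p) = 2 * J (m + k) p" by simp
  have "of_int (2 * m) * (a k (as m p) - as m (a k p)) = - (of_int (2 * k) * vacuum_modes (k + m) p)"
    by (cases "k + m = 0") (auto simp: a_a_star_commutator vacuum_modes_def add_eq_0_iff2)
  then show ?thesis
    using N unfolding f0_def pi_linear_simps[OF pi_linear_vertex_mode]
    by (simp add: algebra_simps)
qed

text \<open>
  The shift of \<open>a\<close> past \<open>(a\<^sup>*)\<^sup>2\<close> costs \<open>2k a\<^sup>*\<close>, which is exactly the change of the term \<open>2m a\<^sup>*(m)\<close>.
\<close>
lemma J_f0_commutator: "J k (f0 m p) - f0 m (J k p) = f0 (k + m) p"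
proof -
  have "J k (N2 m p) - N2 m (J k p) = nop (\<lambda>j v. - a (j + k) v) a2 m p + nop a (\<lambda>j v. of_int 2 * a2 (j + k) v) m p"
    by (rule nop_derivation[OF field_modes_additive[OF F_J] F_V F_a2])
      (simp_all add: J_a_commutator J_a2_commutator add.commute)
  also have "\<dots> = - nop (\<lambda>j. a (j + k)) a2 m p + of_int 2 * nop a (\<lambda>j. a2 (j + k)) m p"
    by (simp only: nop_of_int_right[OF F_V field_modes_shift[OF F_a2]] nop_minus_left[OF field_modes_shift[OF F_V] F_a2])
  also have "nop (\<lambda>j. a (j + k)) a2 m p = N2 (m + k) p + of_int k * (2 * as (m + k) p)"
    using nop_shift_left[of a a2 "\<lambda>i v. 2 * as i v" k m p, OF F_V F_a2 a_a2_commutator] .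
  finally have N: "J k (N2 m p) - N2 m (J k p) = N2 (m + k) p - of_int k * (2 * as (m + k) p)"
    by (simp add: nop_shift_right)
  show ?thesis
    using N J_a_star_commutator[of k m p]
    unfolding f0_def field_modes_simps[OF F_J] by (simp add: algebra_simps)
qed

lemma f0_a_commutator: "f0 m (a k p) - a k (f0 m p) = 2 * J (k + m) p + of_int (2 * k) * vacuum_modes (k + m) p"
  using a_f0_commutator[of k m p] by (simp add: algebra_simps)

lemma f0_a_star_commutator: "f0 n (as m p) - as m (f0 n p) = - a2 (n + m) p"
proof -
  have "as m (N2 n p) - N2 n (as m p) = nop (\<lambda>j v. - vacuum_modes (m + j) v) a2 n p + nop a (\<lambda>j v. 0) n p"
    by (rule nop_derivation[OF field_modes_additive[OF F_as] F_V F_a2])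
      (simp_all add: a_star_a2_commute a_star_a_commutator)
  also have "\<dots> = - a2 (n + m) p" by (simp add: F_a2 F_V nop_minus_delta_left)
  finally show ?thesis
    unfolding f0_def field_modes_simps[OF F_as] by (simp add: a_star_commute[of m n] algebra_simps)
qed

lemma f0_a2_commutator: "f0 n (a2 m p) - a2 m (f0 n p) = - nop a2 as (m + n) p - nop as a2 (m + n) p"
proof -
  have "f0 n (a2 m p) - a2 m (f0 n p) = nop (\<lambda>j v. - a2 (j + n) v) as m p + nop as (\<lambda>j v. - a2 (j + n) v) m p"
    by (rule nop_derivation[OF field_modes_additive[OF F_f0] F_as F_as]) (simp_all add: f0_a_star_commutator add.commute)
  also have "\<dots> = - nop (\<lambda>j. a2 (j + n)) as m p - nop as (\<lambda>j. a2 (j + n)) m p"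
    by (simp add: nop_minus_left[OF field_modes_shift[OF F_a2] F_as] nop_minus_right[OF F_as field_modes_shift[OF F_a2]])
  finally show ?thesis
    using nop_commuting_shift_left[OF F_a2 F_as a_star_a2_commute[symmetric], of n m p] by (simp add: nop_shift_right)
qed

text \<open>
  All contributions that depend on more than \<open>n + m\<close> are multiples of \<open>(a\<^sup>*)\<^sup>2(n + m)\<close>: \<open>-4n\<close> from the
  index shift of \<open>J\<close> past \<open>(a\<^sup>*)\<^sup>2\<close>, \<open>2n\<close> from the central term of \<open>[f, a]\<close> and \<open>-2m\<close> from \<open>[f, a\<^sup>*]\<close>.  Their
  sum \<open>-2(n + m)\<close> is symmetric precisely because the level is critical.
\<close>
lemma f0_commute: "f0 n (f0 m p) = f0 m (f0 n p)"
proof (rule antisym_commutator_zero)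
  fix n m p
  \<comment> \<open>The commutator of f with the square of a* as a field of the total index.\<close>
  define Z where "Z k v = - nop a2 as k v - nop as a2 k v" for k v
  have F_Z: "field_modes Z"
    unfolding Z_def[abs_def] by (intro field_modes_diff field_modes_minus field_modes_nop F_a2 F_as)
  have "f0 n (N2 m p) - N2 m (f0 n p)
      = nop (\<lambda>j v. of_int 2 * J (j + n) v + of_int (2 * j) * vacuum_modes (n + j) v) a2 m p + nop a (\<lambda>j. Z (j + n)) m p"
    by (rule nop_derivation[OF field_modes_additive[OF F_f0] F_V F_a2])
      (simp_all add: f0_a_commutator f0_a2_commutator Z_def add.commute del: of_int_mult)
  also have "\<dots> = nop (\<lambda>j v. of_int 2 * J (j + n) v) a2 m p
      + nop (\<lambda>j v. of_int (2 * j) * vacuum_modes (n + j) v) a2 m p + nop a (\<lambda>j. Z (j + n)) m p"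
  proof -
    have "field_modes (\<lambda>j v. of_int (2 * j) * vacuum_modes (n + j) (v :: pi_space))"
      unfolding add.commute[of n] by (intro field_modes_of_int field_modes_shift field_modes_vacuum)
    then show ?thesis
      by (simp only: nop_add_left[OF field_modes_of_int[OF field_modes_shift[OF F_J]] _ F_a2])
  qed
  also have "\<dots> = of_int 2 * nop (\<lambda>j. J (j + n)) a2 m p - of_int (2 * n) * a2 (m + n) p + nop a Z (m + n) p"
    using nop_delta_left[OF F_a2, of "\<lambda>j. 2 * j" n m p]
    unfolding nop_of_int_left[OF field_modes_shift[OF F_J] F_a2] nop_shift_right by simp
  also have "nop (\<lambda>j. J (j + n)) a2 m p = nop J a2 (m + n) p + of_int n * (2 * a2 (m + n) p)"
    using nop_shift_left[of J a2 "\<lambda>i v. 2 * a2 i v" n m p, OF F_J F_a2 J_a2_commutator] .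
  finally have N: "f0 n (N2 m p) - N2 m (f0 n p) = 2 * nop J a2 (n + m) p + of_int (2 * n) * a2 (n + m) p + nop a Z (n + m) p"
    by (simp add: algebra_simps)
  show "f0 n (f0 m p) - f0 m (f0 n p)
      = (\<lambda>i v. - (2 * nop J a2 i v) - nop a Z i v - of_int (2 * i) * a2 i v) (n + m) p"
    using N arg_cong[OF f0_a_star_commutator[of n m p], of "\<lambda>q. of_int (2 * m) * q"]
    unfolding f0_def[of m] field_modes_simps[OF F_f0] by (simp add: algebra_simps)
qed

text \<open>
  The value of \<open>[f0(k), a\<^sup>-\<^sup>1(n - k)]\<close>, which does not depend on \<open>k\<close>.
\<close>
definition f0_b_bracket :: "int \<Rightarrow> pi_space \<Rightarrow> pi_space" where
  "f0_b_bracket n p = 2 * of_int n * V (- 2) n p - nop a (\<lambda>i v. nop (V (- 2)) as i v + nop as (V (- 2)) i v) n p"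

lemma V2_a_star_commutator: "V (- 2) k (as i p) - as i (V (- 2) k p) = of_int (- 2) * V (- 3) (k + i) p"
  using a_star_vertex_commutator[of i "- 2" k p] by (simp add: algebra_simps)

text \<open>
  The dependence of the double contraction of \<open>(a\<^sup>*)\<^sup>2\<close> with \<open>a\<^sup>-\<^sup>1(m)\<close> on \<open>m\<close> is compensated by the
  contraction of \<open>2n a\<^sup>*(n)\<close>.
\<close>
lemma f0_b_commutator: "f0 n (b m p) - b m (f0 n p) = f0_b_bracket (n + m) p"
proof -
  \<comment> \<open>The single contraction of a* a* with the inverse of a, symmetrised.\<close>
  define G where "G i v = nop (V (- 2)) as i v + nop as (V (- 2)) i v" for i v
  have F_G: "field_modes G"
    unfolding G_def[abs_def] by (intro field_modes_add field_modes_nop F_V F_as)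
  have a2: "b m (a2 j q) - a2 j (b m q) = - G (j + m) q + of_int (2 * m) * V (- 3) (j + m) q" for j q
  proof -
    have "b m (a2 j q) - a2 j (b m q) = nop (\<lambda>i v. - V (- 2) (i + m) v) as j q + nop as (\<lambda>i v. - V (- 2) (i + m) v) j q"
      by (rule nop_derivation[OF field_modes_additive[OF F_V] F_as F_as])
        (simp_all add: minus_diff_eq[of "as _ _", symmetric] a_star_b_commutator del: minus_diff_eq)
    also have "\<dots> = - nop (\<lambda>i. V (- 2) (i + m)) as j q - nop as (\<lambda>i. V (- 2) (i + m)) j q"
      by (simp add: nop_minus_left[OF field_modes_shift[OF F_V] F_as] nop_minus_right[OF F_as field_modes_shift[OF F_V]])
    also have "nop (\<lambda>i. V (- 2) (i + m)) as j q = nop (V (- 2)) as (j + m) q + of_int m * (of_int (- 2) * V (- 3) (j + m) q)"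
      using nop_shift_left[of "V (- 2)" as "\<lambda>i v. of_int (- 2) * V (- 3) i v" m j q, OF F_V F_as V2_a_star_commutator] .
    finally show ?thesis by (simp add: G_def nop_shift_right algebra_simps)
  qed
  have "b m (N2 n p) - N2 n (b m p)
      = nop (\<lambda>j v. 0) a2 n p + nop a (\<lambda>j v. - G (j + m) v + of_int (2 * m) * V (- 3) (j + m) v) n p"
    by (rule nop_derivation[OF field_modes_additive[OF F_V] F_V F_a2])
      (simp_all add: vertex_mode_commute[of l "- 1" _ 1] a2 del: of_int_mult)
  also have "\<dots> = nop a (\<lambda>j v. - G (j + m) v) n p + nop a (\<lambda>j v. of_int (2 * m) * V (- 3) (j + m) v) n p"
    by (simp only: nop_zero_left[OF F_a2] nop_add_right[OF F_V field_modes_minus[OF field_modes_shift[OF F_G]] field_modes_of_int[OF field_modes_shift[OF F_V]]] add_0)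
  also have "\<dots> = - nop a G (n + m) p + of_int (2 * m) * V (- 2) (n + m) p"
    unfolding nop_minus_right[OF F_V field_modes_shift[OF F_G]] nop_of_int_right[OF F_V field_modes_shift[OF F_V]] nop_shift_right
    using vertex_mode_product[OF l, of 1 "- 3" "n + m" p] by simp
  finally have N: "b m (N2 n p) - N2 n (b m p) = - nop a G (n + m) p + of_int (2 * m) * V (- 2) (n + m) p" .
  have "f0_b_bracket (n + m) p = of_int (2 * n) * V (- 2) (n + m) p + (b m (N2 n p) - N2 n (b m p))"
    unfolding N by (simp add: f0_b_bracket_def G_def[abs_def] algebra_simps)
  moreover have "of_int (2 * n) * (as n (b m p) - b m (as n p)) = of_int (2 * n) * V (- 2) (n + m) p"
    by (simp only: a_star_b_commutator)
  ultimately show ?thesis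
    unfolding f0_def field_modes_simps[OF F_V] by (simp add: algebra_simps)
qed


lemma nop_a_b: "nop a b n p = vacuum_modes n p"
  using vertex_mode_product[OF l, of 1 "- 1" n p] by (simp add: vertex_mode_zero)

text \<open>
  Bosonization: \<open>:a a\<^sup>*: = x - \<alpha>\<close>.  As \<open>a\<^sup>* = -:\<alpha> a\<^sup>-\<^sup>1:\<close>, quasi-associativity moves \<open>\<alpha>\<close> to the outside,
  where \<open>a a\<^sup>-\<^sup>1 = 1\<close> applies; the corrections are multiples of \<open>(\<partial>\<^sub>z a) a\<^sup>-\<^sup>1 = x(z)\<close>.
\<close>
lemma J_eq: "J n p = xop n p - alpha_op n p"
proof -
  have F_wa: "field_modes (index_weighted a)" by (rule field_modes_index_weighted[OF F_V])
  have alpha_b: "alpha_op k (b j v) - b j (alpha_op k v) = - b (k + j) v" for k j v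
    by (simp add: alpha_vertex_commutator add.commute)
  have F_nb: "field_modes (\<lambda>k v. - b k v)" by (rule field_modes_minus[OF F_V])
  have zero: "nop (index_weighted alpha_op) (\<lambda>k v. 0) n p = 0"
    by (rule nop_zero_right[OF field_modes_index_weighted[OF field_modes_alpha]])
  have 1: "nop (nop a alpha_op) b n p = nop a (nop alpha_op b) n p + nop (index_weighted a) b n p"
    using nop_quasi_assoc[OF F_V[of 1] field_modes_alpha F_V[of "- 1"] F_nb field_modes_zero, of n p] alpha_b zero
    by (simp add: vertex_mode_commute[of l 1 _ "- 1"] nop_minus_right[OF F_wa F_V])
  have a_alpha: "nop a alpha_op k v = nop alpha_op a k v + (index_weighted a k v + a k v)" for k v
  proof -
    have "nop a alpha_op k v = nop alpha_op a k v - of_int (k + 1) * - a k v"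
      by (rule nop_swap[OF F_V field_modes_alpha])
        (simp add: minus_diff_eq[of "alpha_op _ _", symmetric] alpha_vertex_commutator del: minus_diff_eq)
    then show ?thesis by (simp add: index_weighted_def algebra_simps)
  qed
  have "nop (nop a alpha_op) b n p = nop (\<lambda>k v. nop alpha_op a k v + (index_weighted a k v + a k v)) b n p"
    by (rule nop_cong) (rule a_alpha, rule refl)
  also have "\<dots> = nop (nop alpha_op a) b n p + (nop (index_weighted a) b n p + nop a b n p)"
    by (simp only: nop_add_left field_modes_add field_modes_nop field_modes_alpha F_V F_wa)
  also have "nop (nop alpha_op a) b n p = nop alpha_op (nop a b) n p + nop (index_weighted a) b n p"
    using nop_quasi_assoc[OF field_modes_alpha F_V[of 1] F_V[of "- 1"] field_modes_zero F_nb, of n p] alpha_b zero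
    by (simp add: vertex_mode_commute[of l 1 _ "- 1"] nop_minus_right[OF F_wa F_V])
  also have "nop alpha_op (nop a b) n p = alpha_op n p"
    using nop_cong[of alpha_op alpha_op "nop a b" vacuum_modes n p] nop_a_b nop_vacuum_right[OF field_modes_alpha] by simp
  finally have 2: "nop (nop a alpha_op) b n p = alpha_op n p + 2 * nop (index_weighted a) b n p + vacuum_modes n p"
    by (simp add: nop_a_b)
  have "nop (nop xop a) b n p = nop (\<lambda>k v. - index_weighted a k v + - a k v) b n p"
    by (rule nop_cong) (simp_all add: nop_xop_vertex_mode index_weighted_def algebra_simps)
  also have "\<dots> = - nop (index_weighted a) b n p + - nop a b n p"
    by (simp only: nop_add_left nop_minus_left field_modes_minus F_V F_wa)
  finally have 3: "nop (nop xop a) b n p = - nop (index_weighted a) b n p - vacuum_modes n p" by (simp add: nop_a_b)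
  have "nop (nop xop a) b n p = nop xop (nop a b) n p"
    using nop_quasi_assoc[OF field_modes_xop F_V[of 1] F_V[of "- 1"] field_modes_zero field_modes_zero, of n p]
    by (simp add: vertex_mode_commute[of l 1 _ "- 1"] xop_vertex_mode F_wa field_modes_index_weighted field_modes_xop)
  also have "\<dots> = xop n p"
    using nop_cong[of xop xop "nop a b" vacuum_modes n p] nop_a_b nop_vacuum_right[OF field_modes_xop] by simp
  finally have 4: "xop n p = - nop (index_weighted a) b n p - vacuum_modes n p" using 3 by simp
  have "J n p = nop a (\<lambda>k v. - nop alpha_op b k v) n p"
    by (rule nop_cong) (simp_all add: a_star_op_eq)
  also have "\<dots> = - nop a (nop alpha_op b) n p"
    by (rule nop_minus_right[OF F_V field_modes_nop[OF field_modes_alpha F_V]])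
  also have "nop a (nop alpha_op b) n p = alpha_op n p + nop (index_weighted a) b n p + vacuum_modes n p"
    using 1 2 by (simp add: algebra_simps)
  finally show ?thesis by (simp add: 4)
qed

lemma J_eq_xop_yop: "- (2 * J n p) = yop n p - xop n p"
  unfolding J_eq alpha_op_def using half_of_int[of 1] by (simp add: algebra_simps)

text \<open>
  Quasi-associativity rewrites \<open>:JJ:\<close> as \<open>:a N:\<close> plus terms quadratic in \<open>a\<close>, \<open>a\<^sup>*\<close> and a derivative, where
  \<open>N = :a (a\<^sup>*)\<^sup>2:\<close>.  The terms with \<open>N\<close> cancel against \<open>:a f:\<close>, and the others by the Leibniz rule for the
  derivative of \<open>:a a\<^sup>*:\<close>.
\<close>
lemma sugawara_f0: "nop a f0 n p + nop f0 a n p + 2 * nop J J n p = 0"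
proof -
  let ?wa = "index_weighted a" and ?ws = "index_weighted as"
  have F_w: "field_modes ?wa" "field_modes ?ws" by (rule field_modes_index_weighted F_V F_as)+
  have a_star_J: "as k (J j v) - J j (as k v) = - as (k + j) v" for k j v
    using J_a_star_commutator[of j k v] by (simp add: algebra_simps)
  have 1: "nop J J n p = nop a (nop as J) n p + nop ?wa as n p - nop ?ws a n p"
    using nop_quasi_assoc[OF F_V[of 1] F_as F_J field_modes_minus[OF F_as] F_V[of 1], of n p] a_star_J a_J_commutator
    by (simp add: nop_minus_right[OF F_w(1) F_as] add.commute)
  have 2: "nop as J k v = N2 k v + as k v" for k v
  proof -
    have "nop as J k v = nop J as k v - of_int (k + 1) * - as k v"
      by (rule nop_swap[OF F_as F_J]) (simp add: a_star_J)
    moreover have "nop J as k v = nop a a2 k v - nop ?ws vacuum_modes k v"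
      using nop_quasi_assoc[OF F_V[of 1] F_as F_as field_modes_zero field_modes_vacuum, of k v]
      by (simp add: a_star_commute[of _ _ v] a_star_commute a_a_star_commutator F_w)
    ultimately show ?thesis
      by (simp add: nop_vacuum_right[OF F_w(2)] index_weighted_def algebra_simps)
  qed
  have "nop a (nop as J) n p = nop a (\<lambda>k v. N2 k v + as k v) n p" by (rule nop_cong) (rule refl, rule 2)
  also have "\<dots> = nop a N2 n p + J n p" by (rule nop_add_right[OF F_V F_N2 F_as])
  finally have 3: "nop J J n p = nop a N2 n p + J n p + nop ?wa as n p - nop ?ws a n p" using 1 by simp
  have "nop a f0 n p = nop a (\<lambda>k v. - N2 k v + of_int 2 * ?ws k v) n p"
    by (rule nop_cong) (simp_all add: f0_def index_weighted_def algebra_simps)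
  also have "\<dots> = - nop a N2 n p + of_int 2 * nop a ?ws n p"
    by (simp only: nop_add_right[OF F_V field_modes_minus[OF F_N2] field_modes_of_int[OF F_w(2)]] nop_minus_right[OF F_V F_N2] nop_of_int_right[OF F_V F_w(2)])
  finally have 4: "nop a f0 n p = - nop a N2 n p + 2 * nop a ?ws n p" by simp
  have "nop a f0 n p = nop f0 a n p - of_int (n + 1) * - (2 * J n p)"
    by (rule nop_swap[OF F_V F_f0]) (auto simp: a_f0_commutator vacuum_modes_def)
  moreover have "nop a ?ws n p = nop ?ws a n p - of_int (n + 1) * 0"
    by (rule nop_swap[OF F_V F_w(2)])
      (auto simp: index_weighted_def pi_linear_simps(6)[OF pi_linear_vertex_mode] right_diff_distrib[symmetric] a_a_star_commutator vacuum_modes_def simp del: of_int_diff)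
  moreover have "nop ?wa as n p = of_int n * J n p - nop a ?ws n p"
    using nop_index_weighted[OF F_V F_as, of 1 n p] by (simp add: algebra_simps)
  ultimately have 5: "nop f0 a n p = - nop a N2 n p + 2 * nop a ?ws n p - of_int (n + 1) * (2 * J n p)"
    and 6: "nop J J n p = nop a N2 n p + J n p + (of_int n * J n p - nop a ?ws n p) - nop a ?ws n p"
    using 3 4 by simp_all
  show ?thesis unfolding 4 5 6 by (simp add: algebra_simps)
qed


text \<open>
  The scalar field \<open>\<chi>(z)\<close>, so that \<open>\<chi>(z) a\<^sup>-\<^sup>1(z)\<close> is a normally ordered product.
\<close>
definition chi_modes :: "complex fls \<Rightarrow> int \<Rightarrow> pi_space \<Rightarrow> pi_space" where
  "chi_modes chi n p = pi_const (mode2 chi n) * p"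

lemma F_chi: "field_modes (chi_modes chi)"
proof (rule field_modesI)
  show "Modules.additive (chi_modes chi n)" for n
    by standard (simp add: chi_modes_def distrib_left)
  show "\<exists>N. \<forall>n\<ge>N. chi_modes chi n p = 0" for p
    by (rule exI[of _ "- fls_subdegree chi - 1"]) (auto simp: chi_modes_def mode2_def)
qed

lemma chi_modes_commute:
  "V m k (chi_modes chi j p) = chi_modes chi j (V m k p)"
  "as k (chi_modes chi j p) = chi_modes chi j (as k p)"
  "J k (chi_modes chi j p) = chi_modes chi j (J k p)"
  "f0 k (chi_modes chi j p) = chi_modes chi j (f0 k p)"
  by (simp_all add: chi_modes_def pi_linear_simps(5) pi_linear_vertex_mode pi_linear_a_star pi_linear_J pi_linear_f0)

lemma pi_linear_chi_modes: "pi_linear (chi_modes chi n)"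
  by (simp add: chi_modes_def[abs_def])

abbreviation (input) fchi where "fchi chi \<equiv> nop (chi_modes chi) b"

lemmas F_fchi = field_modes_nop[OF F_chi F_V]

lemma V_fchi_commute: "V m k (fchi chi n p) = fchi chi n (V m k p)"
  by (rule nop_intertwine[OF field_modes_additive[OF F_V] F_chi F_V]) (simp_all add: chi_modes_commute vertex_mode_commute[of l m])

lemma J_fchi_commutator: "J k (fchi chi m p) - fchi chi m (J k p) = fchi chi (k + m) p"
proof -
  have "J k (fchi chi m p) - fchi chi m (J k p) = nop (\<lambda>j v. 0) b m p + nop (chi_modes chi) (\<lambda>j. b (j + k)) m p"
    by (rule nop_derivation[OF field_modes_additive[OF F_J] F_chi F_V])
      (simp_all add: chi_modes_commute J_b_commutator add.commute)
  then show ?thesis by (simp add: F_V nop_shift_right add.commute)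
qed

text \<open>
  Since this is symmetric in \<open>k\<close> and \<open>m\<close>, the cross terms in \<open>[f(k), f(m)]\<close> cancel.
\<close>
lemma f0_fchi_commutator: "f0 k (fchi chi m p) - fchi chi m (f0 k p) = nop (chi_modes chi) f0_b_bracket (m + k) p"
proof -
  have "f0 k (fchi chi m p) - fchi chi m (f0 k p) = nop (\<lambda>j v. 0) b m p + nop (chi_modes chi) (\<lambda>j. f0_b_bracket (j + k)) m p"
    by (rule nop_derivation[OF field_modes_additive[OF F_f0] F_chi F_V])
      (simp_all add: chi_modes_commute f0_b_commutator add.commute)
  then show ?thesis by (simp add: F_V nop_shift_right)
qed

lemma pi_linear_fchi: "pi_linear (fchi chi n)"
  by (intro pi_linear_nop F_chi F_V pi_linear_chi_modes pi_linear_vertex_mode)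

lemma fchi_commute: "fchi chi k (fchi chi m p) = fchi chi m (fchi chi k p)"
  by (rule nop_intertwine[OF field_modes_additive[OF F_fchi] F_chi F_V])
    (simp_all add: V_fchi_commute chi_modes_def pi_linear_simps(5)[OF pi_linear_fchi])

lemma nop_a_fchi: "nop a (fchi chi) n p = chi_modes chi n p"
proof -
  have "nop (nop a (chi_modes chi)) b n p = nop a (fchi chi) n p"
    using nop_quasi_assoc[OF F_V[of 1] F_chi F_V[of "- 1"] field_modes_zero field_modes_zero, of chi n p]
    by (simp add: chi_modes_commute vertex_mode_commute[of l 1 _ "- 1"] field_modes_index_weighted F_V F_chi)
  moreover have "nop (nop (chi_modes chi) a) b n p = nop (chi_modes chi) (nop a b) n p"
    using nop_quasi_assoc[OF F_chi F_V[of 1] F_V[of "- 1"] field_modes_zero field_modes_zero, of chi n p]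
    by (simp add: chi_modes_commute vertex_mode_commute[of l 1 _ "- 1"] field_modes_index_weighted F_V F_chi)
  moreover have "nop a (chi_modes chi) k v = nop (chi_modes chi) a k v" for k v
    using nop_swap[OF F_V[of 1] F_chi, where n = k and v = v and C = 0] by (simp add: chi_modes_commute)
  then have "nop (nop a (chi_modes chi)) b n p = nop (nop (chi_modes chi) a) b n p"
    by (rule nop_cong) (rule refl)
  moreover have "nop (chi_modes chi) (nop a b) n p = nop (chi_modes chi) vacuum_modes n p"
    by (rule nop_cong) (simp_all add: nop_a_b)
  ultimately show ?thesis by (simp add: nop_vacuum_right[OF F_chi])
qed

lemma wak_e_eq: "wak_e l n p = a n p"
  by (simp add: wak_e_def a_op_eq)

lemma normal_ordered_a_eq: "normal_ordered_a l B n p = nop a B n p"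
  unfolding normal_ordered_a_def nop_def nop_term_def[abs_def] a_op_eq ..

lemma wak_h_eq: "wak_h l n p = - (2 * J n p)"
  by (simp add: wak_h_def normal_ordered_a_eq)

lemma a_star_sq_op_eq: "a_star_sq_op l n p = a2 n p"
proof -
  have "nop_term as as n p = (\<lambda>m. as m (as (n - m) p))"
    by (auto simp: nop_term_def a_star_commute)
  then show ?thesis by (simp add: a_star_sq_op_def nop_def)
qed

lemma wak_f_eq: "wak_f l chi n p = f0 n p + fchi chi n p"
proof -
  have "nop_term (chi_modes chi) b n p k = Poly_Mapping.map (MT_act chi k) (a_inv_op l (n - k) p)" for k
  proof -
    have "MT_act chi k = (*) (mode2 chi k)" by (simp add: fun_eq_iff MT_act_def)
    then have "Poly_Mapping.map (MT_act chi k) q = pi_const (mode2 chi k) * q" for q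
      by (simp add: mult_map_scale_conv_mult pi_const_def)
    then show ?thesis
      by (auto simp: nop_term_def a_inv_op_eq chi_modes_commute[unfolded chi_modes_def] chi_modes_def)
  qed
  then have "nop_term (chi_modes chi) b n p = (\<lambda>k. Poly_Mapping.map (MT_act chi k) (a_inv_op l (n - k) p))" by auto
  then have chi: "Sum_any (\<lambda>k. Poly_Mapping.map (MT_act chi k) (a_inv_op l (n - k) p)) = fchi chi n p"
    by (simp add: nop_def)
  have "normal_ordered_a l (a_star_sq_op l) n p = N2 n p"
    unfolding normal_ordered_a_eq by (rule nop_cong) (simp_all add: a_star_sq_op_eq)
  moreover have "pi_const 2 * (pi_const (- of_int n) * as n p) = - (of_int (2 * n) * as n p)"
    using pi_const_of_int[of "- n"] by (simp add: pi_const_mult_eq pi_const_minus mult.assoc)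
  ultimately show ?thesis by (simp only: wak_f_def chi f0_def) simp
qed

lemma field_modes_wak: "field_modes (wak_e l)" "field_modes (wak_h l)" "field_modes (wak_f l chi)"
proof -
  show "field_modes (wak_e l)" using F_V[of 1] by (simp add: wak_e_eq[abs_def])
  show "field_modes (wak_h l)"
    using field_modes_minus[OF field_modes_of_int[OF F_J, of "\<lambda>_. 2"]] by (simp add: wak_h_eq[abs_def])
  show "field_modes (wak_f l chi)"
    using field_modes_add[OF F_f0 F_fchi] by (simp add: wak_f_eq[abs_def])
qed

lemma pi_linear_wak: "pi_linear (wak_e l n)" "pi_linear (wak_h l n)" "pi_linear (wak_f l chi n)"
proof -
  note L = pi_linear_simps[OF pi_linear_vertex_mode] pi_linear_simps[OF pi_linear_J]
    pi_linear_simps[OF pi_linear_f0] pi_linear_simps[OF pi_linear_fchi]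
  show "pi_linear (wak_e l n)" "pi_linear (wak_h l n)" "pi_linear (wak_f l chi n)"
    by (rule pi_linearI; simp add: wak_e_eq wak_h_eq wak_f_eq L distrib_left mult.left_commute)+
qed

theorem wakimoto_commutators:
  "wak_e l n (wak_e l m p) - wak_e l m (wak_e l n p) = 0"
  "wak_f l chi n (wak_f l chi m p) - wak_f l chi m (wak_f l chi n p) = 0"
  "wak_h l n (wak_h l m p) - wak_h l m (wak_h l n p) = - (of_int (4 * n) * vacuum_modes (n + m) p)"
  "wak_h l n (wak_e l m p) - wak_e l m (wak_h l n p) = 2 * wak_e l (n + m) p"
  "wak_h l n (wak_f l chi m p) - wak_f l chi m (wak_h l n p) = - (2 * wak_f l chi (n + m) p)"
  "wak_e l n (wak_f l chi m p) - wak_f l chi m (wak_e l n p) = wak_h l (n + m) p - of_int (2 * n) * vacuum_modes (n + m) p"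
proof -
  have num: "F (2 * q) = 2 * F q" if "field_modes A" "F = A n" for F q and A :: "int \<Rightarrow> pi_space \<Rightarrow> pi_space" and n
    using field_modes_simps(5)[OF that(1), of n 2 q] that(2) by simp
  note S = field_modes_simps(1-3)[OF F_J] field_modes_simps(1-3)[OF F_f0] field_modes_simps(1-3)[OF F_fchi] field_modes_simps(1-3)[OF F_V]
    num[OF F_J refl] num[OF F_f0 refl] num[OF F_fchi refl] num[OF F_V refl]
  show "wak_e l n (wak_e l m p) - wak_e l m (wak_e l n p) = 0"
    by (simp add: wak_e_eq vertex_mode_commute[of l 1 n])
  show "wak_f l chi n (wak_f l chi m p) - wak_f l chi m (wak_f l chi n p) = 0"
    using f0_fchi_commutator[of n chi m p] f0_fchi_commutator[of m chi n p] fchi_commute[of chi n m p] f0_commute[of n m p]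
    by (simp add: wak_f_eq S algebra_simps)
  show "wak_h l n (wak_h l m p) - wak_h l m (wak_h l n p) = - (of_int (4 * n) * vacuum_modes (n + m) p)"
    using arg_cong[OF J_J_commutator[of n m p], of "\<lambda>q. 4 * q"] by (simp add: wak_h_eq S algebra_simps)
  show "wak_h l n (wak_e l m p) - wak_e l m (wak_h l n p) = 2 * wak_e l (n + m) p"
    using arg_cong[OF J_a_commutator[of n m p], of "\<lambda>q. 2 * q"] by (simp add: wak_h_eq wak_e_eq S algebra_simps)
  show "wak_h l n (wak_f l chi m p) - wak_f l chi m (wak_h l n p) = - (2 * wak_f l chi (n + m) p)"
    using arg_cong[OF J_f0_commutator[of n m p], of "\<lambda>q. 2 * q"] arg_cong[OF J_fchi_commutator[of n chi m p], of "\<lambda>q. 2 * q"]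
    by (simp add: wak_h_eq wak_f_eq S algebra_simps)
  show "wak_e l n (wak_f l chi m p) - wak_f l chi m (wak_e l n p) = wak_h l (n + m) p - of_int (2 * n) * vacuum_modes (n + m) p"
    using a_f0_commutator[of n m p] V_fchi_commute[of 1 n chi m p] by (simp add: wak_h_eq wak_e_eq wak_f_eq S algebra_simps)
qed

text \<open>
  The Sugawara field vanishes for \<open>\<chi> = 0\<close>, and \<open>a(z) \<chi>(z) a\<^sup>-\<^sup>1(z) = \<chi>(z)\<close>.
\<close>
theorem wakimoto_sugawara:
  "nop (wak_e l) (wak_f l chi) n p + nop (wak_f l chi) (wak_e l) n p + pi_const (1 / 2) * nop (wak_h l) (wak_h l) n p
    = 2 * (pi_const (mode2 chi n) * p)"
proof -
  have "nop (wak_e l) (wak_f l chi) n p = nop a (\<lambda>k v. f0 k v + fchi chi k v) n p"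
    by (rule nop_cong) (simp_all add: wak_e_eq wak_f_eq)
  also have "\<dots> = nop a f0 n p + nop a (fchi chi) n p"
    by (rule nop_add_right[OF F_V F_f0 F_fchi])
  finally have 1: "nop (wak_e l) (wak_f l chi) n p = nop a f0 n p + chi_modes chi n p" by (simp add: nop_a_fchi)
  have "nop (wak_f l chi) (wak_e l) n p = nop (\<lambda>k v. f0 k v + fchi chi k v) a n p"
    by (rule nop_cong) (simp_all add: wak_e_eq wak_f_eq)
  also have "\<dots> = nop f0 a n p + nop (fchi chi) a n p"
    by (rule nop_add_left[OF F_f0 F_fchi F_V])
  also have "nop (fchi chi) a n p = nop a (fchi chi) n p"
    using nop_swap[OF F_fchi[of chi] F_V[of 1], where n = n and v = p and C = 0] by (simp add: V_fchi_commute)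
  finally have 2: "nop (wak_f l chi) (wak_e l) n p = nop f0 a n p + chi_modes chi n p" by (simp add: nop_a_fchi)
  have "nop (wak_h l) (wak_h l) n p = nop (\<lambda>k v. of_int (- 2) * J k v) (\<lambda>k v. of_int (- 2) * J k v) n p"
    by (rule nop_cong) (simp_all add: wak_h_eq)
  also have "\<dots> = of_int (2 * 2) * nop J J n p"
    unfolding nop_of_int_left[OF F_J field_modes_of_int[OF F_J]] nop_of_int_right[OF F_J F_J] by simp
  finally have 3: "pi_const (1 / 2) * nop (wak_h l) (wak_h l) n p = 2 * nop J J n p"
    using half_of_int[of 2 "nop J J n p"] by simp
  show ?thesis
    using sugawara_f0[of n p] unfolding 1 2 3 by (simp add: chi_modes_def algebra_simps)
qed

lemma wak_h_eq_yop_xop: "wak_h l n p = yop n p - xop n p"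
  by (simp add: wak_h_eq J_eq_xop_yop)

end

hide_const (open) V a b as J a2 N2 fchi

section \<open>Modules over the affine Lie algebra and their quotients\<close>

lemma complex_field_simps [simp]:
  "carrier complex_field = UNIV" "\<zero>\<^bsub>complex_field\<^esub> = 0" "\<one>\<^bsub>complex_field\<^esub> = 1"
  "x \<oplus>\<^bsub>complex_field\<^esub> y = x + y" "x \<otimes>\<^bsub>complex_field\<^esub> y = x * y"
  by (simp_all add: ring_of_type_algebra_def)

locale affine_mod = module complex_field M
  for M :: "('v, 'z) affine_module_scheme" (structure) +
  assumes act_closed [simp, intro]: "v \<in> carrier M \<Longrightarrow> act M x v \<in> carrier M"
    and act_add: "v \<in> carrier M \<Longrightarrow> w \<in> carrier M \<Longrightarrow> act M x (v \<oplus>\<^bsub>M\<^esub> w) = act M x v \<oplus>\<^bsub>M\<^esub> act M x w"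
    and act_smult: "v \<in> carrier M \<Longrightarrow> act M x (s \<odot>\<^bsub>M\<^esub> v) = s \<odot>\<^bsub>M\<^esub> act M x v"
    and act_plus: "v \<in> carrier M \<Longrightarrow> act M (x + y) v = act M x v \<oplus>\<^bsub>M\<^esub> act M y v"
    and act_scale: "v \<in> carrier M \<Longrightarrow> act M (affine_scale s x) v = s \<odot>\<^bsub>M\<^esub> act M x v"
    and act_bracket: "v \<in> carrier M \<Longrightarrow>
      act M (affine_bracket x y) v = act M x (act M y v) \<ominus>\<^bsub>M\<^esub> act M y (act M x v)"
begin

lemma smult_mem [simp, intro]: "v \<in> carrier M \<Longrightarrow> s \<odot>\<^bsub>M\<^esub> v \<in> carrier M"
  by (rule smult_closed) simp_all

lemma smult_add: "v \<in> carrier M \<Longrightarrow> w \<in> carrier M \<Longrightarrow> s \<odot>\<^bsub>M\<^esub> (v \<oplus>\<^bsub>M\<^esub> w) = s \<odot>\<^bsub>M\<^esub> v \<oplus>\<^bsub>M\<^esub> s \<odot>\<^bsub>M\<^esub> w"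
  by (rule smult_r_distr) simp_all

lemma smult_plus: "v \<in> carrier M \<Longrightarrow> (s + t) \<odot>\<^bsub>M\<^esub> v = s \<odot>\<^bsub>M\<^esub> v \<oplus>\<^bsub>M\<^esub> t \<odot>\<^bsub>M\<^esub> v"
  using smult_l_distr[of s t v] by simp

lemma smult_smult: "v \<in> carrier M \<Longrightarrow> s \<odot>\<^bsub>M\<^esub> (t \<odot>\<^bsub>M\<^esub> v) = (s * t) \<odot>\<^bsub>M\<^esub> v"
  using smult_assoc1[of s t v] by simp

lemma smult_1 [simp]: "v \<in> carrier M \<Longrightarrow> 1 \<odot>\<^bsub>M\<^esub> v = v"
  using smult_one[of v] by simp

lemma smult_0 [simp]: "v \<in> carrier M \<Longrightarrow> 0 \<odot>\<^bsub>M\<^esub> v = \<zero>\<^bsub>M\<^esub>"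
  using smult_l_null[of v] by simp

lemma smult_zero [simp]: "s \<odot>\<^bsub>M\<^esub> \<zero>\<^bsub>M\<^esub> = \<zero>\<^bsub>M\<^esub>"
  using smult_r_null[of s] by simp

lemma smult_neg_1: "v \<in> carrier M \<Longrightarrow> (- 1) \<odot>\<^bsub>M\<^esub> v = \<ominus>\<^bsub>M\<^esub> v"
  by (rule M.add.inv_equality[symmetric]) (use smult_plus[of v "- 1" 1] in simp_all)

lemma act_zero [simp]: "act M x \<zero>\<^bsub>M\<^esub> = \<zero>\<^bsub>M\<^esub>"
  using act_smult[of "\<zero>\<^bsub>M\<^esub>" x 0] by simp

lemma act_minus: "v \<in> carrier M \<Longrightarrow> w \<in> carrier M \<Longrightarrow> act M x (v \<ominus>\<^bsub>M\<^esub> w) = act M x v \<ominus>\<^bsub>M\<^esub> act M x w"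
  using act_smult[of w x "- 1"] by (simp add: a_minus_def act_add smult_neg_1)

end

lemma affine_mod_iff: "is_affine_module M \<longleftrightarrow> affine_mod M"
  unfolding is_affine_module_def affine_mod_def affine_mod_axioms_def by blast

definition affine_hom :: "('v, 'y) affine_module_scheme \<Rightarrow> ('w, 'z) affine_module_scheme \<Rightarrow> ('v \<Rightarrow> 'w) \<Rightarrow> bool" where
  "affine_hom M N \<phi> \<longleftrightarrow> (\<forall>v\<in>carrier M. \<phi> v \<in> carrier N) \<and>
     (\<forall>v\<in>carrier M. \<forall>w\<in>carrier M. \<phi> (v \<oplus>\<^bsub>M\<^esub> w) = \<phi> v \<oplus>\<^bsub>N\<^esub> \<phi> w) \<and>
     (\<forall>s. \<forall>v\<in>carrier M. \<phi> (s \<odot>\<^bsub>M\<^esub> v) = s \<odot>\<^bsub>N\<^esub> \<phi> v) \<and>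
     (\<forall>x. \<forall>v\<in>carrier M. \<phi> (act M x v) = act N x (\<phi> v))"

lemma affine_homD:
  assumes "affine_hom M N \<phi>"
  shows "v \<in> carrier M \<Longrightarrow> \<phi> v \<in> carrier N"
    and "v \<in> carrier M \<Longrightarrow> w \<in> carrier M \<Longrightarrow> \<phi> (v \<oplus>\<^bsub>M\<^esub> w) = \<phi> v \<oplus>\<^bsub>N\<^esub> \<phi> w"
    and "v \<in> carrier M \<Longrightarrow> \<phi> (s \<odot>\<^bsub>M\<^esub> v) = s \<odot>\<^bsub>N\<^esub> \<phi> v"
    and "v \<in> carrier M \<Longrightarrow> \<phi> (act M x v) = act N x (\<phi> v)"
  using assms unfolding affine_hom_def by blast+

lemma affine_hom_zero:
  assumes "affine_mod M" "affine_mod N" "affine_hom M N \<phi>"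
  shows "\<phi> \<zero>\<^bsub>M\<^esub> = \<zero>\<^bsub>N\<^esub>"
proof -
  interpret M: affine_mod M by fact
  interpret N: affine_mod N by fact
  have "\<phi> (0 \<odot>\<^bsub>M\<^esub> \<zero>\<^bsub>M\<^esub>) = 0 \<odot>\<^bsub>N\<^esub> \<phi> \<zero>\<^bsub>M\<^esub>" by (rule affine_homD[OF assms(3)]) simp
  then show ?thesis by (simp add: affine_homD[OF assms(3)])
qed

lemma affine_hom_minus:
  assumes "affine_mod M" "affine_mod N" "affine_hom M N \<phi>" "v \<in> carrier M" "w \<in> carrier M"
  shows "\<phi> (v \<ominus>\<^bsub>M\<^esub> w) = \<phi> v \<ominus>\<^bsub>N\<^esub> \<phi> w"
proof -
  interpret M: affine_mod M by fact
  interpret N: affine_mod N by fact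
  note h = affine_homD[OF assms(3)]
  have "\<phi> (v \<oplus>\<^bsub>M\<^esub> (- 1) \<odot>\<^bsub>M\<^esub> w) = \<phi> v \<oplus>\<^bsub>N\<^esub> (- 1) \<odot>\<^bsub>N\<^esub> \<phi> w"
    using assms(4,5) by (simp add: h)
  then show ?thesis using assms(4,5) by (simp add: a_minus_def M.smult_neg_1 N.smult_neg_1 h)
qed

lemma affine_submodule_kernel:
  assumes "affine_mod M" "affine_mod N" "affine_hom M N \<phi>"
  shows "affine_submodule {v \<in> carrier M. \<phi> v = \<zero>\<^bsub>N\<^esub>} M"
proof -
  interpret M: affine_mod M by fact
  interpret N: affine_mod N by fact
  note h = affine_homD[OF assms(3)]
  show ?thesis
    unfolding affine_submodule_def
  proof (intro conjI allI ballI)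
    show "submodule {v \<in> carrier M. \<phi> v = \<zero>\<^bsub>N\<^esub>} complex_field M"
    proof (rule M.submoduleI)
      fix v assume "v \<in> {v \<in> carrier M. \<phi> v = \<zero>\<^bsub>N\<^esub>}"
      then show "\<ominus>\<^bsub>M\<^esub> v \<in> {v \<in> carrier M. \<phi> v = \<zero>\<^bsub>N\<^esub>}"
        using h(3)[of v "- 1"] by (simp add: M.smult_neg_1)
    qed (auto simp: h affine_hom_zero[OF assms])
  qed (auto simp: h)
qed

lemma affine_submoduleD:
  assumes "affine_mod M" "affine_submodule H M"
  shows "H \<subseteq> carrier M" "\<zero>\<^bsub>M\<^esub> \<in> H" "u \<in> H \<Longrightarrow> v \<in> H \<Longrightarrow> u \<oplus>\<^bsub>M\<^esub> v \<in> H"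
    "u \<in> H \<Longrightarrow> s \<odot>\<^bsub>M\<^esub> u \<in> H" "u \<in> H \<Longrightarrow> act M x u \<in> H"
    "u \<in> H \<Longrightarrow> v \<in> H \<Longrightarrow> u \<ominus>\<^bsub>M\<^esub> v \<in> H"
proof -
  interpret M: affine_mod M by fact
  have sub: "submodule H complex_field M" using assms(2) by (simp add: affine_submodule_def)
  note E = M.submoduleE[OF sub]
  show "H \<subseteq> carrier M" "u \<in> H \<Longrightarrow> v \<in> H \<Longrightarrow> u \<oplus>\<^bsub>M\<^esub> v \<in> H"
    "u \<in> H \<Longrightarrow> s \<odot>\<^bsub>M\<^esub> u \<in> H"
    using E by auto
  obtain u0 where "u0 \<in> H" using E(2) by blast
  then have "0 \<odot>\<^bsub>M\<^esub> u0 \<in> H" using E(4) by simp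
  then show "\<zero>\<^bsub>M\<^esub> \<in> H" using \<open>u0 \<in> H\<close> E(1) by (simp add: subset_iff)
  show "u \<in> H \<Longrightarrow> act M x u \<in> H" using assms(2) unfolding affine_submodule_def by blast
  show "u \<in> H \<Longrightarrow> v \<in> H \<Longrightarrow> u \<ominus>\<^bsub>M\<^esub> v \<in> H"
    using E by (auto simp: a_minus_def)
qed

context affine_mod
begin

lemma affine_submodule_gen:
  assumes "S \<subseteq> carrier M"
  shows "affine_submodule (affine_submodule_gen M S) M" and "S \<subseteq> affine_submodule_gen M S"
proof -
  show "S \<subseteq> affine_submodule_gen M S" by (auto simp: affine_submodule_gen_def)
  have carr: "affine_submodule (carrier M) M"
    by (simp add: affine_submodule_def carrier_is_submodule)
  note D = affine_submoduleD[OF affine_mod_axioms]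
  show "affine_submodule (affine_submodule_gen M S) M"
    unfolding affine_submodule_def
  proof (intro conjI allI ballI)
    show "submodule (affine_submodule_gen M S) complex_field M"
    proof (rule submoduleI)
      show "affine_submodule_gen M S \<subseteq> carrier M"
        using carr assms by (auto simp: affine_submodule_gen_def)
      fix u assume u: "u \<in> affine_submodule_gen M S"
      show "\<ominus>\<^bsub>M\<^esub> u \<in> affine_submodule_gen M S"
        unfolding affine_submodule_gen_def
      proof (intro InterI)
        fix H assume "H \<in> {H. affine_submodule H M \<and> S \<subseteq> H}"
        then have H: "affine_submodule H M" "u \<in> H" using u by (auto simp: affine_submodule_gen_def)
        then have "(- 1) \<odot>\<^bsub>M\<^esub> u \<in> H" using D(4) by blast
        then show "\<ominus>\<^bsub>M\<^esub> u \<in> H" using smult_neg_1 D(1)[OF H(1)] H(2) by auto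
      qed
    qed (use D(2-4) in \<open>auto simp: affine_submodule_gen_def\<close>)
  qed (use D(5) in \<open>auto simp: affine_submodule_gen_def\<close>)
qed

end

text \<open>
  A structure onto which a module maps compatibly with the operations inherits the axioms.  Applied to
  the projection to cosets this gives quotient modules.
\<close>
lemma affine_mod_image:
  assumes M: "affine_mod M"
    and carrier: "carrier Q = \<pi> ` carrier M"
    and zero: "\<zero>\<^bsub>Q\<^esub> = \<pi> \<zero>\<^bsub>M\<^esub>"
    and add: "\<And>v w. v \<in> carrier M \<Longrightarrow> w \<in> carrier M \<Longrightarrow> \<pi> v \<oplus>\<^bsub>Q\<^esub> \<pi> w = \<pi> (v \<oplus>\<^bsub>M\<^esub> w)"
    and smult: "\<And>s v. v \<in> carrier M \<Longrightarrow> s \<odot>\<^bsub>Q\<^esub> \<pi> v = \<pi> (s \<odot>\<^bsub>M\<^esub> v)"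
    and act: "\<And>x v. v \<in> carrier M \<Longrightarrow> act Q x (\<pi> v) = \<pi> (act M x v)"
  shows "affine_mod Q" and "affine_hom M Q \<pi>"
proof -
  interpret M: affine_mod M by fact
  have ab: "abelian_group Q"
  proof (rule abelian_groupI)
    fix x assume "x \<in> carrier Q"
    then obtain v where v: "x = \<pi> v" "v \<in> carrier M" by (auto simp: carrier)
    show "\<exists>y\<in>carrier Q. y \<oplus>\<^bsub>Q\<^esub> x = \<zero>\<^bsub>Q\<^esub>"
      by (rule bexI[of _ "\<pi> (\<ominus>\<^bsub>M\<^esub> v)"]) (use v in \<open>auto simp: carrier add zero M.l_neg\<close>)
  qed (auto simp: carrier zero add M.add.m_ac)
  interpret Q: abelian_group Q by fact
  have minus: "\<pi> v \<ominus>\<^bsub>Q\<^esub> \<pi> w = \<pi> (v \<ominus>\<^bsub>M\<^esub> w)" if "v \<in> carrier M" "w \<in> carrier M" for v w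
  proof -
    have "\<ominus>\<^bsub>Q\<^esub> \<pi> w = \<pi> (\<ominus>\<^bsub>M\<^esub> w)"
      by (rule Q.add.inv_equality) (use that in \<open>auto simp: carrier zero add M.l_neg\<close>)
    then show ?thesis using that by (simp add: a_minus_def add)
  qed
  have "Module.module complex_field Q"
    by (rule moduleI[OF cring_from_type_algebra ab])
      (auto simp: carrier smult add M.smult_plus M.smult_add M.smult_smult)
  then show "affine_mod Q"
  proof (rule affine_mod.intro)
    show "affine_mod_axioms Q"
      by (rule affine_mod_axioms.intro; unfold carrier; (erule imageE)+)
        (simp_all add: smult add act minus M.act_add M.act_smult M.act_plus M.act_scale M.act_bracket)
  qed
  show "affine_hom M Q \<pi>"
    by (auto simp: affine_hom_def carrier add smult act)
qed

text \<open>
  The operations on cosets are unions over representatives, so the first step is that all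
  representatives contribute the same coset.
\<close>
lemma affine_quot_properties:
  assumes M: "affine_mod M" and H: "affine_submodule H M"
  defines "\<pi> \<equiv> \<lambda>v. H +>\<^bsub>M\<^esub> v"
  shows "affine_mod (affine_quot M H)" and "affine_hom M (affine_quot M H) \<pi>"
    and "carrier (affine_quot M H) = \<pi> ` carrier M"
    and "\<And>v w. v \<in> carrier M \<Longrightarrow> w \<in> carrier M \<Longrightarrow> \<pi> v = \<pi> w \<longleftrightarrow> v \<ominus>\<^bsub>M\<^esub> w \<in> H"
proof -
  interpret M: affine_mod M by fact
  note D = affine_submoduleD[OF M H]
  have "additive_subgroup H M"
    using H by (auto simp: affine_submodule_def submodule_def intro: additive_subgroup.intro)
  then interpret H: abelian_subgroup H M
    by (rule abelian_subgroupI3) (rule M.abelian_group_axioms)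
  let ?Q = "affine_quot M H"
  have mem: "v \<in> \<pi> v" if "v \<in> carrier M" for v
    using that D(2) by (force simp: \<pi>_def a_r_coset_def')
  have repr: "a \<in> \<pi> v \<longleftrightarrow> a \<in> carrier M \<and> \<pi> a = \<pi> v" if "v \<in> carrier M" for a v
    using that H.a_repr_independence'[of a v] mem[of a] H.a_elemrcos_carrier[of v a]
    by (auto simp: \<pi>_def)
  have eq: "\<pi> v = \<pi> w \<longleftrightarrow> v \<ominus>\<^bsub>M\<^esub> w \<in> H" if "v \<in> carrier M" "w \<in> carrier M" for v w
    using H.a_rcos_module[of w v] repr[of w v] that by (simp add: a_minus_def \<pi>_def)
  show "\<And>v w. v \<in> carrier M \<Longrightarrow> w \<in> carrier M \<Longrightarrow> \<pi> v = \<pi> w \<longleftrightarrow> v \<ominus>\<^bsub>M\<^esub> w \<in> H" by (rule eq)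
  show carrier: "carrier ?Q = \<pi> ` carrier M"
    by (auto simp: affine_quot_def A_RCOSETS_def' \<pi>_def)
  have smult: "s \<odot>\<^bsub>?Q\<^esub> \<pi> v = \<pi> (s \<odot>\<^bsub>M\<^esub> v)" if v: "v \<in> carrier M" for s v
  proof -
    have "\<pi> (s \<odot>\<^bsub>M\<^esub> a) = \<pi> (s \<odot>\<^bsub>M\<^esub> v)" if "a \<in> \<pi> v" for a
    proof -
      have a: "a \<in> carrier M" "a \<ominus>\<^bsub>M\<^esub> v \<in> H" using that v repr[OF v] eq[of a v] by auto
      have "s \<odot>\<^bsub>M\<^esub> a \<ominus>\<^bsub>M\<^esub> s \<odot>\<^bsub>M\<^esub> v = s \<odot>\<^bsub>M\<^esub> (a \<ominus>\<^bsub>M\<^esub> v)"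
        using a v M.smult_r_minus[of s v] by (simp add: a_minus_def M.smult_add)
      then show ?thesis using D(4)[OF a(2), of s] a v by (simp add: eq)
    qed
    then have "(\<Union>a\<in>\<pi> v. \<pi> (s \<odot>\<^bsub>M\<^esub> a)) = \<pi> (s \<odot>\<^bsub>M\<^esub> v)" using mem[OF v] by blast
    then show ?thesis by (simp add: affine_quot_def \<pi>_def)
  qed
  have act: "act ?Q x (\<pi> v) = \<pi> (act M x v)" if v: "v \<in> carrier M" for x v
  proof -
    have "\<pi> (act M x a) = \<pi> (act M x v)" if "a \<in> \<pi> v" for a
    proof -
      have a: "a \<in> carrier M" "a \<ominus>\<^bsub>M\<^esub> v \<in> H" using that v repr[OF v] eq[of a v] by auto
      have "act M x a \<ominus>\<^bsub>M\<^esub> act M x v = act M x (a \<ominus>\<^bsub>M\<^esub> v)"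
        using a v by (simp add: M.act_minus)
      then show ?thesis using D(5)[OF a(2), of x] a v by (simp add: eq)
    qed
    then have "(\<Union>a\<in>\<pi> v. \<pi> (act M x a)) = \<pi> (act M x v)" using mem[OF v] by blast
    then show ?thesis by (simp add: affine_quot_def \<pi>_def)
  qed
  have zero: "\<zero>\<^bsub>?Q\<^esub> = \<pi> \<zero>\<^bsub>M\<^esub>"
    using D(1) M.a_coset_add_zero[of H] by (simp add: affine_quot_def \<pi>_def)
  have add: "\<pi> v \<oplus>\<^bsub>?Q\<^esub> \<pi> w = \<pi> (v \<oplus>\<^bsub>M\<^esub> w)" if "v \<in> carrier M" "w \<in> carrier M" for v w
    using H.a_rcos_sum[OF that] by (simp add: affine_quot_def \<pi>_def)
  show "affine_mod ?Q" "affine_hom M ?Q \<pi>"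
    by (rule affine_mod_image[OF M carrier zero add smult act]; assumption)+
qed

lemma affine_quot_hom:
  assumes M: "affine_mod M" and N: "affine_mod N" and H: "affine_submodule H M"
    and \<phi>: "affine_hom M N \<phi>" and ker: "\<And>v. v \<in> H \<Longrightarrow> \<phi> v = \<zero>\<^bsub>N\<^esub>"
  shows "\<exists>\<psi>. affine_hom (affine_quot M H) N \<psi> \<and> (\<forall>v\<in>carrier M. \<psi> (H +>\<^bsub>M\<^esub> v) = \<phi> v)"
proof -
  interpret M: affine_mod M by fact
  interpret N: affine_mod N by fact
  note Q = affine_quot_properties[OF M H]
  interpret Q: affine_mod "affine_quot M H" by (rule Q(1))
  let ?\<pi> = "\<lambda>v. H +>\<^bsub>M\<^esub> v"
  note h = affine_homD[OF \<phi>] and p = affine_homD[OF Q(2)]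
  have wd: "\<phi> v = \<phi> w" if "v \<in> carrier M" "w \<in> carrier M" "?\<pi> v = ?\<pi> w" for v w
  proof -
    have "\<phi> v \<ominus>\<^bsub>N\<^esub> \<phi> w = \<zero>\<^bsub>N\<^esub>"
      using ker[of "v \<ominus>\<^bsub>M\<^esub> w"] Q(4)[of v w] that affine_hom_minus[OF M N \<phi>, of v w] by simp
    moreover have "\<phi> v = (\<phi> v \<ominus>\<^bsub>N\<^esub> \<phi> w) \<oplus>\<^bsub>N\<^esub> \<phi> w"
      using that h(1) by (simp add: a_minus_def N.a_assoc N.l_neg)
    ultimately show ?thesis using that h(1) by simp
  qed
  define \<psi> where "\<psi> A = \<phi> (SOME v. v \<in> carrier M \<and> ?\<pi> v = A)" for A
  have \<psi>: "\<psi> (?\<pi> v) = \<phi> v" if "v \<in> carrier M" for v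
  proof -
    have "\<exists>u. u \<in> carrier M \<and> ?\<pi> u = ?\<pi> v" using that by blast
    from someI_ex[OF this] show ?thesis unfolding \<psi>_def using wd that by blast
  qed
  have "affine_hom (affine_quot M H) N \<psi>"
    unfolding affine_hom_def Q(3)
    by (auto simp: \<psi> h p(2-4)[symmetric])
  then show ?thesis using \<psi> by blast
qed

section \<open>The Wakimoto module\<close>

text \<open>
  The action of \<open>x \<otimes> t\<^sup>n\<close> for an arbitrary element \<open>x\<close> of the Lie algebra.
\<close>
definition wak_loop :: "complex \<Rightarrow> complex fls \<Rightarrow> sl2 \<Rightarrow> int \<Rightarrow> pi_space \<Rightarrow> pi_space" where
  "wak_loop l chi x n p = (case x of (u, v, w) \<Rightarrow>
     pi_const u * wak_e l n p + pi_const v * wak_f l chi n p + pi_const w * wak_h l n p)"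

lemma wak_loop_add: "wak_loop l chi (x + y) n p = wak_loop l chi x n p + wak_loop l chi y n p"
  by (cases x, cases y) (simp add: wak_loop_def pi_const_add algebra_simps)

lemma wak_loop_scale: "wak_loop l chi (sl2_scale s x) n p = pi_const s * wak_loop l chi x n p"
  by (cases x) (simp add: wak_loop_def sl2_scale_def pi_const_mult algebra_simps)

lemma wak_loop_zero [simp]: "wak_loop l chi 0 n p = 0"
  by (simp add: wak_loop_def zero_prod_def)

context
  fixes l :: complex and chi :: "complex fls"
  assumes l: "l \<noteq> 0"
begin

lemma pi_linear_wak_loop: "pi_linear (wak_loop l chi x n)"
proof -
  note L = pi_linear_simps(1,5)[OF pi_linear_wak(1)[OF l]] pi_linear_simps(1,5)[OF pi_linear_wak(2)[OF l]]
    pi_linear_simps(1,5)[OF pi_linear_wak(3)[OF l]]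
  obtain u v w where "x = (u, v, w)" by (cases x)
  then show ?thesis by (intro pi_linearI) (simp_all add: wak_loop_def L distrib_left mult.left_commute)
qed

lemma wak_loop_commutator:
  "wak_loop l chi x n (wak_loop l chi y m p) - wak_loop l chi y m (wak_loop l chi x n p)
    = wak_loop l chi (sl2_bracket x y) (n + m) p
      + pi_const (- 2 * (of_int n * sl2_form x y)) * vacuum_modes (n + m) p"
proof -
  obtain u v w where x: "x = (u, v, w)" by (cases x)
  obtain u' v' w' where y: "y = (u', v', w')" by (cases y)
  note L = pi_linear_simps(1,5)[OF pi_linear_wak(1)[OF l]] pi_linear_simps(1,5)[OF pi_linear_wak(2)[OF l]]
    pi_linear_simps(1,5)[OF pi_linear_wak(3)[OF l]]
  let ?e = "wak_e l" and ?f = "wak_f l chi" and ?h = "wak_h l"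
  have "wak_loop l chi x n (wak_loop l chi y m p) - wak_loop l chi y m (wak_loop l chi x n p)
      = pi_const (u * u') * (?e n (?e m p) - ?e m (?e n p))
      + pi_const (v * v') * (?f n (?f m p) - ?f m (?f n p))
      + pi_const (w * w') * (?h n (?h m p) - ?h m (?h n p))
      + pi_const (w * u') * (?h n (?e m p) - ?e m (?h n p))
      - pi_const (u * w') * (?h m (?e n p) - ?e n (?h m p))
      + pi_const (w * v') * (?h n (?f m p) - ?f m (?h n p))
      - pi_const (v * w') * (?h m (?f n p) - ?f n (?h m p))
      + pi_const (u * v') * (?e n (?f m p) - ?f m (?e n p))
      - pi_const (v * u') * (?e m (?f n p) - ?f n (?e m p))"
    unfolding x y wak_loop_def prod.case L pi_const_mult by (simp add: algebra_simps)
  also have "\<dots> = wak_loop l chi (sl2_bracket x y) (n + m) p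
      + pi_const (- 2 * (of_int n * sl2_form x y)) * vacuum_modes (n + m) p"
  proof -
    have vac: "of_int (2 * m) * vacuum_modes (n + m) p = - (of_int (2 * n) * vacuum_modes (n + m) p)"
      by (auto simp: vacuum_modes_def add_eq_0_iff2)
    show ?thesis
      unfolding wakimoto_commutators[OF l] add.commute[of m n] vac
      unfolding x y sl2_bracket_def sl2_form_def prod.case wak_loop_def
      by (simp add: pi_const_mult pi_const_add pi_const_diff pi_const_minus algebra_simps)
  qed
  finally show ?thesis .
qed

definition wak_loops :: "(int \<Rightarrow>\<^sub>0 sl2) \<Rightarrow> pi_space \<Rightarrow> pi_space" where
  "wak_loops q p = (\<Sum>n\<in>Poly_Mapping.keys q. wak_loop l chi (Poly_Mapping.lookup q n) n p)"

lemma act_wak: "act (wak_module l chi) (q, s) p = wak_loops q p + pi_const (- 2 * s) * p"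
  by (simp add: wak_module_def wak_loops_def wak_loop_def)

lemma wak_loops_add: "wak_loops (q + r) p = wak_loops q p + wak_loops r p"
  unfolding wak_loops_def
  by (rule setsum_keys_plus_distrib) (simp_all add: wak_loop_add)

lemma wak_loops_single: "wak_loops (Poly_Mapping.single n x) p = wak_loop l chi x n p"
  by (cases "x = 0") (simp_all add: wak_loops_def)

lemma wak_loops_sum: "finite S \<Longrightarrow> wak_loops (sum g S) p = (\<Sum>i\<in>S. wak_loops (g i) p)"
  by (induction S rule: finite_induct) (simp_all add: wak_loops_add, simp add: wak_loops_def)

lemma wak_loops_scale: "wak_loops (Poly_Mapping.map (sl2_scale s) q) p = pi_const s * wak_loops q p"
proof -
  have lookup: "Poly_Mapping.lookup (Poly_Mapping.map (sl2_scale s) q) n = sl2_scale s (Poly_Mapping.lookup q n)" for n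
    by (auto simp: Poly_Mapping.map.rep_eq when_def sl2_scale_def zero_prod_def)
  have scale0: "sl2_scale s 0 = 0" by (simp add: sl2_scale_def zero_prod_def)
  have "wak_loops (Poly_Mapping.map (sl2_scale s) q) p
      = (\<Sum>n\<in>Poly_Mapping.keys q. wak_loop l chi (Poly_Mapping.lookup (Poly_Mapping.map (sl2_scale s) q) n) n p)"
    unfolding wak_loops_def
    by (rule sum.mono_neutral_left) (auto simp: in_keys_iff lookup scale0)
  then show ?thesis by (simp add: lookup wak_loop_scale wak_loops_def sum_distrib_left)
qed

lemma pi_linear_wak_loops: "pi_linear (wak_loops q)"
  by (rule pi_linearI) (simp_all add: wak_loops_def pi_linear_simps[OF pi_linear_wak_loop] sum.distrib sum_distrib_left)

lemma wak_loops_commutator: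
  "wak_loops q (wak_loops r p) - wak_loops r (wak_loops q p)
    = act (wak_module l chi) (affine_bracket (q, s) (r, t)) p"
proof -
  let ?q = "Poly_Mapping.lookup q" and ?r = "Poly_Mapping.lookup r"
  let ?K = "Poly_Mapping.keys q" and ?L = "Poly_Mapping.keys r"
  let ?W = "wak_loop l chi"
  note L = pi_linear_simps(8)[OF pi_linear_wak_loop]
  have "wak_loops q (wak_loops r p) = (\<Sum>n\<in>?K. \<Sum>m\<in>?L. ?W (?q n) n (?W (?r m) m p))"
    unfolding wak_loops_def L ..
  moreover have "wak_loops r (wak_loops q p) = (\<Sum>n\<in>?K. \<Sum>m\<in>?L. ?W (?r m) m (?W (?q n) n p))"
    unfolding wak_loops_def L by (rule sum.swap)
  ultimately have "wak_loops q (wak_loops r p) - wak_loops r (wak_loops q p)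
      = (\<Sum>n\<in>?K. \<Sum>m\<in>?L. ?W (sl2_bracket (?q n) (?r m)) (n + m) p)
        + (\<Sum>n\<in>?K. \<Sum>m\<in>?L. pi_const (- 2 * (of_int n * sl2_form (?q n) (?r m))) * vacuum_modes (n + m) p)"
    by (simp only: sum_subtractf[symmetric] wak_loop_commutator sum.distrib)
  also have "(\<Sum>n\<in>?K. \<Sum>m\<in>?L. pi_const (- 2 * (of_int n * sl2_form (?q n) (?r m))) * vacuum_modes (n + m) p)
      = (\<Sum>n\<in>?K. pi_const (- 2 * (of_int n * sl2_form (?q n) (?r (- n)))) * p)"
  proof (rule sum.cong)
    fix n
    have "(\<Sum>m\<in>?L. pi_const (- 2 * (of_int n * sl2_form (?q n) (?r m))) * vacuum_modes (n + m) p)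
        = (\<Sum>m\<in>?L. if m = - n then pi_const (- 2 * (of_int n * sl2_form (?q n) (?r (- n)))) * p else 0)"
      by (rule sum.cong) (auto simp: vacuum_modes_def add_eq_0_iff)
    also have "\<dots> = pi_const (- 2 * (of_int n * sl2_form (?q n) (?r (- n)))) * p"
      by (auto simp: in_keys_iff)
    finally show "(\<Sum>m\<in>?L. pi_const (- 2 * (of_int n * sl2_form (?q n) (?r m))) * vacuum_modes (n + m) p)
        = pi_const (- 2 * (of_int n * sl2_form (?q n) (?r (- n)))) * p" .
  qed simp
  also have "\<dots> = pi_const (- 2 * (\<Sum>n\<in>?K. of_int n * sl2_form (?q n) (?r (- n)))) * p"
  proof -
    have const_sum: "pi_const (sum g S) = (\<Sum>i\<in>S. pi_const (g i))" for g :: "int \<Rightarrow> complex" and S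
      by (induction S rule: infinite_finite_induct) (simp_all add: pi_const_add)
    show ?thesis by (simp only: sum_distrib_left const_sum sum_distrib_right)
  qed
  finally show ?thesis
    by (simp only: affine_bracket_def prod.case act_wak wak_loops_sum[OF finite_keys] wak_loops_single)
qed

lemma abelian_group_wak: "abelian_group (wak_module l chi)"
  by (rule abelian_groupI) (auto simp: wak_module_def add.assoc add.commute intro: exI[of _ "- _"])

lemma wak_minus: "x \<ominus>\<^bsub>wak_module l chi\<^esub> y = x - y"
proof -
  interpret abelian_group "wak_module l chi" by (rule abelian_group_wak)
  have "\<ominus>\<^bsub>wak_module l chi\<^esub> y = - y"
    by (rule minus_equality) (simp_all add: wak_module_def)
  then show ?thesis by (simp add: a_minus_def) (simp add: wak_module_def)
qed

lemma is_affine_module_wak: "is_affine_module (wak_module l chi)"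
  unfolding is_affine_module_def
proof (intro conjI allI ballI)
  let ?M = "wak_module l chi"
  have simps: "carrier ?M = UNIV" "x \<oplus>\<^bsub>?M\<^esub> y = x + y" "s \<odot>\<^bsub>?M\<^esub> x = pi_const s * x" for x y s
    by (simp_all add: wak_module_def)
  note L = pi_linear_simps(1,5)[OF pi_linear_wak_loops]
  show "Module.module complex_field ?M"
    by (rule moduleI[OF cring_from_type_algebra abelian_group_wak])
      (simp_all add: simps pi_const_add pi_const_mult algebra_simps)
  fix x y :: affine and s and v w
  obtain q a r b where xy: "x = (q, a)" "y = (r, b)" by (cases x, cases y)
  show "act ?M x v \<in> carrier ?M" by (simp add: simps)
  show "act ?M x (v \<oplus>\<^bsub>?M\<^esub> w) = act ?M x v \<oplus>\<^bsub>?M\<^esub> act ?M x w"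
    by (simp add: simps xy act_wak L algebra_simps)
  show "act ?M x (s \<odot>\<^bsub>?M\<^esub> v) = s \<odot>\<^bsub>?M\<^esub> act ?M x v"
    by (simp add: simps xy act_wak L distrib_left mult.left_commute)
  show "act ?M (x + y) v = act ?M x v \<oplus>\<^bsub>?M\<^esub> act ?M y v"
    by (simp add: simps xy act_wak wak_loops_add pi_const_diff pi_const_minus algebra_simps)
  show "act ?M (affine_scale s x) v = s \<odot>\<^bsub>?M\<^esub> act ?M x v"
    by (simp add: simps xy act_wak affine_scale_def wak_loops_scale distrib_left right_diff_distrib pi_const_mult pi_const_minus mult.left_commute mult.assoc)
  show "act ?M (affine_bracket x y) v = act ?M x (act ?M y v) \<ominus>\<^bsub>?M\<^esub> act ?M y (act ?M x v)"
    using wak_loops_commutator[of q r v a b]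
    by (simp add: wak_minus xy act_wak[of q] act_wak[of r] L distrib_left mult.left_commute)
qed

lemma act_wak_basis:
  "act (wak_module l chi) (loop sl2_e n) p = wak_e l n p"
  "act (wak_module l chi) (loop sl2_f n) p = wak_f l chi n p"
  "act (wak_module l chi) (loop sl2_h n) p = wak_h l n p"
  "act (wak_module l chi) central p = pi_const (- 2) * p"
  by (simp_all add: loop_def central_def act_wak wak_loops_single wak_loop_def sl2_e_def sl2_f_def sl2_h_def)
    (simp add: wak_loops_def)

end


lemma affine_mod_wak: "l \<noteq> 0 \<Longrightarrow> affine_mod (wak_module l chi)"
  using is_affine_module_wak affine_mod_iff by blast

section \<open>The universal enveloping algebra\<close>

lemma free_ring_simps [simp]:
  "carrier free_ring = UNIV" "\<zero>\<^bsub>free_ring\<^esub> = 0" "\<one>\<^bsub>free_ring\<^esub> = 1"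
  "x \<oplus>\<^bsub>free_ring\<^esub> y = x + y" "x \<otimes>\<^bsub>free_ring\<^esub> y = x * y"
  by (simp_all add: ring_of_type_algebra_def)

lemma letters_zero: "letters 0 = []"
  by (simp add: zero_free_word_def)

lemma ring_free_ring: "ring free_ring"
proof (rule ringI)
  show "abelian_group free_ring"
    by (rule abelian_groupI) (auto simp: add.assoc add.commute intro: exI[of _ "- _"])
  show "Group.monoid free_ring"
    by (rule monoidI) (simp_all add: mult.assoc)
qed (simp_all add: algebra_simps)

lemma free_ring_minus: "\<ominus>\<^bsub>free_ring\<^esub> x = - x" "x \<ominus>\<^bsub>free_ring\<^esub> y = x - y"
proof -
  interpret ring free_ring by (rule ring_free_ring)
  show "\<ominus>\<^bsub>free_ring\<^esub> x = - x" for x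
    by (rule add.inv_equality) simp_all
  then show "x \<ominus>\<^bsub>free_ring\<^esub> y = x - y" by (simp add: a_minus_def)
qed

lemma ideal_uea_ideal: "ideal uea_ideal free_ring"
  unfolding uea_ideal_def by (rule ring.genideal_ideal[OF ring_free_ring]) simp

lemma uea_relations_in_ideal: "uea_relations \<subseteq> uea_ideal"
  unfolding uea_ideal_def by (rule ring.genideal_self[OF ring_free_ring]) simp

lemma ring_uea: "ring uea"
  unfolding uea_def by (rule ideal.quotient_is_ring[OF ideal_uea_ideal])

definition uea_of :: "free_alg \<Rightarrow> free_alg set" where
  "uea_of a = uea_ideal +>\<^bsub>free_ring\<^esub> a"

lemma uea_of_hom: "uea_of \<in> ring_hom free_ring uea"
  using ideal.rcos_ring_hom[OF ideal_uea_ideal] by (simp add: uea_def uea_of_def[abs_def])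

lemma carrier_uea: "carrier uea = range uea_of"
  by (auto simp: uea_def FactRing_def A_RCOSETS_def' uea_of_def)

lemma uea_of_simps:
  "uea_of (a + b) = uea_of a \<oplus>\<^bsub>uea\<^esub> uea_of b"
  "uea_of (a * b) = uea_of a \<otimes>\<^bsub>uea\<^esub> uea_of b"
  "uea_of 1 = \<one>\<^bsub>uea\<^esub>"
  "uea_of a \<in> carrier uea"
  using ring_hom_add[OF uea_of_hom, of a b] ring_hom_mult[OF uea_of_hom, of a b]
    ring_hom_one[OF uea_of_hom] ring_hom_closed[OF uea_of_hom, of a] by simp_all

lemma uea_of_zero: "uea_of 0 = \<zero>\<^bsub>uea\<^esub>"
proof -
  interpret ring uea by (rule ring_uea)
  have "uea_of 0 \<oplus>\<^bsub>uea\<^esub> uea_of 0 = uea_of 0" using uea_of_simps(1)[of 0 0] by simp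
  then show ?thesis using uea_of_simps(4)[of 0] by (metis add.r_cancel_one')
qed

lemma uea_of_minus: "uea_of (a - b) = uea_of a \<ominus>\<^bsub>uea\<^esub> uea_of b"
proof -
  interpret ring uea by (rule ring_uea)
  have "\<ominus>\<^bsub>uea\<^esub> uea_of b = uea_of (- b)"
    by (rule add.inv_equality) (simp_all add: uea_of_simps(1)[symmetric] uea_of_simps(4) uea_of_zero)
  then show ?thesis using uea_of_simps(1)[of a "- b"] by (simp add: a_minus_def)
qed

lemma uea_of_eq_iff: "uea_of a = uea_of b \<longleftrightarrow> a - b \<in> uea_ideal"
  using ring.quotient_eq_iff_same_a_r_cos[OF ring_free_ring ideal_uea_ideal, of a b]
  by (simp add: uea_of_def free_ring_minus)

lemma uea_gen_eq: "uea_gen x = uea_of (free_gen x)" and uea_scalar_eq: "uea_scalar s = uea_of (free_scalar s)"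
  by (simp_all add: uea_gen_def uea_scalar_def uea_of_def)

lemma free_scalar_simps:
  "free_scalar (s + t) = free_scalar s + free_scalar t"
  "free_scalar (s * t) = free_scalar s * free_scalar t"
  "free_scalar 1 = 1"
  by (simp_all add: free_scalar_def single_add mult_single)

lemma free_scalar_commute: "free_scalar s * a = a * free_scalar s"
  by (induction a rule: poly_mapping_single_add_induct)
    (simp_all add: free_scalar_def mult_single algebra_simps)

lemma uea_of_relations:
  "uea_of (free_gen (x + y)) = uea_of (free_gen x + free_gen y)"
  "uea_of (free_gen (affine_scale s x)) = uea_of (free_scalar s * free_gen x)"
  "uea_of (free_gen (affine_bracket x y)) = uea_of (free_gen x * free_gen y - free_gen y * free_gen x)"
proof -
  show "uea_of (free_gen (x + y)) = uea_of (free_gen x + free_gen y)"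
    unfolding uea_of_eq_iff diff_diff_eq[symmetric]
    by (rule subsetD[OF uea_relations_in_ideal]) (unfold uea_relations_def, blast)
  show "uea_of (free_gen (affine_scale s x)) = uea_of (free_scalar s * free_gen x)"
    unfolding uea_of_eq_iff by (rule subsetD[OF uea_relations_in_ideal]) (unfold uea_relations_def, blast)
  show "uea_of (free_gen (affine_bracket x y)) = uea_of (free_gen x * free_gen y - free_gen y * free_gen x)"
    unfolding uea_of_eq_iff[symmetric]
    by (rule sym, unfold uea_of_eq_iff, rule subsetD[OF uea_relations_in_ideal], unfold uea_relations_def, blast)
qed

lemma uea_module_simps:
  "carrier uea_module = range uea_of"
  "\<zero>\<^bsub>uea_module\<^esub> = uea_of 0"
  "uea_of a \<oplus>\<^bsub>uea_module\<^esub> uea_of b = uea_of (a + b)"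
  "s \<odot>\<^bsub>uea_module\<^esub> uea_of a = uea_of (free_scalar s * a)"
  "act uea_module x (uea_of a) = uea_of (free_gen x * a)"
  by (simp_all add: uea_module_def carrier_uea uea_of_zero uea_of_simps uea_scalar_eq uea_gen_eq)

lemma affine_mod_uea: "affine_mod uea_module"
proof -
  have ab: "abelian_group uea_module"
  proof (rule abelian_groupI)
    fix u assume "u \<in> carrier uea_module"
    then obtain a where "u = uea_of a" by (auto simp: uea_module_simps)
    then show "\<exists>v\<in>carrier uea_module. v \<oplus>\<^bsub>uea_module\<^esub> u = \<zero>\<^bsub>uea_module\<^esub>"
      by (intro bexI[of _ "uea_of (- a)"]) (simp_all add: uea_module_simps)
  qed (auto simp: uea_module_simps add.assoc add.commute add.left_commute)
  interpret abelian_group uea_module by (rule ab)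
  have minus: "uea_of a \<ominus>\<^bsub>uea_module\<^esub> uea_of b = uea_of (a - b)" for a b
  proof -
    have "\<ominus>\<^bsub>uea_module\<^esub> uea_of b = uea_of (- b)"
      by (rule add.inv_equality) (simp_all add: uea_module_simps)
    then show ?thesis by (simp add: a_minus_def uea_module_simps)
  qed
  have cong: "uea_of (b * a) = uea_of (c * a)" if "uea_of b = uea_of c" for a b c
    using that by (simp add: uea_of_simps)
  have "Module.module complex_field uea_module"
    by (rule moduleI[OF cring_from_type_algebra ab])
      (auto simp: uea_module_simps free_scalar_simps algebra_simps)
  then show ?thesis
  proof (rule affine_mod.intro)
    show "affine_mod_axioms uea_module"
    proof (rule affine_mod_axioms.intro; unfold uea_module_simps(1); (erule imageE)+; hypsubst)
      fix x y s a b
      show "act uea_module x (uea_of a) \<in> range uea_of" by (simp add: uea_module_simps)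
      show "act uea_module x (uea_of a \<oplus>\<^bsub>uea_module\<^esub> uea_of b) = act uea_module x (uea_of a) \<oplus>\<^bsub>uea_module\<^esub> act uea_module x (uea_of b)"
        by (simp add: uea_module_simps distrib_left)
      show "act uea_module x (s \<odot>\<^bsub>uea_module\<^esub> uea_of a) = s \<odot>\<^bsub>uea_module\<^esub> act uea_module x (uea_of a)"
        unfolding uea_module_simps by (metis free_scalar_commute mult.assoc)
      show "act uea_module (x + y) (uea_of a) = act uea_module x (uea_of a) \<oplus>\<^bsub>uea_module\<^esub> act uea_module y (uea_of a)"
        using cong[OF uea_of_relations(1)[of x y], of a] by (simp only: uea_module_simps distrib_right)
      show "act uea_module (affine_scale s x) (uea_of a) = s \<odot>\<^bsub>uea_module\<^esub> act uea_module x (uea_of a)"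
        using cong[OF uea_of_relations(2)[of s x], of a] by (simp add: uea_module_simps mult.assoc)
      show "act uea_module (affine_bracket x y) (uea_of a) = act uea_module x (act uea_module y (uea_of a)) \<ominus>\<^bsub>uea_module\<^esub> act uea_module y (act uea_module x (uea_of a))"
        using cong[OF uea_of_relations(3)[of x y], of a] by (simp add: uea_module_simps minus left_diff_distrib mult.assoc)
    qed
  qed
qed

lemma uea_module_generated:
  assumes H: "affine_submodule H uea_module" and one: "uea_of 1 \<in> H"
  shows "carrier uea_module \<subseteq> H"
proof -
  note D = affine_submoduleD[OF affine_mod_uea H]
  have "uea_of a \<in> H" for a
  proof (induction a rule: poly_mapping_single_add_induct)
    case zero then show ?case using D(2) by (simp add: uea_module_simps)
  next
    case (single t c)
    have "uea_of (Poly_Mapping.single (Word xs) 1) \<in> H" for xs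
    proof (induction xs)
      case Nil
      have "Poly_Mapping.single (Word []) 1 = (1 :: free_alg)"
        by (simp flip: zero_free_word_def)
      then show ?case using one by simp
    next
      case (Cons x xs)
      have "Poly_Mapping.single (Word (x # xs)) 1 = free_gen x * (Poly_Mapping.single (Word xs) 1 :: free_alg)"
        by (simp add: free_gen_def mult_single plus_free_word_def)
      then show ?case using D(5)[OF Cons, of x] by (simp add: uea_module_simps)
    qed
    moreover obtain xs where "t = Word xs" by (cases t)
    moreover have "Poly_Mapping.single t c = free_scalar c * Poly_Mapping.single t 1"
      by (simp add: free_scalar_def mult_single)
    ultimately show ?case using D(4)[of "uea_of (Poly_Mapping.single t 1)" c] by (simp add: uea_module_simps)
  next
    case (add a b) then show ?case using D(3) by (simp add: uea_module_simps(3)[symmetric])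
  qed
  then show ?thesis by (auto simp: uea_module_simps)
qed

context
  fixes l :: complex and chi :: "complex fls"
  assumes l: "l \<noteq> 0"
begin

abbreviation (input) P where "P \<equiv> wak_module l chi"

interpretation P: affine_mod P by (rule affine_mod_wak[OF l])

lemma wak_module_simps: "carrier P = UNIV" "x \<oplus>\<^bsub>P\<^esub> y = x + y" "s \<odot>\<^bsub>P\<^esub> x = pi_const s * x" "\<zero>\<^bsub>P\<^esub> = 0" "x \<ominus>\<^bsub>P\<^esub> y = x - y"
  by (simp_all add: wak_minus[OF l]) (simp_all add: wak_module_def)

text \<open>
  The action of the free algebra that extends the action of the Lie algebra.
\<close>
definition free_act :: "free_alg \<Rightarrow> pi_space \<Rightarrow> pi_space" where
  "free_act a p = (\<Sum>t\<in>Poly_Mapping.keys a. pi_const (Poly_Mapping.lookup a t) * foldr (act P) (letters t) p)"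

lemma free_act_add: "free_act (a + b) p = free_act a p + free_act b p"
  unfolding free_act_def by (rule setsum_keys_plus_distrib) (simp_all add: pi_const_add algebra_simps)

lemma free_act_single: "free_act (Poly_Mapping.single t c) p = pi_const c * foldr (act P) (letters t) p"
  by (cases "c = 0") (simp_all add: free_act_def)

lemma pi_linear_act_wak: "pi_linear (act P x)"
  using P.act_add P.act_smult by (intro pi_linearI) (simp_all add: wak_module_simps)

lemma foldr_act_linear: "pi_linear (foldr (act P) xs)"
proof (induction xs)
  case Nil show ?case by (rule pi_linearI) simp_all
next
  case (Cons x xs)
  then show ?case using pi_linear_compose[OF pi_linear_act_wak] by (simp add: comp_def)
qed

lemma pi_linear_free_act: "pi_linear (free_act a)"
  by (rule pi_linearI) (simp_all add: free_act_def pi_linear_simps[OF foldr_act_linear] sum.distrib sum_distrib_left distrib_left mult.left_commute)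

lemma free_act_zero: "free_act 0 p = 0" by (simp add: free_act_def)

lemma free_act_mult: "free_act (a * b) p = free_act a (free_act b p)"
proof (induction a rule: poly_mapping_single_add_induct)
  case zero then show ?case by (simp add: free_act_zero)
next
  case (single t c)
  show ?case
  proof (induction b rule: poly_mapping_single_add_induct)
    case zero then show ?case by (simp add: free_act_zero pi_linear_simps[OF pi_linear_free_act])
  next
    case (single u d)
    then show ?case
      by (simp add: mult_single free_act_single plus_free_word_def pi_const_mult_eq pi_linear_simps[OF foldr_act_linear])
  next
    case (add a b)
    then show ?case by (simp add: distrib_left free_act_add pi_linear_simps[OF pi_linear_free_act])
  qed
next
  case (add a b)
  then show ?case by (simp add: distrib_right free_act_add)
qed

lemma free_act_one: "free_act 1 p = p"
  using free_act_single[of 0 1 p] by (simp add: letters_zero)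

lemma free_act_gen: "free_act (free_gen x) p = act P x p"
  by (simp add: free_gen_def free_act_single)

lemma free_act_scalar: "free_act (free_scalar s) p = pi_const s * p"
  by (simp add: free_scalar_def free_act_single letters_zero)

lemma free_act_minus: "free_act (a - b) p = free_act a p - free_act b p"
  using free_act_add[of "a - b" b p] by simp

text \<open>
  The elements that act by zero form a two-sided ideal, which contains the defining relations because
  of the module axioms.
\<close>
lemma free_act_uea_ideal: "a \<in> uea_ideal \<Longrightarrow> free_act a p = 0"
proof -
  let ?K = "{a. \<forall>p. free_act a p = 0}"
  have "ideal ?K free_ring"
  proof (rule idealI[OF ring_free_ring])
    show "subgroup ?K (add_monoid free_ring)"
    proof (rule group.subgroupI)
      show "group (add_monoid free_ring)"
        by (rule abelian_group.a_group[OF ring.is_abelian_group[OF ring_free_ring]])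
      fix a assume "a \<in> ?K"
      then show "inv\<^bsub>add_monoid free_ring\<^esub> a \<in> ?K"
        using free_ring_minus(1)[of a] free_act_minus[of 0 a] by (simp add: a_inv_def free_act_zero)
    qed (auto simp: free_act_add free_act_zero intro: exI[of _ 0])
  qed (auto simp: free_act_mult pi_linear_simps[OF pi_linear_free_act])
  moreover have "uea_relations \<subseteq> ?K"
    using P.act_plus P.act_scale P.act_bracket
    unfolding uea_relations_def
    by (auto simp: free_act_minus free_act_mult free_act_gen free_act_scalar wak_module_simps simp del: plus_prod_def split_paired_All)
  ultimately have "uea_ideal \<subseteq> ?K"
    unfolding uea_ideal_def by (rule ring.genideal_minimal[OF ring_free_ring])
  then show "a \<in> uea_ideal \<Longrightarrow> free_act a p = 0" by blast
qed

text \<open>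
  The left regular module is free on the generator 1.
\<close>
lemma uea_module_hom_exists:
  obtains \<phi> where "affine_hom uea_module P \<phi>" "\<And>a. \<phi> (uea_of a) = free_act a p"
proof -
  define \<phi> where "\<phi> u = free_act (SOME a. uea_of a = u) p" for u
  have \<phi>: "\<phi> (uea_of a) = free_act a p" for a
  proof -
    have "uea_of (SOME b. uea_of b = uea_of a) = uea_of a" by (rule someI[of _ a]) simp
    then have "free_act ((SOME b. uea_of b = uea_of a) - a) p = 0"
      by (intro free_act_uea_ideal) (simp add: uea_of_eq_iff)
    then show ?thesis by (simp add: \<phi>_def free_act_minus)
  qed
  have "affine_hom uea_module P \<phi>"
    unfolding affine_hom_def
  proof (intro conjI allI ballI)
    fix u assume "u \<in> carrier uea_module"
    then obtain a where u: "u = uea_of a" by (auto simp: uea_module_simps)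
    show "\<phi> u \<in> carrier P" by (simp add: wak_module_simps)
    show "\<phi> (s \<odot>\<^bsub>uea_module\<^esub> u) = s \<odot>\<^bsub>P\<^esub> \<phi> u" for s
      by (simp add: u uea_module_simps \<phi> free_act_mult free_act_scalar wak_module_simps)
    show "\<phi> (act uea_module x u) = act P x (\<phi> u)" for x
      by (simp add: u uea_module_simps \<phi> free_act_mult free_act_gen)
    fix v assume "v \<in> carrier uea_module"
    then obtain b where v: "v = uea_of b" by (auto simp: uea_module_simps)
    show "\<phi> (u \<oplus>\<^bsub>uea_module\<^esub> v) = \<phi> u \<oplus>\<^bsub>P\<^esub> \<phi> v"
      by (simp add: u v uea_module_simps \<phi> free_act_add wak_module_simps)
  qed
  then show ?thesis using that \<phi> by blast
qed

end

hide_const (open) P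

section \<open>Sugawara operators on abstract modules\<close>

lemma affine_scale_zero: "affine_scale 0 x = 0"
proof -
  obtain q s where x: "x = (q, s)" by (cases x)
  have "Poly_Mapping.map (sl2_scale 0) q = 0"
    by (rule poly_mapping_eqI) (auto simp: Poly_Mapping.map.rep_eq when_def sl2_scale_def zero_prod_def)
  then show ?thesis by (simp add: x affine_scale_def zero_prod_def)
qed

lemma sl2_scale_zero: "sl2_scale s 0 = 0"
  by (simp add: sl2_scale_def zero_prod_def)

lemma loop_scale: "loop (sl2_scale s x) n = affine_scale s (loop x n)"
proof -
  have "Poly_Mapping.map (sl2_scale s) (Poly_Mapping.single n x) = Poly_Mapping.single n (sl2_scale s x)"
    by (rule poly_mapping_eqI) (auto simp: Poly_Mapping.map.rep_eq when_def lookup_single sl2_scale_zero)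
  then show ?thesis by (simp add: loop_def affine_scale_def)
qed

lemma sl2_form_basis:
  "sl2_form sl2_e sl2_e = 0" "sl2_form sl2_e sl2_f = 1" "sl2_form sl2_h sl2_e = 0"
  "sl2_form sl2_h sl2_f = 0" "sl2_form sl2_h sl2_h = 2"
  by (simp_all add: sl2_form_def sl2_e_def sl2_f_def sl2_h_def)

lemma sl2_bracket_self: "sl2_bracket x x = 0"
  by (cases x) (simp add: sl2_bracket_def zero_prod_def)

lemma loop_zero: "loop 0 n = 0"
  unfolding loop_def single_zero by (rule zero_prod_def[symmetric])

lemma affine_decompose:
  assumes "P 0" and add: "\<And>x y. P x \<Longrightarrow> P y \<Longrightarrow> P (x + y)" and scale: "\<And>s x. P x \<Longrightarrow> P (affine_scale s x)"
    and "\<And>n. P (loop sl2_e n)" "\<And>n. P (loop sl2_f n)" "\<And>n. P (loop sl2_h n)" "P central"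
  shows "P x"
proof -
  obtain q s where x: "x = (q, s)" by (cases x)
  have "P (q, 0)"
  proof (induction q rule: poly_mapping_single_add_induct)
    case zero then show ?case using assms(1) by (simp add: zero_prod_def)
  next
    case (single n y)
    obtain u v w where y: "y = (u, v, w)" by (cases y)
    have "(Poly_Mapping.single n y, 0) = loop (sl2_scale u sl2_e) n + loop (sl2_scale v sl2_f) n + loop (sl2_scale w sl2_h) n"
      by (simp add: y loop_def single_add[symmetric] sl2_scale_def sl2_e_def sl2_f_def sl2_h_def)
    then show ?case unfolding loop_scale using assms by simp
  next
    case (add p q)
    then show ?case using assms(2)[of "(p, 0)" "(q, 0)"] by simp
  qed
  moreover have "affine_scale s central = (0, s)"
    using poly_mapping_eqI[of "Poly_Mapping.map (sl2_scale s) 0" 0]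
    by (simp add: affine_scale_def central_def Poly_Mapping.map.rep_eq)
  ultimately show ?thesis using add[of "(q, 0)" "affine_scale s central"] scale[OF assms(7), of s] by (simp add: x)
qed

context affine_mod
begin

lemma act_0: "v \<in> carrier M \<Longrightarrow> act M 0 v = \<zero>\<^bsub>M\<^esub>"
  using act_scale[of v 0 0] by (simp add: affine_scale_zero)

lemma eq_add_of_minus_eq:
  "a \<ominus>\<^bsub>M\<^esub> b = c \<Longrightarrow> a \<in> carrier M \<Longrightarrow> b \<in> carrier M \<Longrightarrow> a = b \<oplus>\<^bsub>M\<^esub> c"
proof -
  assume "a \<ominus>\<^bsub>M\<^esub> b = c" "a \<in> carrier M" "b \<in> carrier M"
  then show ?thesis by (auto simp: a_minus_def add.m_lcomm[of b a] r_neg)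
qed

lemma minus_eq_of_eq_add:
  "a = b \<oplus>\<^bsub>M\<^esub> c \<Longrightarrow> b \<in> carrier M \<Longrightarrow> c \<in> carrier M \<Longrightarrow> b = a \<oplus>\<^bsub>M\<^esub> (- 1) \<odot>\<^bsub>M\<^esub> c"
  by (simp add: smult_neg_1 a_assoc r_neg)

lemma loop_commutator:
  assumes v: "v \<in> carrier M"
  shows "act M (loop x n) (act M (loop y m) v) = act M (loop y m) (act M (loop x n) v)
    \<oplus>\<^bsub>M\<^esub> (act M (loop (sl2_bracket x y) (n + m)) v
      \<oplus>\<^bsub>M\<^esub> (of_int n * sl2_form x y * (if n + m = 0 then 1 else 0)) \<odot>\<^bsub>M\<^esub> act M central v)"
  using eq_add_of_minus_eq[OF act_bracket[OF v, of "loop x n" "loop y m", symmetric]] v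
  by (simp add: affine_bracket_loop act_plus act_scale)

lemma commutators:
  assumes v: "v \<in> carrier M"
  shows "act M (loop sl2_e n) (act M (loop sl2_e m) v) = act M (loop sl2_e m) (act M (loop sl2_e n) v)"
    and "act M (loop sl2_h n) (act M (loop sl2_e m) v)
      = act M (loop sl2_e m) (act M (loop sl2_h n) v) \<oplus>\<^bsub>M\<^esub> 2 \<odot>\<^bsub>M\<^esub> act M (loop sl2_e (n + m)) v"
    and "act M (loop sl2_h n) (act M (loop sl2_f m) v)
      = act M (loop sl2_f m) (act M (loop sl2_h n) v) \<oplus>\<^bsub>M\<^esub> (- 2) \<odot>\<^bsub>M\<^esub> act M (loop sl2_f (n + m)) v"
    and "act M (loop sl2_h n) (act M (loop sl2_h m) v)
      = act M (loop sl2_h m) (act M (loop sl2_h n) v) \<oplus>\<^bsub>M\<^esub> (if n + m = 0 then 2 * of_int n else 0) \<odot>\<^bsub>M\<^esub> act M central v"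
    and "act M (loop sl2_e n) (act M (loop sl2_f m) v)
      = act M (loop sl2_f m) (act M (loop sl2_e n) v) \<oplus>\<^bsub>M\<^esub> (act M (loop sl2_h (n + m)) v
          \<oplus>\<^bsub>M\<^esub> (if n + m = 0 then of_int n else 0) \<odot>\<^bsub>M\<^esub> act M central v)"
  using v
  by (simp_all add: loop_commutator[of v sl2_e n sl2_e m] loop_commutator[of v sl2_h n sl2_e m]
      loop_commutator[of v sl2_h n sl2_f m] loop_commutator[of v sl2_h n sl2_h m] loop_commutator[of v sl2_e n sl2_f m]
      sl2_bracket_basis sl2_bracket_self sl2_form_basis loop_scale act_scale loop_zero act_0 mult.commute)

definition sugawara_term :: "int \<Rightarrow> 'v \<Rightarrow> int \<Rightarrow> 'v" where
  "sugawara_term n v k = normal_ordered M sl2_e k sl2_f (n - k) v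
     \<oplus>\<^bsub>M\<^esub> normal_ordered M sl2_f k sl2_e (n - k) v
     \<oplus>\<^bsub>M\<^esub> (1/2) \<odot>\<^bsub>M\<^esub> normal_ordered M sl2_h k sl2_h (n - k) v"

lemma sugawara_eq: "sugawara M n v = (1/2) \<odot>\<^bsub>M\<^esub> finsum M (sugawara_term n v) {k. sugawara_term n v k \<noteq> \<zero>\<^bsub>M\<^esub>}"
  by (simp add: sugawara_def sugawara_term_def[abs_def] Let_def)

lemma normal_ordered_closed [simp]: "v \<in> carrier M \<Longrightarrow> normal_ordered M x k y m v \<in> carrier M"
  by (simp add: normal_ordered_def)

lemma sugawara_term_closed [simp]: "v \<in> carrier M \<Longrightarrow> sugawara_term n v k \<in> carrier M"
  by (simp add: sugawara_term_def)

lemma finsum_support: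
  assumes "finite S" "\<And>k. f k \<in> carrier M" "\<And>k. k \<notin> S \<Longrightarrow> f k = \<zero>\<^bsub>M\<^esub>"
  shows "finsum M f {k. f k \<noteq> \<zero>\<^bsub>M\<^esub>} = finsum M f S"
  by (rule add.finprod_mono_neutral_cong_left) (use assms in auto)

lemma sugawara_eq_finite:
  assumes "finite S" "v \<in> carrier M" "\<And>k. k \<notin> S \<Longrightarrow> sugawara_term n v k = \<zero>\<^bsub>M\<^esub>"
  shows "sugawara M n v = (1/2) \<odot>\<^bsub>M\<^esub> finsum M (sugawara_term n v) S"
  unfolding sugawara_eq using finsum_support[OF assms(1), of "sugawara_term n v"] assms by simp

end

lemma affine_hom_finsum:
  assumes "affine_mod M" "affine_mod N" "affine_hom M N \<phi>" "finite S" "\<And>k. f k \<in> carrier M"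
  shows "\<phi> (finsum M f S) = finsum N (\<lambda>k. \<phi> (f k)) S"
proof -
  interpret M: affine_mod M by fact
  interpret N: affine_mod N by fact
  note h = affine_homD[OF assms(3)]
  show ?thesis
    using assms(4)
  proof (induction S rule: finite_induct)
    case empty then show ?case by (simp add: affine_hom_zero[OF assms(1-3)])
  next
    case (insert x S)
    then show ?case using assms(5) by (simp add: h M.finsum_closed Pi_def)
  qed
qed

lemma affine_hom_sugawara:
  assumes M: "affine_mod M" and N: "affine_mod N" and \<phi>: "affine_hom M N \<phi>" and v: "v \<in> carrier M"
    and fin: "finite {k. affine_mod.sugawara_term M n v k \<noteq> \<zero>\<^bsub>M\<^esub>}"
  shows "\<phi> (sugawara M n v) = sugawara N n (\<phi> v)"
proof -
  interpret M: affine_mod M by fact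
  interpret N: affine_mod N by fact
  note h = affine_homD[OF \<phi>]
  have t: "\<phi> (M.sugawara_term n v k) = N.sugawara_term n (\<phi> v) k" for k
    using v by (simp add: M.sugawara_term_def N.sugawara_term_def normal_ordered_def h)
  let ?S = "{k. M.sugawara_term n v k \<noteq> \<zero>\<^bsub>M\<^esub>}"
  have "\<phi> (sugawara M n v) = (1/2) \<odot>\<^bsub>N\<^esub> \<phi> (finsum M (M.sugawara_term n v) ?S)"
    unfolding M.sugawara_eq using v by (intro h M.finsum_closed) auto
  also have "\<phi> (finsum M (M.sugawara_term n v) ?S) = finsum N (N.sugawara_term n (\<phi> v)) ?S"
    using affine_hom_finsum[OF M N \<phi> fin, of "M.sugawara_term n v"] v by (simp add: t)
  also have "(1/2) \<odot>\<^bsub>N\<^esub> \<dots> = sugawara N n (\<phi> v)"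
  proof (rule N.sugawara_eq_finite[OF fin, symmetric])
    show "\<phi> v \<in> carrier N" using h(1)[OF v] .
    fix k assume "k \<notin> ?S"
    then show "N.sugawara_term n (\<phi> v) k = \<zero>\<^bsub>N\<^esub>" using t[of k] affine_hom_zero[OF M N \<phi>] by simp
  qed
  finally show ?thesis .
qed

text \<open>
  Linear subspaces; the leading term below is determined modulo such a subspace.
\<close>
definition subspace_of :: "'v set \<Rightarrow> ('v, 'z) affine_module_scheme \<Rightarrow> bool" where
  "subspace_of S M \<longleftrightarrow> S \<subseteq> carrier M \<and> \<zero>\<^bsub>M\<^esub> \<in> S \<and> (\<forall>u\<in>S. \<forall>v\<in>S. u \<oplus>\<^bsub>M\<^esub> v \<in> S) \<and> (\<forall>s. \<forall>u\<in>S. s \<odot>\<^bsub>M\<^esub> u \<in> S)"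

lemma (in affine_mod) finsum_mod_subspace:
  assumes "finite K" "subspace_of S M" "u \<in> carrier M" "\<And>k. k \<in> K \<Longrightarrow> \<exists>r\<in>S. t k = c k \<odot>\<^bsub>M\<^esub> u \<oplus>\<^bsub>M\<^esub> r"
  shows "\<exists>r\<in>S. finsum M t K = sum c K \<odot>\<^bsub>M\<^esub> u \<oplus>\<^bsub>M\<^esub> r"
  using assms(1,4)
proof (induction K rule: finite_induct)
  case empty
  show ?case using assms(2,3) by (intro bexI[of _ "\<zero>\<^bsub>M\<^esub>"]) (simp_all add: subspace_of_def)
next
  case (insert k K)
  then obtain r where r: "r \<in> S" "finsum M t K = sum c K \<odot>\<^bsub>M\<^esub> u \<oplus>\<^bsub>M\<^esub> r" by blast
  obtain r' where r': "r' \<in> S" "t k = c k \<odot>\<^bsub>M\<^esub> u \<oplus>\<^bsub>M\<^esub> r'" using insert.prems by blast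
  have c: "r \<in> carrier M" "r' \<in> carrier M" using r(1) r'(1) assms(2) by (auto simp: subspace_of_def)
  have t: "t i \<in> carrier M" if i: "i \<in> insert k K" for i
  proof -
    obtain q where "q \<in> S" "t i = c i \<odot>\<^bsub>M\<^esub> u \<oplus>\<^bsub>M\<^esub> q" using insert.prems[OF i] by blast
    then show ?thesis using assms(2,3) by (auto simp: subspace_of_def)
  qed
  have "finsum M t (insert k K) = t k \<oplus>\<^bsub>M\<^esub> finsum M t K"
    using insert.hyps t by (intro finsum_insert) auto
  also have "\<dots> = (c k + sum c K) \<odot>\<^bsub>M\<^esub> u \<oplus>\<^bsub>M\<^esub> (r' \<oplus>\<^bsub>M\<^esub> r)"
    using c assms(3) by (simp add: r r' smult_plus add.m_ac)
  finally show ?case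
    using insert.hyps r(1) r'(1) assms(2) by (intro bexI[of _ "r' \<oplus>\<^bsub>M\<^esub> r"]) (auto simp: subspace_of_def)
qed

text \<open>
  In \<open>2 T(n) w\<close> the vector \<open>f(n) w\<close> arises twice with coefficient \<open>l\<close>, from \<open>:e(0) f(n):\<close> and \<open>:f(n) e(0):\<close>.
  Every other summand has, after the mode of \<open>e\<close> is moved to the left, a mode of \<open>f\<close> of index above \<open>n\<close> or
  a mode of \<open>e\<close> that kills \<open>w\<close>.  The lemma is used twice: with the span of the \<open>e\<close>- and \<open>h\<close>-words it
  eliminates \<open>f\<close>, and with the zero subspace it computes \<open>f(n) w\<close> in the Wakimoto module.
\<close>
lemma (in affine_mod) sugawara_leading_term:
  assumes w: "w \<in> carrier M" and S: "subspace_of S M"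
    and e0: "act M (loop sl2_e 0) w = l \<odot>\<^bsub>M\<^esub> w"
    and e: "\<And>i. i \<ge> 1 \<Longrightarrow> act M (loop sl2_e i) w = \<zero>\<^bsub>M\<^esub>"
    and eS: "\<And>i v. v \<in> S \<Longrightarrow> act M (loop sl2_e i) v \<in> S"
    and f: "\<And>m. m > n \<Longrightarrow> act M (loop sl2_f m) w \<in> S"
    and h: "act M (loop sl2_h n) w \<in> S" "\<And>k. normal_ordered M sl2_h k sl2_h (n - k) w \<in> S"
    and fin: "finite {k. sugawara_term n w k \<noteq> \<zero>\<^bsub>M\<^esub>}"
  shows "\<exists>r\<in>S. sugawara M n w = l \<odot>\<^bsub>M\<^esub> act M (loop sl2_f n) w \<oplus>\<^bsub>M\<^esub> r"
proof -
  let ?E = "\<lambda>i. act M (loop sl2_e i)" and ?F = "\<lambda>i. act M (loop sl2_f i)" and ?H = "\<lambda>i. act M (loop sl2_h i)"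
  let ?K = "{k. sugawara_term n w k \<noteq> \<zero>\<^bsub>M\<^esub>} \<union> {0, n}"
  have Sc: "S \<subseteq> carrier M" and S0: "\<zero>\<^bsub>M\<^esub> \<in> S" and Sa: "\<And>u v. u \<in> S \<Longrightarrow> v \<in> S \<Longrightarrow> u \<oplus>\<^bsub>M\<^esub> v \<in> S"
    and Ss: "\<And>s u. u \<in> S \<Longrightarrow> s \<odot>\<^bsub>M\<^esub> u \<in> S" using S by (auto simp: subspace_of_def)
  \<comment> \<open>The coefficient of f(n) w in the summand of index k; both parts apply when n = 0.\<close>
  define c where "c k = (if k = 0 then l else 0) + (if k = n then l else 0)" for k :: int
  have ef: "\<exists>r\<in>S. normal_ordered M sl2_e k sl2_f (n - k) w = (if k = 0 then l else 0) \<odot>\<^bsub>M\<^esub> ?F n w \<oplus>\<^bsub>M\<^esub> r" for k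
  proof (cases "k < 0")
    case True
    then have "normal_ordered M sl2_e k sl2_f (n - k) w \<in> S" using eS f by (simp add: normal_ordered_def)
    then show ?thesis using True w Sc by (intro bexI) auto
  next
    case False
    then have "normal_ordered M sl2_e k sl2_f (n - k) w = (if k = 0 then l else 0) \<odot>\<^bsub>M\<^esub> ?F n w"
      using e[of k] e0 w by (auto simp: normal_ordered_def act_smult)
    then show ?thesis using w S0 by (intro bexI[of _ "\<zero>\<^bsub>M\<^esub>"]) auto
  qed
  have EF: "?E i (?F j w) = ?F j (?E i w) \<oplus>\<^bsub>M\<^esub> ?H n w" if "i + j = n" "n = 0 \<Longrightarrow> i = 0" for i j
  proof (cases "n = 0")
    case True
    then show ?thesis using commutators(5)[OF w, of i j] that w by simp
  next
    case False
    then show ?thesis using commutators(5)[OF w, of i j] that w by simp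
  qed
  have fe: "\<exists>r\<in>S. normal_ordered M sl2_f k sl2_e (n - k) w = (if k = n then l else 0) \<odot>\<^bsub>M\<^esub> ?F n w \<oplus>\<^bsub>M\<^esub> r" for k
  proof -
    consider "k < 0" "k < n" | "k < 0" "k = n" | "k < 0" "n < k" | "k \<ge> 0" "n < k" | "k \<ge> 0" "k = n" | "k \<ge> 0" "k < n"
      by linarith
    then show ?thesis
    proof cases
      case 1
      then show ?thesis using w S0 e[of "n - k"] by (intro bexI[of _ "\<zero>\<^bsub>M\<^esub>"]) (auto simp: normal_ordered_def)
    next
      case 2
      then show ?thesis using w S0 e0 by (intro bexI[of _ "\<zero>\<^bsub>M\<^esub>"]) (auto simp: normal_ordered_def act_smult)
    next
      case 3
      have "?F k (?E (n - k) w) = ?E (n - k) (?F k w) \<oplus>\<^bsub>M\<^esub> (- 1) \<odot>\<^bsub>M\<^esub> ?H n w"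
        by (rule minus_eq_of_eq_add[OF EF]) (use 3 w in auto)
      then show ?thesis using 3 w f[of k] eS h(1) Sa Ss Sc
        by (intro bexI[of _ "?E (n - k) (?F k w) \<oplus>\<^bsub>M\<^esub> (- 1) \<odot>\<^bsub>M\<^esub> ?H n w"]) (auto simp: normal_ordered_def)
    next
      case 4
      then show ?thesis using w f[of k] eS by (intro bexI[of _ "?E (n - k) (?F k w)"]) (auto simp: normal_ordered_def)
    next
      case 5
      then show ?thesis using w EF[of 0 n] h(1) e0
        by (intro bexI[of _ "?H n w"]) (auto simp: normal_ordered_def act_smult)
    next
      case 6
      then show ?thesis using w EF[of "n - k" k] h(1) e[of "n - k"]
        by (intro bexI[of _ "?H n w"]) (auto simp: normal_ordered_def)
    qed
  qed
  have "\<exists>r\<in>S. sugawara_term n w k = c k \<odot>\<^bsub>M\<^esub> ?F n w \<oplus>\<^bsub>M\<^esub> r" for k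
  proof -
    obtain r where r: "r \<in> S" "normal_ordered M sl2_e k sl2_f (n - k) w = (if k = 0 then l else 0) \<odot>\<^bsub>M\<^esub> ?F n w \<oplus>\<^bsub>M\<^esub> r"
      using ef by blast
    obtain r' where r': "r' \<in> S" "normal_ordered M sl2_f k sl2_e (n - k) w = (if k = n then l else 0) \<odot>\<^bsub>M\<^esub> ?F n w \<oplus>\<^bsub>M\<^esub> r'"
      using fe by blast
    let ?r = "(1/2) \<odot>\<^bsub>M\<^esub> normal_ordered M sl2_h k sl2_h (n - k) w"
    have c: "r \<in> carrier M" "r' \<in> carrier M" "?r \<in> S" "?r \<in> carrier M" using r r' h(2)[of k] Ss Sc by auto
    have "sugawara_term n w k = c k \<odot>\<^bsub>M\<^esub> ?F n w \<oplus>\<^bsub>M\<^esub> (r \<oplus>\<^bsub>M\<^esub> r' \<oplus>\<^bsub>M\<^esub> ?r)"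
      unfolding sugawara_term_def r(2) r'(2) c_def using c w by (simp add: smult_plus add.m_ac)
    then show ?thesis using r(1) r'(1) c(3) Sa by blast
  qed
  then obtain r where r: "r \<in> S" "finsum M (sugawara_term n w) ?K = sum c ?K \<odot>\<^bsub>M\<^esub> ?F n w \<oplus>\<^bsub>M\<^esub> r"
    using finsum_mod_subspace[of ?K S "?F n w" "sugawara_term n w" c] fin S w by auto
  have "sum c ?K = 2 * l"
    unfolding c_def sum.distrib using fin by (simp add: sum.delta)
  moreover have "sugawara M n w = (1/2) \<odot>\<^bsub>M\<^esub> finsum M (sugawara_term n w) ?K"
    by (rule sugawara_eq_finite) (use fin w in auto)
  ultimately have "sugawara M n w = l \<odot>\<^bsub>M\<^esub> ?F n w \<oplus>\<^bsub>M\<^esub> (1/2) \<odot>\<^bsub>M\<^esub> r"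
    using r w Sc by (auto simp: smult_add smult_smult)
  then show ?thesis using r(1) Ss by blast
qed

section \<open>Whittaker vectors\<close>

definition is_whittaker_vector :: "('v, 'z) affine_module_scheme \<Rightarrow> 'v \<Rightarrow> complex \<Rightarrow> complex \<Rightarrow> bool" where
  "is_whittaker_vector M w l mu \<longleftrightarrow> w \<in> carrier M \<and>
     act M (loop sl2_e 0) w = l \<odot>\<^bsub>M\<^esub> w \<and> act M (loop sl2_f 1) w = mu \<odot>\<^bsub>M\<^esub> w \<and>
     act M central w = (- 2) \<odot>\<^bsub>M\<^esub> w \<and>
     (\<forall>i\<ge>1. act M (loop sl2_e i) w = \<zero>\<^bsub>M\<^esub> \<and> act M (loop sl2_h i) w = \<zero>\<^bsub>M\<^esub> \<and> act M (loop sl2_f (i + 1)) w = \<zero>\<^bsub>M\<^esub>)"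

definition generates :: "('v, 'z) affine_module_scheme \<Rightarrow> 'v \<Rightarrow> bool" where
  "generates M w \<longleftrightarrow> (\<forall>H. affine_submodule H M \<longrightarrow> w \<in> H \<longrightarrow> carrier M \<subseteq> H)"

lemma whittaker_vector_hom:
  assumes "affine_mod M" "affine_mod N" "affine_hom M N \<phi>" "is_whittaker_vector M w l mu"
  shows "is_whittaker_vector N (\<phi> w) l mu"
proof -
  note h = affine_homD[OF assms(3)]
  have w: "w \<in> carrier M" using assms(4) by (simp add: is_whittaker_vector_def)
  show ?thesis
    using assms(4) w h(1)[OF w] affine_hom_zero[OF assms(1-3)]
    unfolding is_whittaker_vector_def h(4)[OF w, symmetric] h(3)[OF w, symmetric] by auto
qed

lemma generates_image:
  assumes M: "affine_mod M" and N: "affine_mod N" and \<phi>: "affine_hom M N \<phi>"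
    and surj: "carrier N = \<phi> ` carrier M" and gen: "generates M w" and w: "w \<in> carrier M"
  shows "generates N (\<phi> w)"
  unfolding generates_def
proof (intro allI impI)
  fix H assume H: "affine_submodule H N" "\<phi> w \<in> H"
  interpret M: affine_mod M by fact
  interpret N: affine_mod N by fact
  note h = affine_homD[OF \<phi>] and D = affine_submoduleD[OF N H(1)]
  let ?K = "{v \<in> carrier M. \<phi> v \<in> H}"
  have "affine_submodule ?K M"
    unfolding affine_submodule_def
  proof (intro conjI allI ballI)
    show "submodule ?K complex_field M"
    proof (rule M.submoduleI)
      fix v assume "v \<in> ?K"
      then show "\<ominus>\<^bsub>M\<^esub> v \<in> ?K" using D(4)[of "\<phi> v" "- 1"] by (simp add: h(3)[symmetric] M.smult_neg_1)
    qed (use D in \<open>auto simp: h affine_hom_zero[OF M N \<phi>]\<close>)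
  qed (use D(5) in \<open>auto simp: h\<close>)
  then have "carrier M \<subseteq> ?K" using gen w H(2) by (simp add: generates_def)
  then show "carrier N \<subseteq> H" by (auto simp: surj)
qed

lemma whittaker_sugawara_finite:
  assumes "affine_mod M" "is_whittaker_vector M w l mu"
  shows "finite {k. affine_mod.sugawara_term M n w k \<noteq> \<zero>\<^bsub>M\<^esub>}"
proof -
  interpret affine_mod M by fact
  have W: "w \<in> carrier M" "\<And>i. i \<ge> 1 \<Longrightarrow> act M (loop sl2_e i) w = \<zero>\<^bsub>M\<^esub>"
    "\<And>i. i \<ge> 1 \<Longrightarrow> act M (loop sl2_h i) w = \<zero>\<^bsub>M\<^esub>"
    using assms(2) by (auto simp: is_whittaker_vector_def)
  have f: "act M (loop sl2_f i) w = \<zero>\<^bsub>M\<^esub>" if "i \<ge> 2" for i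
  proof -
    have "i - 1 \<ge> 1" using that by simp
    then have "act M (loop sl2_f (i - 1 + 1)) w = \<zero>\<^bsub>M\<^esub>" using assms(2) unfolding is_whittaker_vector_def by blast
    then show ?thesis by simp
  qed
  have "sugawara_term n w k = \<zero>\<^bsub>M\<^esub>" if "k \<notin> {min 0 (n - 1)..1}" for k
  proof (cases "k < 0")
    case True
    then have "n - k \<ge> 2" using that by auto
    then show ?thesis using True W f by (simp add: sugawara_term_def normal_ordered_def)
  next
    case False
    then have "k \<ge> 2" using that by auto
    then show ?thesis using W f by (simp add: sugawara_term_def normal_ordered_def)
  qed
  then have "{k. sugawara_term n w k \<noteq> \<zero>\<^bsub>M\<^esub>} \<subseteq> {min 0 (n - 1)..1}" by blast
  then show ?thesis by (rule finite_subset) simp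
qed

context
  fixes l :: complex and chi :: "complex fls"
  assumes l: "l \<noteq> 0"
begin

abbreviation (input) Wak where "Wak \<equiv> wak_module l chi"

interpretation P: affine_mod Wak by (rule affine_mod_wak[OF l])

lemma finsum_wak: "finite S \<Longrightarrow> finsum Wak f S = sum f S"
  by (induction S rule: finite_induct) (simp_all add: wak_module_simps[OF l])

lemma sugawara_term_wak:
  "P.sugawara_term n p k = nop_term (wak_e l) (wak_f l chi) n p k + nop_term (wak_f l chi) (wak_e l) n p k
    + pi_const (1/2) * nop_term (wak_h l) (wak_h l) n p k"
  by (simp add: P.sugawara_term_def normal_ordered_def nop_term_def wak_module_simps[OF l] act_wak_basis[OF l])

lemma sugawara_term_wak_finite: "finite {k. P.sugawara_term n p k \<noteq> 0}"
proof -
  note fin = finite_nop_term[OF field_modes_wak(1)[OF l] field_modes_wak(3)[OF l, of chi], of n p]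
    finite_nop_term[OF field_modes_wak(3)[OF l, of chi] field_modes_wak(1)[OF l], of n p]
    finite_nop_term[OF field_modes_wak(2)[OF l] field_modes_wak(2)[OF l], of n p]
  show ?thesis
    by (rule finite_subset[OF _ finite_UnI[OF finite_UnI[OF fin(1,2)] fin(3)]]) (auto simp: sugawara_term_wak)
qed

lemma sugawara_wak: "sugawara Wak n p = pi_const (mode2 chi n) * p"
proof -
  note F = field_modes_wak(1)[OF l] field_modes_wak(2)[OF l] field_modes_wak(3)[OF l, of chi]
  let ?ef = "nop_term (wak_e l) (wak_f l chi) n p" and ?fe = "nop_term (wak_f l chi) (wak_e l) n p"
    and ?hh = "nop_term (wak_h l) (wak_h l) n p"
  have fin: "finite {k. ?ef k \<noteq> 0}" "finite {k. ?fe k \<noteq> 0}" "finite {k. ?hh k \<noteq> 0}" "finite {k. pi_const (1/2) * ?hh k \<noteq> 0}"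
    using finite_nop_term[OF F(1) F(3)] finite_nop_term[OF F(3) F(1)] finite_nop_term[OF F(2) F(2)]
      finite_nonzero_image[OF pi_linear_additive[OF pi_linear_mult] finite_nop_term[OF F(2) F(2)], of "pi_const (1/2)" n p]
    by simp_all
  have term_eq: "P.sugawara_term n p = (\<lambda>k. ?ef k + ?fe k + pi_const (1/2) * ?hh k)"
    by (rule ext) (rule sugawara_term_wak)
  have "Sum_any (P.sugawara_term n p) = Sum_any ?ef + Sum_any ?fe + pi_const (1/2) * Sum_any ?hh"
    unfolding term_eq using fin finite_nonzero_add(1)[OF fin(1,2)] by (simp add: Sum_any.distrib Sum_any_right_distrib)
  also have "\<dots> = 2 * (pi_const (mode2 chi n) * p)"
    using wakimoto_sugawara[OF l, of chi n p] by (simp add: nop_def)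
  finally have "Sum_any (P.sugawara_term n p) = 2 * (pi_const (mode2 chi n) * p)" .
  moreover have "finsum Wak (P.sugawara_term n p) {k. P.sugawara_term n p k \<noteq> \<zero>\<^bsub>Wak\<^esub>} = Sum_any (P.sugawara_term n p)"
    by (simp add: finsum_wak sugawara_term_wak_finite wak_module_simps[OF l] Sum_any.expand_set)
  ultimately show ?thesis
    unfolding P.sugawara_eq using half_of_int[of 1] by (simp add: wak_module_simps[OF l])
qed

lemma wak_e_one: "wak_e l n 1 = pi_const l * exp_mode_int 1 (- n)"
  by (simp add: wak_e_eq[OF l] vertex_mode_one)

text \<open>
  Only the values of \<open>f(n)\<close> at 1 need an argument.  They follow from \<open>T(n) = \<chi>(n)\<close> by descending
  induction: once \<open>f(m)\<close> kills 1 for all \<open>m > n \<ge> 0\<close>, the leading term gives \<open>l f(n) 1 = \<chi>(n)\<close>.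
\<close>
lemma whittaker_vector_wak:
  assumes chi: "\<And>n. n > 1 \<Longrightarrow> mode2 chi n = 0"
  shows "is_whittaker_vector Wak 1 l (mode2 chi 1 / l)"
proof -
  have e: "wak_e l 0 1 = pi_const l" "\<And>i. i \<ge> 1 \<Longrightarrow> wak_e l i 1 = 0"
    by (simp_all add: wak_e_one exp_mode_int_def)
  have h: "wak_h l i 1 = 0" if "i \<ge> 1" for i
    using that by (simp add: wak_h_eq_yop_xop[OF l] xop_one yop_one)
  have zero: "subspace_of {0} Wak" by (simp add: subspace_of_def wak_module_simps[OF l])
  have wh0: "wak_h l i 0 = 0" "wak_e l i 0 = 0" for i
    using pi_linear_simps(4)[OF pi_linear_wak(2)[OF l]] pi_linear_simps(4)[OF pi_linear_wak(1)[OF l]] by auto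
  have lead: "pi_const l * wak_f l chi n 1 = pi_const (mode2 chi n)"
    if n: "n \<ge> 1" and above: "\<And>m. m > n \<Longrightarrow> wak_f l chi m 1 = 0" for n
  proof -
    have "\<exists>r\<in>{0}. sugawara Wak n 1 = l \<odot>\<^bsub>Wak\<^esub> act Wak (loop sl2_f n) 1 \<oplus>\<^bsub>Wak\<^esub> r"
    proof (rule P.sugawara_leading_term[OF _ zero])
      show "normal_ordered Wak sl2_h k sl2_h (n - k) 1 \<in> {0}" for k
      proof -
        consider "k < 0" | "k = 0" | "k > 0" by linarith
        then show ?thesis
        proof cases
          case 2
          have "wak_h l n (wak_h l 0 1) = wak_h l 0 (wak_h l n 1)"
            using wakimoto_commutators(3)[OF l, of n 0 1] n by (simp add: vacuum_modes_def)
          then show ?thesis using 2 n h by (simp add: normal_ordered_def act_wak_basis[OF l] wh0)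
        qed (use n h in \<open>simp_all add: normal_ordered_def act_wak_basis[OF l] wh0\<close>)
      qed
      show "finite {k. P.sugawara_term n 1 k \<noteq> \<zero>\<^bsub>Wak\<^esub>}" using sugawara_term_wak_finite by (simp add: wak_module_simps[OF l])
    qed (use n above e h in \<open>auto simp: act_wak_basis[OF l] wak_module_simps[OF l] wh0\<close>)
    then show ?thesis by (simp add: sugawara_wak wak_module_simps[OF l] act_wak_basis[OF l])
  qed
  obtain N where N: "N \<ge> 0" "\<And>n. n \<ge> N \<Longrightarrow> wak_f l chi n 1 = 0"
    by (rule field_modes_bound[OF field_modes_wak(3)[OF l, of chi], of 1]) blast
  have cancel: "q = pi_const (c / l)" if "pi_const l * q = pi_const c" for q c
    using arg_cong[OF that, of "\<lambda>q. pi_const (1 / l) * q"] l by (simp add: pi_const_mult_eq pi_const_mult[symmetric])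
  have f: "wak_f l chi n 1 = 0" if "n \<ge> 2" for n
    using that
  proof (induction "nat (N - n)" arbitrary: n rule: less_induct)
    case less
    show ?case
    proof (cases "n \<ge> N")
      case True then show ?thesis by (rule N(2))
    next
      case False
      have "wak_f l chi m 1 = 0" if "m > n" for m
        using less.hyps[of m] less.prems that False N(2)[of m] by (cases "m \<ge> N") auto
      then have "pi_const l * wak_f l chi n 1 = pi_const 0"
        using lead[of n] less.prems chi[of n] by simp
      then show ?thesis using cancel[of "wak_f l chi n 1" 0] by simp
    qed
  qed
  have f1: "wak_f l chi 1 1 = pi_const (mode2 chi 1 / l)"
    by (rule cancel, rule lead) (use f in auto)
  show ?thesis
    unfolding is_whittaker_vector_def using e h f f1
    by (simp add: act_wak_basis[OF l] wak_module_simps[OF l])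
qed

section \<open>Free generators adapted to the action\<close>

text \<open>
  The polynomial by which \<open>h(-j)\<close> acts; \<open>x(0)\<close> is \<open>-1\<close>.
\<close>
definition y_mode :: "nat \<Rightarrow> pi_space" where
  "y_mode j = yvar j - (if j = 0 then - 1 else xvar (j - 1))"

text \<open>
  The substitution of the polynomials by which \<open>e(-k-1)\<close> (on polynomials in the \<open>x(-n)\<close>) and \<open>h(-j)\<close>
  act for the variables.
\<close>
definition gen_subst :: "pi_var \<Rightarrow> pi_space" where
  "gen_subst v = (case v of Xvar k \<Rightarrow> pi_const l * exp_mode 1 (Suc k) | Yvar j \<Rightarrow> y_mode j)"

text \<open>
  The values that the inverse substitution must take on the coefficients of the exponential series.
\<close>
definition u_gen :: "nat \<Rightarrow> pi_space" where
  "u_gen j = (if j = 0 then 1 else pi_const (1 / l) * xvar (j - 1))"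

text \<open>
  The recursion \<open>(k + 1) u\<^sub>k\<^sub>+\<^sub>1 = \<Sum>i\<le>k. x(-i-1) u\<^sub>k\<^sub>-\<^sub>i\<close> of the exponential series, solved for its top term
  \<open>x(-k-1)\<close>.
\<close>
fun x_inv :: "nat \<Rightarrow> pi_space" where
  "x_inv k = of_nat (Suc k) * u_gen (Suc k) - (\<Sum>i<k. x_inv i * u_gen (k - i))"

declare x_inv.simps [simp del]

definition gen_subst_inv :: "pi_var \<Rightarrow> pi_space" where
  "gen_subst_inv v = (case v of Xvar k \<Rightarrow> x_inv k | Yvar j \<Rightarrow> yvar j + (if j = 0 then - 1 else x_inv (j - 1)))"

lemma gen_subst_simps [simp]:
  "gen_subst (Xvar k) = pi_const l * exp_mode 1 (Suc k)" "gen_subst (Yvar j) = y_mode j"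
  "gen_subst_inv (Xvar k) = x_inv k" "gen_subst_inv (Yvar j) = yvar j + (if j = 0 then - 1 else x_inv (j - 1))"
  by (simp_all add: gen_subst_def gen_subst_inv_def)

lemma subst_inv_exp_mode: "pi_subst gen_subst_inv (exp_mode 1 j) = u_gen j"
proof (induction j rule: less_induct)
  case (less j)
  note L = pi_linear_simps[OF pi_linear_subst]
  show ?case
  proof (cases j)
    case 0 then show ?thesis by (simp add: u_gen_def)
  next
    case (Suc n)
    have "of_nat (Suc n) * pi_subst gen_subst_inv (exp_mode 1 (Suc n)) = pi_subst gen_subst_inv (\<Sum>k\<le>n. xvar k * exp_mode 1 (n - k))"
      using arg_cong[OF exp_mode_Suc_rec[of n 1], of "pi_subst gen_subst_inv"] by (simp only: L of_int_1 mult_1)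
    also have "\<dots> = (\<Sum>k\<le>n. x_inv k * u_gen (n - k))"
      unfolding L by (intro sum.cong refl) (simp add: pi_subst_mult less Suc)
    also have "\<dots> = (\<Sum>k<n. x_inv k * u_gen (n - k)) + x_inv n * u_gen 0"
      by (simp add: lessThan_Suc_atMost[symmetric])
    also have "\<dots> = of_nat (Suc n) * u_gen (Suc n)"
      unfolding x_inv.simps[of n] by (simp add: u_gen_def)
    finally show ?thesis unfolding Suc by (rule of_nat_mult_cancel_pi)
  qed
qed

lemma subst_u_gen: "pi_subst gen_subst (u_gen j) = exp_mode 1 j"
proof (cases j)
  case 0 then show ?thesis by (simp add: u_gen_def)
next
  case (Suc n)
  then show ?thesis using l by (simp add: u_gen_def pi_subst_mult pi_const_mult_eq)
qed

lemma subst_x_inv: "pi_subst gen_subst (x_inv k) = xvar k"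
proof (induction k rule: less_induct)
  case (less k)
  note L = pi_linear_simps[OF pi_linear_subst]
  have "pi_subst gen_subst (x_inv k) = of_nat (Suc k) * exp_mode 1 (Suc k) - (\<Sum>i<k. xvar i * exp_mode 1 (k - i))"
    unfolding x_inv.simps[of k] L by (simp add: pi_subst_mult subst_u_gen less)
  also have "\<dots> = xvar k"
    unfolding exp_mode_Suc_rec by (simp add: lessThan_Suc_atMost[symmetric])
  finally show ?case .
qed

text \<open>
  The coefficient of \<open>z\<^sup>k\<close> in the exponential series is \<open>x(-k) / k\<close> plus a polynomial in \<open>x(-1), \<dots>, x(-k+1)\<close>,
  so the substitution is triangular.
\<close>
lemma gen_subst_inverse:
  "pi_subst gen_subst_inv (pi_subst gen_subst p) = p"
  "pi_subst gen_subst (pi_subst gen_subst_inv p) = p"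
proof -
  note L = pi_linear_simps[OF pi_linear_subst]
  show "pi_subst gen_subst_inv (pi_subst gen_subst p) = p"
  proof (induction p rule: pi_space_induct)
    case (var v p)
    have "pi_subst gen_subst_inv (gen_subst v) = pi_of_var v"
      using l by (cases v) (simp_all add: pi_subst_mult subst_inv_exp_mode u_gen_def pi_const_mult_eq y_mode_def L(2,3))
    then show ?case using var by (simp add: pi_subst_mult)
  qed (simp_all add: L(1,5))
  show "pi_subst gen_subst (pi_subst gen_subst_inv p) = p"
  proof (induction p rule: pi_space_induct)
    case (var v p)
    have "pi_subst gen_subst (gen_subst_inv v) = pi_of_var v"
      by (cases v) (simp_all add: subst_x_inv L(1,3) y_mode_def)
    then show ?case using var by (simp add: pi_subst_mult)
  qed (simp_all add: L(1,5))
qed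

end

hide_const (open) Wak

section \<open>A spanning set of the Whittaker quotient\<close>

definition monomial_of :: "nat list \<Rightarrow> nat list \<Rightarrow> pi_var \<Rightarrow>\<^sub>0 nat" where
  "monomial_of xs ys = (\<Sum>i\<leftarrow>xs. Poly_Mapping.single (Xvar i) 1) + (\<Sum>j\<leftarrow>ys. Poly_Mapping.single (Yvar j) 1)"

lemma monomial_of_Cons:
  "monomial_of (i # xs) ys = Poly_Mapping.single (Xvar i) 1 + monomial_of xs ys"
  "monomial_of xs (j # ys) = Poly_Mapping.single (Yvar j) 1 + monomial_of xs ys"
  by (simp_all add: monomial_of_def add_ac)

lemma monomial_of_Nil: "monomial_of [] [] = 0"
  by (simp add: monomial_of_def)

lemma lookup_monomial_of:
  "Poly_Mapping.lookup (monomial_of xs ys) (Xvar i) = count_list xs i"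
  "Poly_Mapping.lookup (monomial_of xs ys) (Yvar i) = count_list ys i"
proof -
  have "Poly_Mapping.lookup (\<Sum>i\<leftarrow>xs. Poly_Mapping.single (f i) (1::nat)) v = count_list (map f xs) v" for f and xs :: "nat list" and v :: pi_var
    by (induction xs) (simp_all add: lookup_add lookup_single when_def)
  moreover have "count_list (map Xvar xs) (Xvar i) = count_list xs i" "count_list (map Yvar xs) (Yvar i) = count_list xs i"
    "count_list (map Xvar xs) (Yvar i) = 0" "count_list (map Yvar xs) (Xvar i) = 0" for xs
    by (induction xs) simp_all
  ultimately show "Poly_Mapping.lookup (monomial_of xs ys) (Xvar i) = count_list xs i"
    "Poly_Mapping.lookup (monomial_of xs ys) (Yvar i) = count_list ys i"
    by (simp_all add: monomial_of_def lookup_add)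
qed

lemma monomial_of_eqD:
  assumes "monomial_of xs ys = monomial_of xs' ys'"
  shows "mset xs = mset xs'" "mset ys = mset ys'"
  using lookup_monomial_of(1)[of xs ys] lookup_monomial_of(1)[of xs' ys']
    lookup_monomial_of(2)[of xs ys] lookup_monomial_of(2)[of xs' ys'] assms
  by (auto intro!: multiset_eqI simp: count_mset)

lemma monomial_of_surj: "\<exists>xs ys. monomial_of xs ys = t"
proof (induction t rule: pi_monomial_induct)
  case zero show ?case using monomial_of_Nil by blast
next
  case (var v t)
  then obtain xs ys where "monomial_of xs ys = t" by blast
  then show ?case
    by (cases v) (use monomial_of_Cons(1)[of _ xs ys] monomial_of_Cons(2)[of xs _ ys] in blast)+
qed

text \<open>
  Products of commuting operators on a set that is closed under them.
\<close>
lemma foldr_permute: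
  assumes closed: "\<And>k v. v \<in> C \<Longrightarrow> T k v \<in> C"
    and comm: "\<And>i j v. v \<in> C \<Longrightarrow> T i (T j v) = T j (T i v)"
    and v: "v \<in> C" and "mset xs = mset ys"
  shows "foldr T xs v = foldr T ys v"
  using assms(4)
proof (induction xs arbitrary: ys)
  case Nil then show ?case by simp
next
  case (Cons x xs)
  have carr: "foldr T zs v \<in> C" for zs by (induction zs) (simp_all add: v closed)
  have move: "x \<in> set zs \<Longrightarrow> foldr T zs v = T x (foldr T (remove1 x zs) v)" for zs
    by (induction zs) (auto simp: comm[OF carr])
  have "x \<in> set ys" using Cons.prems by (metis list.set_intros(1) set_mset_mset)
  moreover have "mset xs = mset (remove1 x ys)" using Cons.prems by (metis add_mset_remove_trivial mset.simps(2) mset_remove1)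
  ultimately show ?case using Cons.IH[of "remove1 x ys"] move[of ys] by simp
qed

text \<open>
  The properties of \<open>V(\<lambda>, \<mu>, -2, c(z))\<close> on which the rest of the proof depends.
\<close>
locale whittaker_module_data = affine_mod M
  for M :: "('v, 'z) affine_module_scheme" (structure) +
  fixes w l mu and chi :: "complex fls"
  assumes l: "l \<noteq> 0"
    and w: "is_whittaker_vector M w l mu"
    and gen: "generates M w"
    and T: "\<And>n. n \<le> 0 \<Longrightarrow> sugawara M n w = mode2 chi n \<odot>\<^bsub>M\<^esub> w"
begin

abbreviation (input) E where "E n \<equiv> act M (loop sl2_e n)"
abbreviation (input) F where "F n \<equiv> act M (loop sl2_f n)"
abbreviation (input) H where "H n \<equiv> act M (loop sl2_h n)"

lemma w_rules:
  "w \<in> carrier M" "E 0 w = l \<odot>\<^bsub>M\<^esub> w" "F 1 w = mu \<odot>\<^bsub>M\<^esub> w" "act M central w = (- 2) \<odot>\<^bsub>M\<^esub> w"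
  "i \<ge> 1 \<Longrightarrow> E i w = \<zero>\<^bsub>M\<^esub>" "i \<ge> 1 \<Longrightarrow> H i w = \<zero>\<^bsub>M\<^esub>" "i \<ge> 2 \<Longrightarrow> F i w = \<zero>\<^bsub>M\<^esub>"
proof -
  show "i \<ge> 2 \<Longrightarrow> F i w = \<zero>\<^bsub>M\<^esub>"
  proof -
    assume "i \<ge> 2"
    then have "i - 1 \<ge> 1" by simp
    then have "F (i - 1 + 1) w = \<zero>\<^bsub>M\<^esub>" using w unfolding is_whittaker_vector_def by blast
    then show ?thesis by simp
  qed
qed (use w in \<open>auto simp: is_whittaker_vector_def\<close>)

lemma central_act: "v \<in> carrier M \<Longrightarrow> act M central v = (- 2) \<odot>\<^bsub>M\<^esub> v"
proof -
  let ?K = "{v \<in> carrier M. act M central v = (- 2) \<odot>\<^bsub>M\<^esub> v}"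
  have comm: "act M central (act M x v) = act M x (act M central v)" if "v \<in> carrier M" for x v
  proof -
    have "act M central (act M x v) \<ominus>\<^bsub>M\<^esub> act M x (act M central v) = \<zero>\<^bsub>M\<^esub>"
      using act_bracket[OF that, of central x] that by (simp add: affine_bracket_central act_0)
    from eq_add_of_minus_eq[OF this] show ?thesis using that by simp
  qed
  have "affine_submodule ?K M"
    unfolding affine_submodule_def
  proof (intro conjI allI ballI)
    show "submodule ?K complex_field M"
    proof (rule submoduleI)
      fix v assume "v \<in> ?K"
      then show "\<ominus>\<^bsub>M\<^esub> v \<in> ?K"
        unfolding smult_neg_1[symmetric, of v] by (auto simp: smult_neg_1[symmetric] act_smult smult_smult)
    qed (auto simp: act_add smult_add act_smult smult_smult mult.commute)
  qed (auto simp: comm act_smult)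
  then have "carrier M \<subseteq> ?K" using gen w_rules by (simp add: generates_def)
  then show "v \<in> carrier M \<Longrightarrow> act M central v = (- 2) \<odot>\<^bsub>M\<^esub> v" by blast
qed

definition e_word :: "nat list \<Rightarrow> 'v" where
  "e_word xs = foldr (\<lambda>k. E (- int k - 1)) xs w"

definition h_word :: "nat list \<Rightarrow> 'v \<Rightarrow> 'v" where
  "h_word ys v = foldr (\<lambda>j. H (- int j)) ys v"

lemma words_closed [simp]: "e_word xs \<in> carrier M" "v \<in> carrier M \<Longrightarrow> h_word ys v \<in> carrier M"
proof -
  show "e_word xs \<in> carrier M" by (induction xs) (simp_all add: e_word_def w_rules)
  show "v \<in> carrier M \<Longrightarrow> h_word ys v \<in> carrier M" by (induction ys) (simp_all add: h_word_def)
qed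

lemma words_simps [simp]:
  "e_word [] = w" "e_word (k # xs) = E (- int k - 1) (e_word xs)"
  "h_word [] v = v" "h_word (j # ys) v = H (- int j) (h_word ys v)"
  by (simp_all add: e_word_def h_word_def)

text \<open>
  The span of the vectors \<open>h(-j\<^sub>1) \<dots> h(-j\<^sub>s) e(-k\<^sub>1-1) \<dots> e(-k\<^sub>r-1) w\<close>.
\<close>
inductive_set R :: "'v set" where
  word: "h_word ys (e_word xs) \<in> R"
| add: "u \<in> R \<Longrightarrow> v \<in> R \<Longrightarrow> u \<oplus>\<^bsub>M\<^esub> v \<in> R"
| smult: "u \<in> R \<Longrightarrow> s \<odot>\<^bsub>M\<^esub> u \<in> R"

lemma R_carrier: "v \<in> R \<Longrightarrow> v \<in> carrier M"
  by (induction rule: R.induct) simp_all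

lemma R_zero: "\<zero>\<^bsub>M\<^esub> \<in> R"
  using R.smult[OF R.word[of "[]" "[]"], of 0] w_rules(1) by simp

lemma R_act:
  assumes "\<And>xs ys. act M x (h_word ys (e_word xs)) \<in> R" and "v \<in> R"
  shows "act M x v \<in> R"
  using assms(2)
proof (induction rule: R.induct)
  case (add u v) then show ?case by (simp add: act_add R_carrier R.add)
next
  case (smult u s) then show ?case by (simp add: act_smult R_carrier R.smult)
qed (rule assms(1))

lemma R_H_neg: "v \<in> R \<Longrightarrow> H (- int j) v \<in> R"
  by (rule R_act) (use R.word[of "j # _"] in simp)

lemma EH: "v \<in> carrier M \<Longrightarrow> E n (H m v) = H m (E n v) \<oplus>\<^bsub>M\<^esub> (- 2) \<odot>\<^bsub>M\<^esub> E (n + m) v"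
  using minus_eq_of_eq_add[OF commutators(2)[of v m n]] by (simp add: smult_smult add.commute)

lemma FH: "v \<in> carrier M \<Longrightarrow> F n (H m v) = H m (F n v) \<oplus>\<^bsub>M\<^esub> 2 \<odot>\<^bsub>M\<^esub> F (n + m) v"
  using minus_eq_of_eq_add[OF commutators(3)[of v m n]] by (simp add: smult_smult add.commute)

lemma FE: "v \<in> carrier M \<Longrightarrow> F n (E m v) = E m (F n v) \<oplus>\<^bsub>M\<^esub> (- 1) \<odot>\<^bsub>M\<^esub> (H (n + m) v
    \<oplus>\<^bsub>M\<^esub> (if n + m = 0 then - 2 * of_int m else 0) \<odot>\<^bsub>M\<^esub> v)"
  using minus_eq_of_eq_add[OF commutators(5)[of v m n]]
  by (auto simp: central_act smult_smult add.commute mult.commute)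

lemma E_e_word: "E n (e_word xs) \<in> R"
proof (cases "n < 0")
  case True
  then have "n = - int (nat (- n - 1)) - 1" by simp
  then have "E n (e_word xs) = h_word [] (e_word (nat (- n - 1) # xs))" by simp
  then show ?thesis using R.word by metis
next
  case False
  have "E n (e_word xs) = (if n = 0 then l else 0) \<odot>\<^bsub>M\<^esub> e_word xs"
  proof (induction xs)
    case Nil then show ?case using w_rules False by simp
  next
    case (Cons k xs)
    then show ?case by (simp only: words_simps commutators(1)[of "e_word xs" n] words_closed act_smult)
  qed
  then show ?thesis using R.smult[OF R.word[of "[]" xs]] by simp
qed

text \<open>
  Moving \<open>e(n)\<close> past the modes of \<open>h\<close> produces further modes of \<open>e\<close>, so the induction is over the
  \<open>h\<close>-word for all \<open>n\<close> at once.  The modes of \<open>h\<close> and \<open>f\<close> are treated in the same way.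
\<close>
lemma R_E: "v \<in> R \<Longrightarrow> E n v \<in> R"
proof (rule R_act)
  fix xs ys show "E n (h_word ys (e_word xs)) \<in> R"
  proof (induction ys arbitrary: n)
    case Nil then show ?case by (simp add: E_e_word)
  next
    case (Cons j ys)
    then show ?case by (simp add: EH R.add R.smult R_H_neg)
  qed
qed

lemma H_e_word: "n > 0 \<Longrightarrow> H n (e_word xs) \<in> R"
proof (induction xs)
  case Nil then show ?case using w_rules R_zero by simp
next
  case (Cons k xs)
  have "e_word xs \<in> R" using R.word[of "[]" xs] by simp
  then show ?case using Cons by (simp add: commutators(2) R.add R.smult R_E)
qed

lemma R_H: "v \<in> R \<Longrightarrow> H n v \<in> R"
proof (cases "n > 0")
  case True
  assume "v \<in> R"
  then show ?thesis
  proof (rule R_act[rotated])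
    fix xs ys show "H n (h_word ys (e_word xs)) \<in> R"
    proof (induction ys)
      case Nil then show ?case using True by (simp add: H_e_word)
    next
      case (Cons j ys)
      then show ?case
        using R.word[of ys xs]
        by (simp only: words_simps commutators(4)[of "h_word ys (e_word xs)" n] words_closed central_act R.add R.smult R_H_neg)
    qed
  qed
next
  case False
  then have "n = - int (nat (- n))" by simp
  then show "v \<in> R \<Longrightarrow> H n v \<in> R" using R_H_neg[of v "nat (- n)"] by simp
qed

lemma subspace_R: "subspace_of R M"
  using R_carrier R_zero R.add R.smult by (auto simp: subspace_of_def)

lemma w_R: "w \<in> R"
  using R.word[of "[]" "[]"] by simp

text \<open>
  For \<open>n \<le> 0\<close> the relation \<open>T(n) w = c\<^sub>n w\<close> expresses \<open>\<lambda> f(n) w\<close> by vectors that are already in the span.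
\<close>
lemma F_w: "F n w \<in> R"
proof (induction "nat (2 - n)" arbitrary: n rule: less_induct)
  case less
  show ?case
  proof (cases "n \<ge> 1")
    case True
    then consider "n = 1" | "n \<ge> 2" by linarith
    then show ?thesis by cases (use w_rules w_R R.smult R_zero in auto)
  next
    case False
    have above: "F m w \<in> R" if "m > n" for m
    proof (cases "m \<ge> 2")
      case True then show ?thesis using w_rules R_zero by simp
    next
      case False
      then show ?thesis using less[of m] that by simp
    qed
    have "\<exists>r\<in>R. sugawara M n w = l \<odot>\<^bsub>M\<^esub> F n w \<oplus>\<^bsub>M\<^esub> r"
    proof (rule sugawara_leading_term[OF w_rules(1) subspace_R w_rules(2)])
      show "normal_ordered M sl2_h k sl2_h (n - k) w \<in> R" for k
        using R_H w_R by (simp add: normal_ordered_def)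
      show "finite {k. sugawara_term n w k \<noteq> \<zero>\<^bsub>M\<^esub>}"
        by (rule whittaker_sugawara_finite[OF affine_mod_axioms w])
    qed (use above R_E R_H w_R w_rules in auto)
    then obtain r where r: "r \<in> R" "mode2 chi n \<odot>\<^bsub>M\<^esub> w = l \<odot>\<^bsub>M\<^esub> F n w \<oplus>\<^bsub>M\<^esub> r"
      using T[of n] False by auto
    have "l \<odot>\<^bsub>M\<^esub> F n w = mode2 chi n \<odot>\<^bsub>M\<^esub> w \<oplus>\<^bsub>M\<^esub> (- 1) \<odot>\<^bsub>M\<^esub> r"
      by (rule minus_eq_of_eq_add[OF r(2)]) (use r(1) R_carrier w_rules in auto)
    then have "l \<odot>\<^bsub>M\<^esub> F n w \<in> R" using r(1) w_R R.add R.smult by simp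
    then have "(1 / l) \<odot>\<^bsub>M\<^esub> (l \<odot>\<^bsub>M\<^esub> F n w) \<in> R" by (rule R.smult)
    then show ?thesis using l w_rules(1) by (simp add: smult_smult)
  qed
qed

lemma R_F: "v \<in> R \<Longrightarrow> F n v \<in> R"
proof (rule R_act)
  fix xs ys
  have "F n (e_word xs) \<in> R" for n
  proof (induction xs arbitrary: n)
    case Nil then show ?case by (simp add: F_w)
  next
    case (Cons k xs)
    then show ?case using R.word[of "[]" xs] by (simp add: FE R.add R.smult R_E R_H)
  qed
  then show "F n (h_word ys (e_word xs)) \<in> R"
  proof (induction ys arbitrary: n)
    case (Cons j ys)
    then show ?case by (simp add: FH R.add R.smult R_H_neg)
  qed simp
qed

lemma R_eq_carrier: "R = carrier M"
proof -
  have "act M x v \<in> R" if v: "v \<in> R" for x v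
  proof (rule affine_decompose[of "\<lambda>x. act M x v \<in> R"])
    show "act M 0 v \<in> R" using v by (simp add: act_0 R_carrier R_zero)
    show "act M (x + y) v \<in> R" if "act M x v \<in> R" "act M y v \<in> R" for x y
      using that v by (simp add: act_plus R_carrier R.add)
    show "act M (affine_scale s x) v \<in> R" if "act M x v \<in> R" for s x
      using that v by (simp add: act_scale R_carrier R.smult)
    show "act M central v \<in> R" using v by (simp add: central_act R_carrier R.smult)
  qed (use v R_E R_F R_H in auto)
  moreover have "submodule R complex_field M"
  proof (rule submoduleI)
    fix v assume "v \<in> R"
    then show "\<ominus>\<^bsub>M\<^esub> v \<in> R" using R.smult[of v "- 1"] by (simp add: smult_neg_1 R_carrier)
  qed (auto simp: R_carrier R_zero R.add R.smult)
  ultimately have "affine_submodule R M" by (simp add: affine_submodule_def)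
  then show ?thesis using gen w_R R_carrier by (auto simp: generates_def)
qed

lemma words_permute:
  assumes "mset xs = mset xs'" "mset ys = mset ys'"
  shows "h_word ys (e_word xs) = h_word ys' (e_word xs')"
proof -
  have "e_word xs = e_word xs'"
    unfolding e_word_def
    by (rule foldr_permute[of "carrier M"]) (simp_all only: act_closed commutators(1) w_rules(1) assms(1))
  moreover have comm: "H (- int i) (H (- int j) v) = H (- int j) (H (- int i) v)" if "v \<in> carrier M" for i j v
    using commutators(4)[OF that, of "- int i" "- int j"] that by (cases "i = j") (auto split: if_splits)
  have "h_word ys v = h_word ys' v" if "v \<in> carrier M" for v
    unfolding h_word_def
    by (rule foldr_permute[of "carrier M"]) (use that comm assms(2) in \<open>simp_all only: act_closed\<close>)
  ultimately show ?thesis by simp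
qed

text \<open>
  The word that belongs to a monomial; by \<open>words_permute\<close> the choice of the order is immaterial.
\<close>
definition basis_vector :: "(pi_var \<Rightarrow>\<^sub>0 nat) \<Rightarrow> 'v" where
  "basis_vector t = (let p = SOME p. monomial_of (fst p) (snd p) = t in h_word (snd p) (e_word (fst p)))"

lemma basis_vector_monomial: "basis_vector (monomial_of xs ys) = h_word ys (e_word xs)"
proof -
  define p where "p = (SOME p. monomial_of (fst p) (snd p) = monomial_of xs ys)"
  have "monomial_of (fst p) (snd p) = monomial_of xs ys"
    unfolding p_def by (rule someI[of _ "(xs, ys)"]) simp
  from words_permute[OF monomial_of_eqD[OF this]] show ?thesis
    by (simp only: basis_vector_def Let_def p_def[symmetric])
qed

lemma basis_vector_closed [simp]: "basis_vector t \<in> carrier M"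
  using monomial_of_surj[of t] basis_vector_monomial by force

text \<open>
  The linear map from polynomials onto the module that sends each monomial to its word.
\<close>
definition combination :: "pi_space \<Rightarrow> 'v" where
  "combination p = finsum M (\<lambda>t. Poly_Mapping.lookup p t \<odot>\<^bsub>M\<^esub> basis_vector t) (Poly_Mapping.keys p)"

lemma combination_superset:
  assumes "finite S" "Poly_Mapping.keys p \<subseteq> S"
  shows "combination p = finsum M (\<lambda>t. Poly_Mapping.lookup p t \<odot>\<^bsub>M\<^esub> basis_vector t) S"
  unfolding combination_def
  by (rule M.add.finprod_mono_neutral_cong_left) (use assms in \<open>auto simp: in_keys_iff\<close>)

lemma combination_add: "combination (p + q) = combination p \<oplus>\<^bsub>M\<^esub> combination q"
proof -
  let ?S = "Poly_Mapping.keys p \<union> Poly_Mapping.keys q"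
  have "combination r = finsum M (\<lambda>t. Poly_Mapping.lookup r t \<odot>\<^bsub>M\<^esub> basis_vector t) ?S" if "Poly_Mapping.keys r \<subseteq> ?S" for r
    by (rule combination_superset) (use that in auto)
  then show ?thesis
    using keys_add[of p q] by (simp add: lookup_add smult_plus M.finsum_addf)
qed

lemma combination_single: "combination (Poly_Mapping.single t c) = c \<odot>\<^bsub>M\<^esub> basis_vector t"
  using combination_superset[of "{t}" "Poly_Mapping.single t c"] by simp

lemma combination_closed [simp]: "combination p \<in> carrier M"
  unfolding combination_def by (rule M.finsum_closed) auto

lemma combination_smult: "combination (pi_const s * p) = s \<odot>\<^bsub>M\<^esub> combination p"
proof (induction p rule: poly_mapping_single_add_induct)
  case zero then show ?case using combination_single[of 0 0] by simp
next
  case (single t c) then show ?case by (simp add: pi_const_def mult_single combination_single smult_smult)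
next
  case (add p q) then show ?case by (simp add: distrib_left combination_add smult_add)
qed

lemma combination_surj: "v \<in> carrier M \<Longrightarrow> \<exists>p. v = combination p"
  unfolding R_eq_carrier[symmetric]
proof (induction rule: R.induct)
  case (word ys xs)
  have "h_word ys (e_word xs) = combination (Poly_Mapping.single (monomial_of xs ys) 1)"
    by (simp add: combination_single basis_vector_monomial)
  then show ?case by blast
next
  case (add u v) then show ?case using combination_add by metis
next
  case (smult u s) then show ?case using combination_smult by metis
qed

section \<open>The isomorphism\<close>

context
  fixes \<phi> and chi' :: "complex fls"
  assumes \<phi>: "affine_hom M (wak_module l chi') \<phi>" and \<phi>_w: "\<phi> w = 1"
begin

interpretation P: affine_mod "wak_module l chi'" by (rule affine_mod_wak[OF l])

lemmas \<phi>_hom = affine_homD[OF \<phi>]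

text \<open>
  The image of an \<open>e\<close>-word is a polynomial in the \<open>x(-n)\<close>, so every vertex operator commutes with
  multiplication by it; in particular \<open>e(-k-1)\<close> multiplies it by the value at 1.
\<close>
lemma vertex_mode_e_word: "vertex_mode l m n (\<phi> (e_word xs) * p) = \<phi> (e_word xs) * vertex_mode l m n p
  \<and> \<phi> (e_word xs) = pi_subst (gen_subst l) (Poly_Mapping.single (monomial_of xs []) 1)"
proof (induction xs arbitrary: p m n)
  case Nil then show ?case by (simp add: \<phi>_w monomial_of_Nil)
next
  case (Cons k xs)
  have "\<phi> (e_word (k # xs)) = vertex_mode l 1 (- int k - 1) (\<phi> (e_word xs) * 1)"
    by (simp add: \<phi>_hom act_wak_basis[OF l] wak_e_eq[OF l])
  also have "\<dots> = \<phi> (e_word xs) * vertex_mode l 1 (- int k - 1) 1" using Cons by blast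
  also have "\<dots> = pi_const l * (exp_mode 1 (Suc k) * \<phi> (e_word xs))"
  proof -
    have "exp_mode_int 1 (- (- int k - 1)) = exp_mode 1 (Suc k)"
      by (simp add: exp_mode_int_def nat_add_distrib)
    then show ?thesis by (simp only: vertex_mode_one power_int_1_right mult_ac)
  qed
  finally have eq: "\<phi> (e_word (k # xs)) = pi_const l * (exp_mode 1 (Suc k) * \<phi> (e_word xs))" .
  have single: "Poly_Mapping.single (monomial_of (k # xs) []) 1 = xvar k * (Poly_Mapping.single (monomial_of xs []) 1 :: pi_space)"
    by (simp add: monomial_of_Cons pi_of_var_def mult_single)
  have IH: "\<And>m n p. vertex_mode l m n (\<phi> (e_word xs) * p) = \<phi> (e_word xs) * vertex_mode l m n p"
    "\<phi> (e_word xs) = pi_subst (gen_subst l) (Poly_Mapping.single (monomial_of xs []) 1)"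
    using Cons by blast+
  show ?case
  proof (intro conjI)
    show "vertex_mode l m n (\<phi> (e_word (k # xs)) * p) = \<phi> (e_word (k # xs)) * vertex_mode l m n p"
      unfolding eq by (simp add: mult.assoc pi_linear_simps(5)[OF pi_linear_vertex_mode] vertex_mode_exp_mode IH(1))
    show "\<phi> (e_word (k # xs)) = pi_subst (gen_subst l) (Poly_Mapping.single (monomial_of (k # xs) []) 1)"
      unfolding eq single pi_subst_mult IH(2) by (simp add: mult.assoc gen_subst_simps[OF l])
  qed
qed

lemma \<phi>_word: "\<phi> (h_word ys (e_word xs)) = pi_subst (gen_subst l) (Poly_Mapping.single (monomial_of xs ys) 1)"
proof (induction ys)
  case Nil then show ?case using vertex_mode_e_word by simp
next
  case (Cons j ys)
  have single: "Poly_Mapping.single (monomial_of xs (j # ys)) 1 = yvar j * (Poly_Mapping.single (monomial_of xs ys) 1 :: pi_space)"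
    by (simp add: monomial_of_Cons pi_of_var_def mult_single)
  have y: "wak_h l (- int j) q = y_mode j * q" for q
  proof -
    have "wak_h l (- int j) q = yvar j * q - xop (- int j) q"
      by (simp add: wak_h_eq_yop_xop[OF l] yop_nonpos)
    also have "xop (- int j) q = (if j = 0 then - 1 else xvar (j - 1)) * q"
      using xop_neg[of "j - 1" q] by (cases j) (simp_all add: xop_zero)
    finally show ?thesis by (simp only: y_mode_def[OF l] left_diff_distrib)
  qed
  show ?case
    unfolding single pi_subst_mult using Cons by (simp add: \<phi>_hom act_wak_basis[OF l] y gen_subst_simps[OF l])
qed

lemma \<phi>_combination: "\<phi> (combination p) = pi_subst (gen_subst l) p"
proof (induction p rule: poly_mapping_single_add_induct)
  case zero
  then show ?case
    using combination_single[of 0 0] affine_hom_zero[OF affine_mod_axioms P.affine_mod_axioms \<phi>]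
    by (simp add: pi_linear_simps[OF pi_linear_subst] wak_module_simps[OF l])
next
  case (single t c)
  obtain xs ys where t: "t = monomial_of xs ys" using monomial_of_surj by metis
  have "pi_subst (gen_subst l) (Poly_Mapping.single t c) = pi_const c * pi_subst (gen_subst l) (Poly_Mapping.single t 1)"
    by (subst single_eq_pi_const_mult) (rule pi_linear_simps(5)[OF pi_linear_subst])
  then show ?case
    by (simp add: combination_single \<phi>_hom t basis_vector_monomial \<phi>_word wak_module_simps[OF l])
next
  case (add p q)
  then show ?case by (simp add: combination_add \<phi>_hom wak_module_simps[OF l] pi_subst_add)
qed

text \<open>
  The composition of the surjection from polynomials with \<open>\<phi>\<close> is an invertible substitution, so both
  maps are bijective.
\<close>
lemma \<phi>_bij: "bij_betw \<phi> (carrier M) UNIV"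
proof (rule bij_betwI')
  fix u v assume "u \<in> carrier M" "v \<in> carrier M"
  then obtain p q where uv: "u = combination p" "v = combination q" using combination_surj by metis
  show "(\<phi> u = \<phi> v) = (u = v)"
  proof
    assume "\<phi> u = \<phi> v"
    then have "pi_subst (gen_subst_inv l) (pi_subst (gen_subst l) p) = pi_subst (gen_subst_inv l) (pi_subst (gen_subst l) q)"
      by (simp add: uv \<phi>_combination)
    then show "u = v" by (simp add: uv gen_subst_inverse(1)[OF l])
  qed simp
next
  fix p show "\<exists>v\<in>carrier M. p = \<phi> v"
    using gen_subst_inverse(2)[OF l, of p] \<phi>_combination[of "pi_subst (gen_subst_inv l) p"]
    by (intro bexI[of _ "combination (pi_subst (gen_subst_inv l) p)"]) simp_all
qed simp

end

end

lemma left_ideal_gen: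
  assumes "ring A" and "S \<subseteq> carrier A"
  shows "left_ideal (left_ideal_gen A S) A"
proof -
  interpret ring A by fact
  have "left_ideal (carrier A) A"
    by (auto simp: left_ideal_def additive_subgroup_def intro!: add.subgroup_self)
  then have ne: "{J. left_ideal J A \<and> S \<subseteq> J} \<noteq> {}" using assms(2) by blast
  have "subgroup (\<Inter>{J. left_ideal J A \<and> S \<subseteq> J}) (add_monoid A)"
    by (rule add.subgroups_Inter) (use ne in \<open>auto simp: left_ideal_def additive_subgroup_def\<close>)
  then show ?thesis
    by (auto simp: left_ideal_gen_def left_ideal_def additive_subgroup_def)
qed

lemma subgroup_uea_iff: "subgroup K (add_monoid uea_module) \<longleftrightarrow> subgroup K (add_monoid uea)"
  by (simp add: subgroup_def m_inv_def uea_module_def)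

text \<open>
  Scalars and elements of the Lie algebra act on the regular module by left multiplication.
\<close>
lemma left_ideal_uea_submodule:
  assumes "left_ideal K uea"
  shows "affine_submodule K uea_module"
proof -
  have mult: "act uea_module x u = uea_gen x \<otimes>\<^bsub>uea\<^esub> u" "s \<odot>\<^bsub>uea_module\<^esub> u = uea_scalar s \<otimes>\<^bsub>uea\<^esub> u" for x s u
    by (simp_all add: uea_module_def)
  have in_uea: "uea_gen x \<in> carrier uea" "uea_scalar s \<in> carrier uea" for x s
    by (simp_all add: uea_gen_eq uea_scalar_eq uea_of_simps)
  show ?thesis
    unfolding affine_submodule_def submodule_def submodule_axioms_def subgroup_uea_iff
    using assms in_uea by (auto simp: left_ideal_def additive_subgroup_def mult simp del: split_paired_All)
qed

definition whittaker_generators :: "complex \<Rightarrow> complex \<Rightarrow> free_alg set set" where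
  "whittaker_generators l mu =
     {uea_gen (loop sl2_e 0) \<ominus>\<^bsub>uea\<^esub> uea_scalar l,
       uea_gen (loop sl2_f 1) \<ominus>\<^bsub>uea\<^esub> uea_scalar mu,
       uea_gen central \<oplus>\<^bsub>uea\<^esub> uea_scalar 2} \<union>
      (\<Union>i\<in>{1..}. {uea_gen (loop sl2_e i), uea_gen (loop sl2_h i), uea_gen (loop sl2_f (i + 1))})"

lemma whittaker_ideal_eq: "whittaker_ideal l mu = left_ideal_gen uea (whittaker_generators l mu)"
  by (simp add: whittaker_ideal_def whittaker_generators_def)

lemma whittaker_generators_eq:
  "whittaker_generators l mu = uea_of ` ({free_gen (loop sl2_e 0) - free_scalar l,
       free_gen (loop sl2_f 1) - free_scalar mu, free_gen central + free_scalar 2} \<union>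
      (\<Union>i\<in>{1..}. {free_gen (loop sl2_e i), free_gen (loop sl2_h i), free_gen (loop sl2_f (i + 1))}))"
  by (simp add: whittaker_generators_def uea_gen_eq uea_scalar_eq uea_of_minus uea_of_simps image_Un image_UN)

lemma whittaker_submodule: "affine_submodule (whittaker_ideal l mu) uea_module"
  unfolding whittaker_ideal_eq
  by (rule left_ideal_uea_submodule, rule left_ideal_gen[OF ring_uea])
    (auto simp: whittaker_generators_eq carrier_uea)

lemma whittaker_generators_subset: "whittaker_generators l mu \<subseteq> whittaker_ideal l mu"
  by (auto simp: whittaker_ideal_eq left_ideal_gen_def)

lemma whittaker_vector_facts:
  shows "affine_mod (whittaker_module l mu)"
    and "is_whittaker_vector (whittaker_module l mu) (whittaker_vector l mu) l mu"
    and "generates (whittaker_module l mu) (whittaker_vector l mu)"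
proof -
  let ?J = "whittaker_ideal l mu" and ?W = "whittaker_module l mu"
  let ?\<pi> = "\<lambda>v. ?J +>\<^bsub>uea_module\<^esub> v"
  interpret U: affine_mod uea_module by (rule affine_mod_uea)
  note Q = affine_quot_properties[OF affine_mod_uea whittaker_submodule[of l mu], folded whittaker_module_def]
  interpret W: affine_mod ?W by (rule Q(1))
  show "affine_mod ?W" by (rule Q(1))
  note h = affine_homD[OF Q(2)]
  have w: "whittaker_vector l mu = ?\<pi> (uea_of 1)" by (simp add: whittaker_vector_def uea_of_simps)
  have one: "uea_of 1 \<in> carrier uea_module" by (simp add: uea_module_simps)
  show "generates ?W (whittaker_vector l mu)"
    unfolding w
  proof (rule generates_image[OF affine_mod_uea Q(1,2,3) _ one])
    show "generates uea_module (uea_of 1)" using uea_module_generated by (simp add: generates_def)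
  qed
  have minus: "uea_of a \<ominus>\<^bsub>uea_module\<^esub> uea_of b = uea_of (a - b)" for a b
    using uea_of_minus[of a b] by (simp add: uea_module_def a_minus_def a_inv_def m_inv_def)
  have eq: "?\<pi> (uea_of a) = ?\<pi> (uea_of b)" if "uea_of (a - b) \<in> whittaker_generators l mu" for a b
    using that whittaker_generators_subset[of l mu] Q(4)[of "uea_of a" "uea_of b"] by (auto simp: uea_module_simps minus)
  have act: "act ?W x (?\<pi> (uea_of 1)) = ?\<pi> (uea_of (free_gen x))" for x
    using h(4)[OF one, of x] by (simp add: uea_module_simps)
  have smult: "s \<odot>\<^bsub>?W\<^esub> ?\<pi> (uea_of 1) = ?\<pi> (uea_of (free_scalar s))" for s
    using h(3)[OF one, of s] by (simp add: uea_module_simps)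
  have zero: "\<zero>\<^bsub>?W\<^esub> = ?\<pi> (uea_of 0)"
    using affine_hom_zero[OF affine_mod_uea Q(1,2)] by (simp add: uea_module_simps)
  have G: "uea_of (free_gen (loop sl2_e 0) - free_scalar l) \<in> whittaker_generators l mu"
    "uea_of (free_gen (loop sl2_f 1) - free_scalar mu) \<in> whittaker_generators l mu"
    "uea_of (free_gen central - free_scalar (- 2)) \<in> whittaker_generators l mu"
    by (simp_all add: whittaker_generators_eq free_scalar_def single_uminus)
  have G': "uea_of (free_gen (loop sl2_e i) - 0) \<in> whittaker_generators l mu"
    "uea_of (free_gen (loop sl2_h i) - 0) \<in> whittaker_generators l mu"
    "uea_of (free_gen (loop sl2_f (i + 1)) - 0) \<in> whittaker_generators l mu" if "i \<ge> 1" for i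
    unfolding diff_0_right whittaker_generators_def uea_gen_eq using that by blast+
  show "is_whittaker_vector ?W (whittaker_vector l mu) l mu"
    unfolding is_whittaker_vector_def w act smult zero
    using h(1)[OF one] eq[OF G(1)] eq[OF G(2)] eq[OF G(3)] eq[OF G'(1)] eq[OF G'(2)] eq[OF G'(3)] by blast
qed

text \<open>
  The elements of the enveloping algebra that annihilate the Whittaker vector 1 form a left ideal, which
  contains the generators of the Whittaker ideal.
\<close>
lemma whittaker_module_hom:
  assumes N: "l \<noteq> 0" and v: "is_whittaker_vector (wak_module l chi) 1 l mu"
  obtains \<phi> where "affine_hom (whittaker_module l mu) (wak_module l chi) \<phi>" "\<phi> (whittaker_vector l mu) = 1"
proof -
  let ?P = "wak_module l chi" and ?J = "whittaker_ideal l mu"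
  interpret P: affine_mod ?P by (rule affine_mod_wak[OF N])
  obtain \<phi> where \<phi>: "affine_hom uea_module ?P \<phi>" "\<And>a. \<phi> (uea_of a) = free_act l chi a 1"
    by (rule uea_module_hom_exists[OF N]) blast
  let ?K = "{u \<in> carrier uea_module. \<phi> u = 0}"
  have K: "affine_submodule ?K uea_module"
    using affine_submodule_kernel[OF affine_mod_uea P.affine_mod_axioms \<phi>(1)] by (simp add: wak_module_simps[OF N])
  have "left_ideal ?K uea"
    unfolding left_ideal_def
  proof (intro conjI ballI)
    show "additive_subgroup ?K uea"
      using K by (simp add: affine_submodule_def submodule_def additive_subgroup_def subgroup_uea_iff)
    fix r u assume "r \<in> carrier uea" "u \<in> ?K"
    then obtain a b where "r = uea_of a" "u = uea_of b" "free_act l chi b 1 = 0"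
      by (auto simp: carrier_uea uea_module_simps \<phi>)
    then show "r \<otimes>\<^bsub>uea\<^esub> u \<in> ?K"
      using pi_linear_simps(4)[OF pi_linear_free_act[OF N]]
      by (simp add: uea_of_simps(2)[symmetric] uea_module_simps \<phi> free_act_mult[OF N])
  qed
  moreover have "whittaker_generators l mu \<subseteq> ?K"
    using v unfolding is_whittaker_vector_def
    by (auto simp: whittaker_generators_eq uea_module_simps \<phi> free_act_minus[OF N] free_act_add[OF N]
        free_act_gen[OF N] free_act_scalar[OF N] wak_module_simps[OF N] pi_const_minus)
  ultimately have "?J \<subseteq> ?K" by (auto simp: whittaker_ideal_eq left_ideal_gen_def)
  then have "\<phi> u = \<zero>\<^bsub>?P\<^esub>" if "u \<in> ?J" for u using that by (auto simp: wak_module_simps[OF N])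
  then obtain \<psi> where \<psi>: "affine_hom (affine_quot uea_module ?J) ?P \<psi>"
      "\<And>u. u \<in> carrier uea_module \<Longrightarrow> \<psi> (?J +>\<^bsub>uea_module\<^esub> u) = \<phi> u"
    using affine_quot_hom[OF affine_mod_uea P.affine_mod_axioms whittaker_submodule \<phi>(1)] by blast
  have "\<psi> (whittaker_vector l mu) = 1"
    using \<psi>(2)[of "uea_of 1"] \<phi>(2)[of 1] by (simp add: whittaker_vector_def uea_of_simps(3)[symmetric] uea_module_simps free_act_one[OF N])
  then show ?thesis using that \<psi>(1) by (simp add: whittaker_module_def)
qed

theorem theorem1p3:
  fixes l mu :: complex and c chi :: "complex fls"
  assumes "l \<noteq> 0"
    and "\<And>n. n > 0 \<Longrightarrow> mode2 c n = 0"
    and "chi = fls_const (l * mu) * fls_X_intpow (- 3) + c"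
  shows "affine_isomorphic (whittaker_quotient l mu c) (wak_module l chi)"
proof -
  let ?P = "wak_module l chi" and ?W = "whittaker_module l mu" and ?w = "whittaker_vector l mu"
  have chi: "mode2 chi n = mode2 c n + (if n = 1 then l * mu else 0)" for n
    by (auto simp: assms(3) mode2_def)
  interpret P: affine_mod ?P by (rule affine_mod_wak[OF assms(1)])
  note W = whittaker_vector_facts[of l mu]
  interpret W: affine_mod ?W by (rule W(1))
  have w: "?w \<in> carrier ?W" using W(2) by (simp add: is_whittaker_vector_def)
  have "mode2 chi 1 / l = mu" using assms(1,2) by (simp add: chi)
  then have "is_whittaker_vector ?P 1 l mu"
    using whittaker_vector_wak[OF assms(1), of chi] assms(2) by (simp add: chi)
  then obtain \<phi> where \<phi>: "affine_hom ?W ?P \<phi>" "\<phi> ?w = 1"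
    by (rule whittaker_module_hom[OF assms(1)])
  note fin = whittaker_sugawara_finite[OF W(1,2)]
  have sug_closed: "sugawara ?W n ?w \<in> carrier ?W" for n
    unfolding W.sugawara_eq using w by (intro W.smult_mem W.finsum_closed) auto
  define S where "S = {sugawara ?W n ?w \<ominus>\<^bsub>?W\<^esub> mode2 c n \<odot>\<^bsub>?W\<^esub> ?w | n. n \<le> 0}"
  have S: "S \<subseteq> carrier ?W" using sug_closed w by (auto simp: S_def)
  define H where "H = affine_submodule_gen ?W S"
  have H: "affine_submodule H ?W" "S \<subseteq> H"
    unfolding H_def by (rule W.affine_submodule_gen[OF S])+
  have M: "whittaker_quotient l mu c = affine_quot ?W H"
    by (simp add: whittaker_quotient_def H_def S_def Let_def)
  let ?M = "affine_quot ?W H" and ?\<pi> = "\<lambda>v. H +>\<^bsub>?W\<^esub> v"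
  note Q = affine_quot_properties[OF W(1) H(1)]
  interpret M: affine_mod ?M by (rule Q(1))
  note h = affine_homD[OF Q(2)]
  have "S \<subseteq> {v \<in> carrier ?W. \<phi> v = \<zero>\<^bsub>?P\<^esub>}"
  proof -
    have "\<phi> (sugawara ?W n ?w \<ominus>\<^bsub>?W\<^esub> mode2 c n \<odot>\<^bsub>?W\<^esub> ?w) = 0" if "n \<le> 0" for n
      using affine_hom_minus[OF W(1) P.affine_mod_axioms \<phi>(1), of "sugawara ?W n ?w" "mode2 c n \<odot>\<^bsub>?W\<^esub> ?w"]
        affine_hom_sugawara[OF W(1) P.affine_mod_axioms \<phi>(1) w fin[of n]] affine_homD(3)[OF \<phi>(1) w] that w sug_closed
      by (simp add: \<phi>(2) wak_module_simps[OF assms(1)] sugawara_wak[OF assms(1)] chi)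
    then show ?thesis using S by (auto simp: S_def wak_module_simps[OF assms(1)])
  qed
  then have "H \<subseteq> {v \<in> carrier ?W. \<phi> v = \<zero>\<^bsub>?P\<^esub>}"
    using affine_submodule_kernel[OF W(1) P.affine_mod_axioms \<phi>(1)] by (auto simp: H_def affine_submodule_gen_def)
  then have "\<phi> v = \<zero>\<^bsub>?P\<^esub>" if "v \<in> H" for v using that by auto
  then obtain \<psi> where \<psi>: "affine_hom ?M ?P \<psi>" "\<And>v. v \<in> carrier ?W \<Longrightarrow> \<psi> (?\<pi> v) = \<phi> v"
    using affine_quot_hom[OF W(1) P.affine_mod_axioms H(1) \<phi>(1)] by blast
  have data: "whittaker_module_data ?M (?\<pi> ?w) l mu chi"
  proof (intro whittaker_module_data.intro whittaker_module_data_axioms.intro Q(1) assms(1))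
    show "is_whittaker_vector ?M (?\<pi> ?w) l mu" by (rule whittaker_vector_hom[OF W(1) Q(1,2) W(2)])
    show "generates ?M (?\<pi> ?w)" by (rule generates_image[OF W(1) Q(1-3) W(3) w])
    fix n :: int assume n: "n \<le> 0"
    have "?\<pi> (sugawara ?W n ?w) = ?\<pi> (mode2 c n \<odot>\<^bsub>?W\<^esub> ?w)"
      using Q(4)[of "sugawara ?W n ?w" "mode2 c n \<odot>\<^bsub>?W\<^esub> ?w"] sug_closed w H(2) n by (auto simp: S_def)
    then show "sugawara ?M n (?\<pi> ?w) = mode2 chi n \<odot>\<^bsub>?M\<^esub> ?\<pi> ?w"
      using affine_hom_sugawara[OF W(1) Q(1,2) w fin[of n]] h(3)[OF w] n by (simp add: chi)
  qed
  have "bij_betw \<psi> (carrier ?M) (carrier ?P)"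
    using whittaker_module_data.\<phi>_bij[OF data \<psi>(1)] \<psi>(2)[OF w] \<phi>(2) by (simp add: wak_module_simps[OF assms(1)])
  then have "\<psi> \<in> affine_module_iso ?M ?P"
    using \<psi>(1) by (simp add: affine_module_iso_def affine_hom_def)
  then show ?thesis
    using Q(1) P.affine_mod_axioms unfolding affine_isomorphic_def M affine_mod_iff by blast
qed

end
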